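(* Let $L \subset [0,1)$ be a compact interval, let $k \geq 2$, and let $\mathcal{I} = \{I_1, \dots, I_k\}$ be a collection of pairwise disjoint compact intervals with union $I = I_1 \cup \dots \cup I_k \subset L$. Let $M > 0$. Then there exists $\epsilon > 0$, depending only on $\{|I_j|/|L| : j = 1, \dots, k\}$ and $M$, such that if $S \in \mathcal{S}^2(\mathcal{I}, L)$ satisfies $|S''| < M$ on $I$ and $\mathcal{N}(S) < \epsilon$, then the Cantor set $C_S$ is not $C^1$-minimal.
   Context: The circle is $\mathbf{R}/\mathbf{Z}$ with coordinates $[0,1)$, so that subsets of $[0,1)$ are regarded as subsets of the circle. For an interval $J$, $|J|$ denotes its length; all intervals are nondegenerate. Given a compact interval $L \subset [0,1)$ and a collection $\mathcal{I} = \{I_1, \dots, I_k\}$, $k \ge 2$, of pairwise disjoint compact intervals with union $I \subset L$, $\mathcal{S}^r(\mathcal{I}, L)$ is the set of $C^r$ functions $S : I \to L$ such that $|S'| > 1$ on $I$ and $S[I_j] = L$ for each $j = 1, \dots, k$. The nonlinearity of such an $S$ is $\mathcal{N}(S) = \max_j \sup\{\log(S'(x)/S'(y)) : x, y \in I_j\}$ (note that $S'$ has constant sign on each $I_j$). Any $S \in \mathcal{S}^r(\mathcal{I}, L)$ has a unique maximal invariant set, which is a Cantor set: $C_S = \{x \in I : S^n(x) \in I \text{ for all } n > 0\}$, where $S^n$ is the $n$-fold iterate. A Cantor set in the circle is called $C^1$-minimal if it is the minimal set of some $C^1$ diffeomorphism of the circle $\mathbf{R}/\mathbf{Z}$. 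*)

theory Defs
  imports "HOL-Analysis.Analysis"
begin

definition compact_interval :: "real set \<Rightarrow> bool" where
  "compact_interval J \<longleftrightarrow> (\<exists>a b. a < b \<and> J = {a..b})"

abbreviation len :: "real set \<Rightarrow> real" where
  "len J \<equiv> measure lborel J"

text \<open>The pairs \<open>(\<I>, L)\<close>; the number \<open>k\<close> of intervals is \<open>card \<I>\<close>
  (and \<open>card \<I> \<ge> 2\<close> forces \<open>\<I>\<close> to be finite).\<close>

definition interval_system :: "real set set \<Rightarrow> real set \<Rightarrow> bool" where
  "interval_system \<I> L \<longleftrightarrow>
     compact_interval L \<and> L \<subseteq> {0..<1} \<and>
     card \<I> \<ge> 2 \<and> (\<forall>J\<in>\<I>. compact_interval J) \<and> disjoint \<I> \<and> \<Union>\<I> \<subseteq> L"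

text \<open>Derivatives are taken within the domain \<open>A\<close>, hence are one-sided at the endpoints of
  its components. They are well defined when \<open>A\<close> is a finite union of nondegenerate intervals.\<close>

fun nth_deriv :: "real set \<Rightarrow> nat \<Rightarrow> (real \<Rightarrow> real) \<Rightarrow> real \<Rightarrow> real" where
  "nth_deriv A 0 f = f"
| "nth_deriv A (Suc n) f = (\<lambda>x. vector_derivative (nth_deriv A n f) (at x within A))"

definition C_on :: "nat \<Rightarrow> real set \<Rightarrow> (real \<Rightarrow> real) \<Rightarrow> bool" where
  "C_on r A f \<longleftrightarrow>
     (\<forall>n<r. nth_deriv A n f differentiable_on A) \<and> continuous_on A (nth_deriv A r f)"

definition expanding_maps :: "nat \<Rightarrow> real set set \<Rightarrow> real set \<Rightarrow> (real \<Rightarrow> real) set" where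
  "expanding_maps r \<I> L =
     {S. C_on r (\<Union>\<I>) S \<and> (\<forall>x\<in>\<Union>\<I>. \<bar>nth_deriv (\<Union>\<I>) 1 S x\<bar> > 1) \<and> (\<forall>J\<in>\<I>. S ` J = L)}"

definition nonlinearity :: "real set set \<Rightarrow> (real \<Rightarrow> real) \<Rightarrow> real" where
  "nonlinearity \<I> S =
     Max ((\<lambda>J. Sup {ln (nth_deriv (\<Union>\<I>) 1 S x / nth_deriv (\<Union>\<I>) 1 S y) | x y. x \<in> J \<and> y \<in> J}) ` \<I>)"

text \<open>The values of \<open>S\<close> off \<open>\<Union>\<I>\<close> are irrelevant here: the condition for all
  smaller iterates keeps the orbit inside \<open>\<Union>\<I>\<close>.\<close>

definition max_invariant :: "real set set \<Rightarrow> (real \<Rightarrow> real) \<Rightarrow> real set" where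
  "max_invariant \<I> S = {x \<in> \<Union>\<I>. \<forall>n>0. (S ^^ n) x \<in> \<Union>\<I>}"

text \<open>The circle \<open>\<real>/\<int>\<close> is represented by \<open>{0..<1}\<close> with quotient projection
  \<open>frac\<close>. A set is closed in the quotient topology iff its preimage is closed in \<open>\<real>\<close>,
  and a circle map is \<open>C\<^sup>1\<close> iff it has a \<open>C\<^sup>1\<close> lift to \<open>\<real>\<close>; in particular
  orientation-reversing diffeomorphisms are included.\<close>

definition circle :: "real set" where
  "circle = {0..<1}"

definition circle_closed :: "real set \<Rightarrow> bool" where
  "circle_closed K \<longleftrightarrow> K \<subseteq> circle \<and> closed (frac -` K)"

definition circle_C1 :: "(real \<Rightarrow> real) \<Rightarrow> bool" where
  "circle_C1 f \<longleftrightarrow> f ` circle \<subseteq> circle \<and>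
     (\<exists>F. F C1_differentiable_on UNIV \<and> (\<forall>x. f (frac x) = frac (F x)))"

definition circle_C1_diffeo :: "(real \<Rightarrow> real) \<Rightarrow> bool" where
  "circle_C1_diffeo f \<longleftrightarrow>
     bij_betw f circle circle \<and> circle_C1 f \<and> circle_C1 (inv_into circle f)"

definition minimal_set :: "(real \<Rightarrow> real) \<Rightarrow> real set \<Rightarrow> bool" where
  "minimal_set f K \<longleftrightarrow>
     K \<noteq> {} \<and> circle_closed K \<and> f ` K = K \<and>
     (\<forall>K'. K' \<noteq> {} \<and> circle_closed K' \<and> f ` K' = K' \<and> K' \<subseteq> K \<longrightarrow> K' = K)"

text \<open>Uniqueness of the minimal set is not part of the definition: a circle homeomorphism with an
  infinite minimal set has only one.\<close>

definition C1_minimal :: "real set \<Rightarrow> bool" where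
  "C1_minimal K \<longleftrightarrow> (\<exists>f. circle_C1_diffeo f \<and> minimal_set f K)"

end

theory Submission
  imports Defs
begin

text \<open>Suppose a \<open>C\<^sup>1\<close> diffeomorphism \<open>f\<close> has \<open>C = C\<^sub>S\<close> as minimal set. Near \<open>x \<in> C\<close> rescale \<open>f\<close> by
  iterates of \<open>S\<close>, from a deep cylinder around \<open>x\<close> and from the smallest cylinder containing its
  image, to maps \<open>h\<^sub>n : C \<rightarrow> C\<close>. All iterates of \<open>S\<close> have distortion at most \<open>\<delta>\<close>, where \<open>\<delta>\<close> is small
  with \<open>\<epsilon>\<close> (the bound on \<open>S''\<close> controls all but the last few steps), so the \<open>h\<^sub>n\<close> are nearly affine;
  they also map gaps of \<open>C\<close> to gaps. Uniform porosity of \<open>C\<close> makes such a map rigid: it is determined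
  by its values at the ends of one gap. As these have finitely many possible values, some \<open>h\<close>
  equals \<open>h\<^sub>n\<close> for infinitely many \<open>n\<close>, and letting \<open>n \<rightarrow> \<infinity>\<close> shows that on \<open>C\<close> the logarithmic
  difference quotients of \<open>f\<close> are as regular as those of \<open>S\<close>, namely Lipschitz. Denjoy's theorem
  in Schwartz's form then excludes \<open>C\<close> as a minimal set.\<close>

text \<open>As \<open>f\<close> is only C^1 and nothing is known about it inside the gaps, Denjoy's
  variation argument on the whole circle is out of reach. Everything is therefore expressed by
  difference quotients at points of the Cantor set. Schwartz's argument needs no more than a gap
  with summable orbit and a distortion that is linear in the spread, and both make sense there. The
  constants must not depend on each other in a circle. Of \<open>\<delta>\<close>, the porosity
  estimate uses only \<open>exp \<delta> \<le> 2\<close>, so the porosity constant comes from the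
  length ratios alone. \<open>\<delta>\<close> is fitted to it: a renormalised map has three factors
  of distortion at most \<open>\<delta>\<close>, whence the condition on
  \<open>exp (2 * (3 * \<delta>))\<close>. \<open>\<epsilon>\<close> is fitted to
  \<open>\<delta>\<close>, \<open>M\<close> and the ratios. A renormalised map that recurs exactly,
  not merely as a limit, allows the way back from infinite depth: it is estimated at large depths,
  where \<open>f\<close> is almost affine, while \<open>f\<close> is recovered from it at one fixed
  depth by an inverse branch and an iterate of \<open>S\<close>.\<close>

subsection \<open>Distortion, monotone maps and gaps\<close>

text \<open>The logarithms of the difference quotients of \<open>h\<close> on \<open>B\<close> vary
  by at most \<open>c\<close>. The cross-multiplied form needs no exception for coinciding points
  and no derivative, so it applies to maps between Cantor sets.\<close>

definition distortion_le :: "(real \<Rightarrow> real) \<Rightarrow> real set \<Rightarrow> real \<Rightarrow> bool" where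
  "distortion_le h B c \<longleftrightarrow>
     (\<forall>u\<in>B. \<forall>v\<in>B. \<forall>s\<in>B. \<forall>t\<in>B. \<bar>h u - h v\<bar> * \<bar>s - t\<bar> \<le> exp c * (\<bar>h s - h t\<bar> * \<bar>u - v\<bar>))"

definition spread_le :: "real set \<Rightarrow> real \<Rightarrow> bool" where
  "spread_le B D \<longleftrightarrow> (\<forall>p\<in>B. \<forall>q\<in>B. \<bar>p - q\<bar> \<le> D)"

definition monotonic :: "real set \<Rightarrow> (real \<Rightarrow> real) \<Rightarrow> bool" where
  "monotonic A h \<longleftrightarrow> (\<exists>s\<in>{-1, 1}. \<forall>u\<in>A. \<forall>v\<in>A. u < v \<longrightarrow> s * h u < s * h v)"

text \<open>The ends of a gap, in either order, so that orientation-reversing maps preserve the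
  relation.\<close>

definition adjacent :: "real set \<Rightarrow> real \<Rightarrow> real \<Rightarrow> bool" where
  "adjacent C u v \<longleftrightarrow> u \<in> C \<and> v \<in> C \<and> u \<noteq> v \<and> open_segment u v \<inter> C = {}"

lemma in_open_segment_real:
  "z \<in> open_segment u v \<longleftrightarrow> (u < z \<and> z < v) \<or> (v < z \<and> z < (u::real))"
  by (auto simp: open_segment_eq_real_ivl)

lemma in_closed_segment_real:
  "z \<in> closed_segment u v \<longleftrightarrow> (u \<le> z \<and> z \<le> v) \<or> (v \<le> z \<and> z \<le> (u::real))"
  by (auto simp: closed_segment_eq_real_ivl)

section \<open>Calculus of distortion\<close>

lemma distortion_leD:
  "\<lbrakk>distortion_le h B c; u \<in> B; v \<in> B; s \<in> B; t \<in> B\<rbrakk>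
     \<Longrightarrow> \<bar>h u - h v\<bar> * \<bar>s - t\<bar> \<le> exp c * (\<bar>h s - h t\<bar> * \<bar>u - v\<bar>)"
  unfolding distortion_le_def by blast

lemma distortion_le_subset: "distortion_le h B c \<Longrightarrow> A \<subseteq> B \<Longrightarrow> distortion_le h A c"
  unfolding distortion_le_def by blast

lemma distortion_le_mono:
  assumes "distortion_le h B c" "c \<le> d"
  shows "distortion_le h B d"
  unfolding distortion_le_def
proof (intro ballI)
  fix u v s t assume "u \<in> B" "v \<in> B" "s \<in> B" "t \<in> B"
  then have "\<bar>h u - h v\<bar> * \<bar>s - t\<bar> \<le> exp c * (\<bar>h s - h t\<bar> * \<bar>u - v\<bar>)"
    using assms(1) distortion_leD by blast
  also have "\<dots> \<le> exp d * (\<bar>h s - h t\<bar> * \<bar>u - v\<bar>)"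
    using assms(2) by (intro mult_right_mono) auto
  finally show "\<bar>h u - h v\<bar> * \<bar>s - t\<bar> \<le> exp d * (\<bar>h s - h t\<bar> * \<bar>u - v\<bar>)" .
qed

lemma distortion_le_cong:
  "\<lbrakk>distortion_le h B c; \<And>u. u \<in> B \<Longrightarrow> h u = k u\<rbrakk> \<Longrightarrow> distortion_le k B c"
  unfolding distortion_le_def by simp

text \<open>Difference quotients multiply, so their logarithmic variations add. Injectivity allows
  the common factor \<open>\<bar>h s - h t\<bar>\<close> to be cancelled.\<close>

lemma distortion_le_comp:
  assumes h: "distortion_le h B c" and g: "distortion_le g (h ` B) d" and inj: "inj_on h B"
  shows "distortion_le (g \<circ> h) B (c + d)"
  unfolding distortion_le_def
proof (intro ballI)
  fix u v s t assume B: "u \<in> B" "v \<in> B" "s \<in> B" "t \<in> B"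
  show "\<bar>(g \<circ> h) u - (g \<circ> h) v\<bar> * \<bar>s - t\<bar>
          \<le> exp (c + d) * (\<bar>(g \<circ> h) s - (g \<circ> h) t\<bar> * \<bar>u - v\<bar>)"
  proof (cases "s = t")
    case True
    then show ?thesis by simp
  next
    case False
    then have pos: "0 < \<bar>h s - h t\<bar>" using inj B by (auto dest: inj_onD)
    have "\<bar>h s - h t\<bar> * (\<bar>g (h u) - g (h v)\<bar> * \<bar>s - t\<bar>)
        = (\<bar>g (h u) - g (h v)\<bar> * \<bar>h s - h t\<bar>) * \<bar>s - t\<bar>" by (simp add: mult_ac)
    also have "\<dots> \<le> (exp d * (\<bar>g (h s) - g (h t)\<bar> * \<bar>h u - h v\<bar>)) * \<bar>s - t\<bar>"
      by (intro mult_right_mono distortion_leD[OF g]) (use B in auto)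
    also have "\<dots> = exp d * \<bar>g (h s) - g (h t)\<bar> * (\<bar>h u - h v\<bar> * \<bar>s - t\<bar>)" by (simp add: mult_ac)
    also have "\<dots> \<le> exp d * \<bar>g (h s) - g (h t)\<bar> * (exp c * (\<bar>h s - h t\<bar> * \<bar>u - v\<bar>))"
      by (intro mult_left_mono distortion_leD[OF h]) (use B in auto)
    also have "\<dots> = \<bar>h s - h t\<bar> * (exp (c + d) * (\<bar>g (h s) - g (h t)\<bar> * \<bar>u - v\<bar>))"
      by (simp add: exp_add mult_ac)
    finally show ?thesis using pos by simp
  qed
qed

lemma distortion_le_inverse:
  assumes "distortion_le h B c" "\<And>u. u \<in> B \<Longrightarrow> k (h u) = u"
  shows "distortion_le k (h ` B) c"
  unfolding distortion_le_def
proof (intro ballI)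
  fix u v s t assume "u \<in> h ` B" "v \<in> h ` B" "s \<in> h ` B" "t \<in> h ` B"
  then obtain u' v' s' t' where
    B: "u' \<in> B" "v' \<in> B" "s' \<in> B" "t' \<in> B" "u = h u'" "v = h v'" "s = h s'" "t = h t'" by blast
  then show "\<bar>k u - k v\<bar> * \<bar>s - t\<bar> \<le> exp c * (\<bar>k s - k t\<bar> * \<bar>u - v\<bar>)"
    using distortion_leD[OF assms(1) B(3,4,1,2)] assms(2) by (simp add: mult_ac)
qed

text \<open>This removes the contribution of \<open>f\<close>, which is arbitrarily small at large
  depth.\<close>

lemma distortion_le_limit:
  assumes "\<And>\<eta>. \<eta> > 0 \<Longrightarrow> distortion_le h B (c + \<eta>)"
  shows "distortion_le h B c"
  unfolding distortion_le_def
proof (intro ballI)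
  fix u v s t assume B: "u \<in> B" "v \<in> B" "s \<in> B" "t \<in> B"
  let ?X = "\<bar>h u - h v\<bar> * \<bar>s - t\<bar>" and ?Y = "\<bar>h s - h t\<bar> * \<bar>u - v\<bar>"
  have lim: "((\<lambda>\<eta>. exp (c + \<eta>) * ?Y) \<longlongrightarrow> exp (c + 0) * ?Y) (at_right 0)"
    by (intro tendsto_intros)
  have "\<forall>\<^sub>F \<eta> in at_right 0. ?X \<le> exp (c + \<eta>) * ?Y"
    using eventually_at_right_less[of "0::real"]
    by eventually_elim (use assms B distortion_leD in blast)
  with lim have "?X \<le> exp (c + 0) * ?Y"
    by (intro tendsto_lowerbound[OF lim]) auto
  then show "?X \<le> exp c * ?Y" by simp
qed

section \<open>Monotone maps\<close>

lemma monotonic_inj_on: "monotonic A h \<Longrightarrow> inj_on h A"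
  unfolding monotonic_def inj_on_def by (metis less_irrefl linorder_neqE_linordered_idom)

lemma monotonic_subset: "monotonic A h \<Longrightarrow> B \<subseteq> A \<Longrightarrow> monotonic B h"
  unfolding monotonic_def by blast

lemma monotonic_comp:
  assumes "monotonic A h" "monotonic (h ` A) g"
  shows "monotonic A (g \<circ> h)"
proof -
  obtain s where s: "s = -1 \<or> s = 1" "\<And>u v. \<lbrakk>u \<in> A; v \<in> A; u < v\<rbrakk> \<Longrightarrow> s * h u < s * h v"
    using assms(1) unfolding monotonic_def by blast
  obtain t where t: "t = -1 \<or> t = 1"
    "\<And>u v. \<lbrakk>u \<in> A; v \<in> A; h u < h v\<rbrakk> \<Longrightarrow> t * g (h u) < t * g (h v)"
    using assms(2) unfolding monotonic_def by blast
  have "\<forall>u\<in>A. \<forall>v\<in>A. u < v \<longrightarrow> (s * t) * (g \<circ> h) u < (s * t) * (g \<circ> h) v"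
    using s t by fastforce
  moreover have "s * t \<in> {-1, 1}" using s(1) t(1) by auto
  ultimately show ?thesis unfolding monotonic_def by blast
qed

lemma monotonic_inverse:
  assumes "monotonic A h" "\<And>u. u \<in> A \<Longrightarrow> k (h u) = u"
  shows "monotonic (h ` A) k"
proof -
  obtain s where s: "s = -1 \<or> s = 1" "\<And>u v. \<lbrakk>u \<in> A; v \<in> A; u < v\<rbrakk> \<Longrightarrow> s * h u < s * h v"
    using assms(1) unfolding monotonic_def by blast
  have "s * u < s * v" if "u \<in> A" "v \<in> A" "h u < h v" for u v
    using s(1) s(2)[of u v] s(2)[of v u] that by (cases u v rule: linorder_cases) auto
  then show ?thesis unfolding monotonic_def using s(1) assms(2) by (intro bexI[of _ s]) auto
qed

lemma monotonic_cases:
  assumes "monotonic A h"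
  obtains "\<And>x y. \<lbrakk>x \<in> A; y \<in> A\<rbrakk> \<Longrightarrow> h x < h y \<longleftrightarrow> x < y"
  | "\<And>x y. \<lbrakk>x \<in> A; y \<in> A\<rbrakk> \<Longrightarrow> h x < h y \<longleftrightarrow> y < x"
proof -
  obtain s where s: "s = -1 \<or> s = 1" "\<And>u v. \<lbrakk>u \<in> A; v \<in> A; u < v\<rbrakk> \<Longrightarrow> s * h u < s * h v"
    using assms unfolding monotonic_def by blast
  have *: "s * h x < s * h y \<longleftrightarrow> x < y" if "x \<in> A" "y \<in> A" for x y
    using s(2)[OF that] s(2)[OF that(2,1)] by (cases x y rule: linorder_cases) auto
  from s(1) show thesis
  proof
    assume "s = 1"
    with * that(1) show thesis by simp
  next
    assume "s = -1"
    with * have "h x < h y \<longleftrightarrow> y < x" if "x \<in> A" "y \<in> A" for x y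
      using that by simp
    with that(2) show thesis by blast
  qed
qed

lemma monotonic_open_segment:
  assumes "monotonic A h" "u \<in> A" "v \<in> A" "z \<in> A"
  shows "h z \<in> open_segment (h u) (h v) \<longleftrightarrow> z \<in> open_segment u v"
  using assms(1)
proof (cases rule: monotonic_cases)
  case 1
  with assms show ?thesis by (simp add: in_open_segment_real)
next
  case 2
  with assms show ?thesis by (simp add: in_open_segment_real disj_commute conj_commute)
qed

lemma monotonic_closed_segment:
  assumes "monotonic A h" "u \<in> A" "v \<in> A" "z \<in> A"
  shows "h z \<in> closed_segment (h u) (h v) \<longleftrightarrow> z \<in> closed_segment u v"
proof -
  have "h z = h u \<longleftrightarrow> z = u" "h z = h v \<longleftrightarrow> z = v"
    using monotonic_inj_on[OF assms(1)] assms by (auto dest: inj_onD)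
  then show ?thesis
    using monotonic_open_segment[OF assms]
    by (auto simp: closed_segment_eq_open)
qed

lemma monotonic_same_side:
  assumes "monotonic A h" "e \<in> A" "p \<in> A" "z \<in> A" "(z - e) * (p - e) \<ge> 0"
  shows "(h z - h e) * (h p - h e) \<ge> 0"
  using assms(1)
proof (cases rule: monotonic_cases)
  case 1
  then have "h x \<le> h y \<longleftrightarrow> x \<le> y" if "x \<in> A" "y \<in> A" for x y
    using that by (simp flip: linorder_not_less)
  with assms show ?thesis by (simp add: zero_le_mult_iff)
next
  case 2
  then have "h x \<le> h y \<longleftrightarrow> y \<le> x" if "x \<in> A" "y \<in> A" for x y
    using that by (simp flip: linorder_not_less)
  with assms show ?thesis by (simp add: zero_le_mult_iff disj_commute)
qed

text \<open>A monotone map preserves betweenness within \<open>A\<close>. Convexity relative to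
  \<open>C\<close>, needed only on the two segments in question, excludes further points of
  \<open>C\<close> there. The lemma serves for cylinders and for the lift of the Cantor set.\<close>

lemma adjacent_image_iff:
  assumes "monotonic A h" "A \<subseteq> C" "h ` A \<subseteq> C" "u \<in> A" "v \<in> A"
    and A: "\<And>z. \<lbrakk>z \<in> C; z \<in> open_segment u v\<rbrakk> \<Longrightarrow> z \<in> A"
    and hA: "\<And>z. \<lbrakk>z \<in> C; z \<in> open_segment (h u) (h v)\<rbrakk> \<Longrightarrow> z \<in> h ` A"
  shows "adjacent C (h u) (h v) \<longleftrightarrow> adjacent C u v"
proof -
  have "h u = h v \<longleftrightarrow> u = v" using monotonic_inj_on assms by (auto dest: inj_onD)
  moreover have "open_segment (h u) (h v) \<inter> C = {} \<longleftrightarrow> open_segment u v \<inter> C = {}"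
    using monotonic_open_segment[OF assms(1,4,5)] A hA assms(2,3) by blast
  ultimately show ?thesis using assms unfolding adjacent_def by auto
qed

text \<open>Two open gaps are equal or disjoint. With the same orientation and starting points
  closer than either length, they overlap.\<close>

lemma adjacent_eqI:
  assumes "adjacent C u v" "adjacent C u' v'" "(v - u) * (v' - u') > 0"
    "\<bar>u - u'\<bar> < \<bar>u - v\<bar>" "\<bar>u - u'\<bar> < \<bar>u' - v'\<bar>"
  shows "u = u' \<and> v = v'"
proof -
  have *: "\<not> (u < z \<and> z < v)" "\<not> (v < z \<and> z < u)" "\<not> (u' < z \<and> z < v')" "\<not> (v' < z \<and> z < u')"
    if "z \<in> C" for z
    using assms(1,2) that unfolding adjacent_def in_open_segment_real[symmetric] disjoint_iff
    by (auto simp: in_open_segment_real)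
  have C: "u \<in> C" "v \<in> C" "u' \<in> C" "v' \<in> C" using assms unfolding adjacent_def by auto
  from assms(3) consider "u < v" "u' < v'" | "v < u" "v' < u'"
    by (auto simp: zero_less_mult_iff)
  then show ?thesis
  proof cases
    case 1
    then have "u = u'" using *[OF C(1)] *[OF C(3)] assms(4,5) by linarith
    with 1 show ?thesis using *[OF C(2)] *[OF C(4)] by linarith
  next
    case 2
    then have "u = u'" using *[OF C(1)] *[OF C(3)] assms(4,5) by linarith
    with 2 show ?thesis using *[OF C(2)] *[OF C(4)] by linarith
  qed
qed

text \<open>Rounding both ends to the grid of mesh \<open>k\<close> is injective on these gaps,
  because gaps with the same rounding overlap.\<close>

lemma finite_large_gaps:
  assumes C: "C \<subseteq> {0..1::real}" and "k > 0"
  shows "finite {(u, v). adjacent C u v \<and> k \<le> \<bar>u - v\<bar>}"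
proof -
  let ?G = "{(u, v). adjacent C u v \<and> k \<le> \<bar>u - v\<bar>}"
  let ?\<phi> = "\<lambda>(u, v). (\<lfloor>u / k\<rfloor>, \<lfloor>v / k\<rfloor>)"
  have close: "\<bar>x - y\<bar> < k" if "\<lfloor>x / k\<rfloor> = \<lfloor>y / k\<rfloor>" for x y
  proof -
    have "\<bar>x / k - y / k\<bar> < 1" using that by linarith
    then have "\<bar>x - y\<bar> / k < 1" using \<open>k > 0\<close> by (simp add: diff_divide_distrib[symmetric])
    then show ?thesis using \<open>k > 0\<close> by simp
  qed
  have "inj_on ?\<phi> ?G"
  proof (rule inj_onI, clarsimp)
    fix u v u' v'
    assume a: "adjacent C u v" "k \<le> \<bar>u - v\<bar>" "adjacent C u' v'" "k \<le> \<bar>u' - v'\<bar>"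
      and fl: "\<lfloor>u / k\<rfloor> = \<lfloor>u' / k\<rfloor>" "\<lfloor>v / k\<rfloor> = \<lfloor>v' / k\<rfloor>"
    have ne: "\<lfloor>u / k\<rfloor> \<noteq> \<lfloor>v / k\<rfloor>" using close a(2) by force
    have mono: "x \<le> y \<Longrightarrow> \<lfloor>x / k\<rfloor> \<le> \<lfloor>y / k\<rfloor>" for x y
      using \<open>k > 0\<close> by (intro floor_mono divide_right_mono) auto
    \<comment> \<open>The ends of a long gap round to different grid points, so the rounding
      determines the orientation.\<close>
    have "(v - u) * (v' - u') > 0"
      using mono[of u v] mono[of v u] mono[of u' v'] mono[of v' u'] ne fl
      unfolding zero_less_mult_iff by linarith
    with a show "u = u' \<and> v = v'"
      using close[OF fl(1)] by (intro adjacent_eqI) auto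
  qed
  moreover have "?\<phi> ` ?G \<subseteq> {0..\<lfloor>1 / k\<rfloor>} \<times> {0..\<lfloor>1 / k\<rfloor>}"
  proof -
    have "\<lfloor>x / k\<rfloor> \<in> {0..\<lfloor>1 / k\<rfloor>}" if "x \<in> C" for x
    proof -
      have "0 \<le> x / k" "x / k \<le> 1 / k" using that C \<open>k > 0\<close> by (auto simp: divide_right_mono subset_iff)
      then show ?thesis using floor_mono[of "x / k" "1 / k"] by simp
    qed
    then show ?thesis unfolding adjacent_def by auto
  qed
  ultimately show ?thesis
    by (meson finite_SigmaI finite_atLeastAtMost_int finite_imageD finite_subset)
qed

section \<open>Porosity and rigidity\<close>

definition porous_between :: "real set \<Rightarrow> real \<Rightarrow> real \<Rightarrow> real \<Rightarrow> bool" where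
  "porous_between C \<sigma> p q \<longleftrightarrow>
     (\<exists>u v. adjacent C u v \<and> u \<in> closed_segment p q \<and> v \<in> closed_segment p q \<and> \<sigma> * \<bar>p - q\<bar> \<le> \<bar>u - v\<bar>)"

lemma porous_between_commute: "porous_between C \<sigma> p q \<longleftrightarrow> porous_between C \<sigma> q p"
  by (simp add: porous_between_def closed_segment_commute abs_minus_commute)

lemma porous_between_weaken:
  assumes "porous_between C \<sigma> p' q'" "p' \<in> closed_segment p q" "q' \<in> closed_segment p q"
    "\<sigma>' * \<bar>p - q\<bar> \<le> \<sigma> * \<bar>p' - q'\<bar>"
  shows "porous_between C \<sigma>' p q"
proof -
  have "closed_segment p' q' \<subseteq> closed_segment p q"
    using assms(2,3) by (simp add: subset_closed_segment)
  then show ?thesis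
    using assms(1,4) unfolding porous_between_def by (meson order_trans subsetD)
qed

text \<open>At the point of agreement nearest to a hypothetical disagreement, porosity provides a gap
  whose two images overlap, hence coincide, so that its endpoints are points of agreement too.\<close>

lemma porous_rigidity:
  assumes C: "compact C" and por: "\<And>p q. \<lbrakk>p \<in> C; q \<in> C; p \<noteq> q\<rbrakk> \<Longrightarrow> porous_between C \<sigma> p q"
    and \<sigma>: "exp (2 * c) < 1 + \<sigma>"
    and h: "h ` C \<subseteq> C" "monotonic C h" "distortion_le h C c"
    "\<And>u v. adjacent C u v \<Longrightarrow> adjacent C (h u) (h v)"
    and k: "k ` C \<subseteq> C" "monotonic C k" "distortion_le k C c"
    "\<And>u v. adjacent C u v \<Longrightarrow> adjacent C (k u) (k v)"
    and ab: "a \<in> C" "b \<in> C" "a \<noteq> b" "h a = k a" "h b = k b"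
    and "x \<in> C"
  shows "h x = k x"
proof (rule ccontr)
  assume neq: "h x \<noteq> k x"
  \<comment> \<open>\<open>l\<close> is the slope that both maps have between \<open>a\<close> and
    \<open>b\<close>. Bounded distortion confines all difference quotients of both to the range from
    \<open>exp (- c) * l\<close> to \<open>exp c * l\<close>.\<close>
  define l where "l = \<bar>h a - h b\<bar> / \<bar>a - b\<bar>"
  have "h a \<noteq> h b" using ab(1-3) monotonic_inj_on[OF h(2)] by (meson inj_onD)
  then have l: "l > 0" using ab by (simp add: l_def)
  have bounds: "\<bar>g u - g v\<bar> \<le> exp c * l * \<bar>u - v\<bar>" "exp (- c) * l * \<bar>u - v\<bar> \<le> \<bar>g u - g v\<bar>"
    if "g = h \<or> g = k" "u \<in> C" "v \<in> C" for g u v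
  proof -
    have g: "distortion_le g C c" "\<bar>g a - g b\<bar> = l * \<bar>a - b\<bar>"
      using that h k ab by (auto simp: l_def)
    have "\<bar>g u - g v\<bar> * \<bar>a - b\<bar> \<le> (exp c * l * \<bar>u - v\<bar>) * \<bar>a - b\<bar>"
      using distortion_leD[OF g(1) that(2,3) ab(1,2)] g(2) by (simp add: mult_ac)
    then show "\<bar>g u - g v\<bar> \<le> exp c * l * \<bar>u - v\<bar>" using ab(3) by simp
    have "(l * \<bar>u - v\<bar>) * \<bar>a - b\<bar> \<le> (exp c * \<bar>g u - g v\<bar>) * \<bar>a - b\<bar>"
      using distortion_leD[OF g(1) ab(1,2) that(2,3)] g(2) by (simp add: mult_ac)
    then have "l * \<bar>u - v\<bar> \<le> exp c * \<bar>g u - g v\<bar>" using ab(3) by simp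
    then have "exp (-c) * (l * \<bar>u - v\<bar>) \<le> exp (-c) * (exp c * \<bar>g u - g v\<bar>)"
      by (intro mult_left_mono) auto
    then show "exp (- c) * l * \<bar>u - v\<bar> \<le> \<bar>g u - g v\<bar>"
      by (simp add: exp_minus field_simps)
  qed
  have cont: "continuous_on C g" if "g = h \<or> g = k" for g
    by (rule lipschitz_on_continuous_on[of "exp c * l"], rule lipschitz_onI)
      (use that l bounds(1) in \<open>auto simp: dist_real_def\<close>)
  define P where "P = {y \<in> C. h y = k y}"
  have "closed {y \<in> C. h y - k y = 0}"
    by (intro continuous_closed_preimage_constant continuous_on_diff cont compact_imp_closed C) auto
  then have "closed P" by (simp add: P_def)
  moreover have "P \<noteq> {}" using ab P_def by auto
  ultimately obtain p where p: "p \<in> P" "\<And>y. y \<in> P \<Longrightarrow> dist x p \<le> dist x y"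
    using distance_attains_inf by blast
  have pC: "p \<in> C" "h p = k p" "p \<noteq> x" using p(1) neq P_def by auto
  obtain u v where uv: "adjacent C u v" "u \<in> closed_segment p x" "v \<in> closed_segment p x"
    "\<sigma> * \<bar>p - x\<bar> \<le> \<bar>u - v\<bar>"
    using por[OF pC(1) \<open>x \<in> C\<close> pC(3)] unfolding porous_between_def by blast
  have uvC: "u \<in> C" "v \<in> C" "u \<noteq> v" using uv(1) unfolding adjacent_def by auto
  obtain s where s: "s = -1 \<or> s = 1" "\<And>u v. \<lbrakk>u \<in> C; v \<in> C; u < v\<rbrakk> \<Longrightarrow> s * h u < s * h v"
    using h(2) unfolding monotonic_def by blast
  obtain t where t: "t = -1 \<or> t = 1" "\<And>u v. \<lbrakk>u \<in> C; v \<in> C; u < v\<rbrakk> \<Longrightarrow> t * k u < t * k v"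
    using k(2) unfolding monotonic_def by blast
  have st: "s = t"
    using s(1) t(1) s(2)[OF ab(1,2)] s(2)[OF ab(2,1)] t(2)[OF ab(1,2)] t(2)[OF ab(2,1)] ab(3-)
    by (cases a b rule: linorder_cases) auto
  have near: "\<bar>h u - k u\<bar> \<le> (exp c - exp (-c)) * l * \<bar>p - x\<bar>"
  proof -
    have "\<bar>h u - k u\<bar> = \<bar>\<bar>h u - h p\<bar> - \<bar>k u - k p\<bar>\<bar>"
      using s(1) s(2)[OF uvC(1) pC(1)] s(2)[OF pC(1) uvC(1)] t(2)[OF uvC(1) pC(1)]
        t(2)[OF pC(1) uvC(1)] pC(2) st
      by (cases u p rule: linorder_cases) auto
    also have "\<dots> \<le> exp c * l * \<bar>u - p\<bar> - exp (-c) * l * \<bar>u - p\<bar>"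
      using bounds[of h u p, OF _ uvC(1) pC(1)] bounds[of k u p, OF _ uvC(1) pC(1)] by argo
    also have "\<dots> = (exp c - exp (-c)) * l * \<bar>u - p\<bar>" by (simp add: algebra_simps)
    also have "\<dots> \<le> (exp c - exp (-c)) * l * \<bar>p - x\<bar>"
    proof (intro mult_left_mono mult_nonneg_nonneg)
      have "exp (-c) * l * \<bar>a - b\<bar> \<le> exp c * l * \<bar>a - b\<bar>"
        using bounds[of h a b] ab by auto
      then show "0 \<le> exp c - exp (-c)" using l ab by simp
    qed (use l uv(2) in \<open>auto simp: in_closed_segment_real\<close>)
    finally show ?thesis .
  qed
  \<comment> \<open>The maps agree at \<open>p\<close>, which limits their displacement at
    \<open>u\<close>; porosity makes both image gaps longer than this displacement. Comparing the
    two bounds gives exactly the condition \<open>exp (2 * c) < 1 + \<sigma>\<close>.\<close>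
  have less: "(exp c - exp (-c)) * l * \<bar>p - x\<bar> < exp (-c) * l * \<bar>u - v\<bar>"
  proof -
    have "exp c - exp (-c) = exp (-c) * (exp (2 * c) - 1)"
      by (simp add: algebra_simps exp_add[symmetric])
    also have "\<dots> < exp (-c) * \<sigma>" using \<sigma> by simp
    finally have "(exp c - exp (-c)) * (l * \<bar>p - x\<bar>) < exp (-c) * \<sigma> * (l * \<bar>p - x\<bar>)"
      using l pC by (intro mult_strict_right_mono) auto
    also have "\<dots> = exp (-c) * l * (\<sigma> * \<bar>p - x\<bar>)" by simp
    also have "\<dots> \<le> exp (-c) * l * \<bar>u - v\<bar>" using uv(4) l by (intro mult_left_mono) auto
    finally show ?thesis by (simp add: mult.assoc)
  qed
  have "h u = k u \<and> h v = k v"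
  proof (rule adjacent_eqI[of C])
    show "(h v - h u) * (k v - k u) > 0"
      using s(1) s(2)[OF uvC(1,2)] s(2)[OF uvC(2,1)] t(2)[OF uvC(1,2)] t(2)[OF uvC(2,1)] uvC(3) st
      unfolding zero_less_mult_iff by (cases u v rule: linorder_cases) auto
    show "\<bar>h u - k u\<bar> < \<bar>h u - h v\<bar>" "\<bar>h u - k u\<bar> < \<bar>k u - k v\<bar>"
      using near less bounds(2)[of h u v] bounds(2)[of k u v] uvC by auto
  qed (use h k uv in auto)
  then have "u \<in> P" "v \<in> P" using uvC P_def by auto
  \<comment> \<open>At least one of \<open>u\<close> and \<open>v\<close> differs from
    \<open>p\<close>, and lying between \<open>p\<close> and \<open>x\<close> it is nearer to
    \<open>x\<close>.\<close>
  then show False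
    using p(2)[of u] p(2)[of v] uv(2,3) uvC(3)
    unfolding dist_real_def in_closed_segment_real by auto
qed

text \<open>Schwartz's argument: the gap \<open>(a, b)\<close> has a summable orbit, so the iterates have bounded
  distortion on a whole neighbourhood of \<open>a\<close> in \<open>X\<close>. Since they contract the gap, they contract this
  neighbourhood too, and a return of \<open>a\<close> close to itself yields a fixed point of a contraction.\<close>

lemma summable_gap_imp_periodic:
  fixes F :: "real \<Rightarrow> real"
  assumes X: "closed X" "\<And>y. y \<in> X \<Longrightarrow> F y \<in> X" "\<And>y p. y \<in> X \<Longrightarrow> y - of_int p \<in> X" and F: "inj F"
    and Q: "Q \<ge> 0" "\<And>B D. \<lbrakk>B \<subseteq> X; D \<ge> 0; spread_le B D\<rbrakk> \<Longrightarrow> distortion_le F B (Q * D)"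
    and ab: "a \<in> X" "b \<in> X" "a \<noteq> b"
    and sum: "\<And>n. (\<Sum>i<n. \<bar>(F ^^ i) a - (F ^^ i) b\<bar>) \<le> W"
    and recur: "\<And>\<tau> N. \<tau> > 0 \<Longrightarrow> \<exists>n\<ge>N. \<exists>p. \<bar>(F ^^ n) a - of_int p - a\<bar> \<le> \<tau>"
  shows "\<exists>x\<in>X. \<exists>n>0. \<exists>p. (F ^^ n) x = x + of_int p"
proof -
  define l where "l i = \<bar>(F ^^ i) a - (F ^^ i) b\<bar>" for i
  \<comment> \<open>The 2 comes from the spread bound \<open>2 * l n\<close> below. With
    \<open>\<tau>\<close> such that \<open>exp c * (2 * \<tau>) = l 0\<close>, an iterate of
    distortion at most \<open>c\<close> makes the image of \<open>A\<close> no wider than the image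
    of the gap.\<close>
  define c where "c = 2 * Q * W"
  define \<tau> where "\<tau> = l 0 * exp (- c) / 2"
  define A where "A = {y \<in> X. \<bar>y - a\<bar> \<le> \<tau>}"
  have l0: "l 0 > 0" using ab by (simp add: l_def)
  have \<tau>: "\<tau> > 0" using l0 by (simp add: \<tau>_def)
  have aA: "a \<in> A" using ab \<tau> by (simp add: A_def)
  have AX: "insert b A \<subseteq> X" using ab by (auto simp: A_def)
  have FX: "(F ^^ n) y \<in> X" if "y \<in> X" for n y using that X(2) by (induction n) auto
  have shrink: "\<bar>(F ^^ n) y - (F ^^ n) y'\<bar> * l 0 \<le> exp c * (l n * \<bar>y - y'\<bar>)"
    if "distortion_le (F ^^ n) (insert b A) c" "y \<in> A" "y' \<in> A" for n y y'
    using distortion_leD[OF that(1), of y y' a b] that(2,3) aA by (simp add: l_def)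
  \<comment> \<open>The two bounds need each other: the uniform bound \<open>c\<close> controls the
    width of the current image, and the width adds one term to the sum, which never exceeds
    \<open>c\<close>.\<close>
  have dist: "distortion_le (F ^^ n) (insert b A) (\<Sum>i<n. Q * (2 * l i))
      \<and> distortion_le (F ^^ n) (insert b A) c" for n
  proof (induction n)
    case 0
    have "0 \<le> W" using sum[of 0] by simp
    then have "0 \<le> c" using Q(1) by (simp add: c_def)
    have *: "distortion_le (F ^^ 0) (insert b A) 0" by (simp add: distortion_le_def mult.commute)
    show ?case using * distortion_le_mono[OF * \<open>0 \<le> c\<close>] by (simp only: lessThan_0 sum.empty)
  next
    case (Suc n)
    have near: "\<bar>(F ^^ n) y - (F ^^ n) y'\<bar> \<le> l n" if "y \<in> A" "y' \<in> A" for y y'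
    proof -
      have "\<bar>y - y'\<bar> \<le> 2 * \<tau>" using that unfolding A_def by force
      then have "exp c * (l n * \<bar>y - y'\<bar>) \<le> exp c * (l n * (2 * \<tau>))"
        by (intro mult_left_mono) (auto simp: l_def)
      also have "\<dots> = l n * l 0" by (simp add: \<tau>_def exp_minus)
      finally have "\<bar>(F ^^ n) y - (F ^^ n) y'\<bar> * l 0 \<le> l n * l 0"
        using shrink[OF conjunct2[OF Suc] that] by linarith
      then show ?thesis using l0 by simp
    qed
    have near_b: "\<bar>(F ^^ n) y - (F ^^ n) b\<bar> \<le> 2 * l n" if "y \<in> A" for y
      using near[OF that aA] abs_triangle_ineq[of "(F ^^ n) y - (F ^^ n) a" "(F ^^ n) a - (F ^^ n) b"]
      unfolding l_def by simp
    have "spread_le ((F ^^ n) ` insert b A) (2 * l n)"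
      unfolding spread_le_def
    proof (intro ballI)
      fix p q assume "p \<in> (F ^^ n) ` insert b A" "q \<in> (F ^^ n) ` insert b A"
      then obtain y y' where y: "p = (F ^^ n) y" "q = (F ^^ n) y'" "y = b \<or> y \<in> A" "y' = b \<or> y' \<in> A"
        by blast
      have "0 \<le> l n" by (simp add: l_def)
      with y near near_b show "\<bar>p - q\<bar> \<le> 2 * l n"
        by (elim disjE) (force simp: abs_minus_commute)+
    qed
    moreover have "(F ^^ n) ` insert b A \<subseteq> X" using AX FX by blast
    ultimately have "distortion_le F ((F ^^ n) ` insert b A) (Q * (2 * l n))"
      by (intro Q(2)) (auto simp: l_def)
    moreover have "inj_on (F ^^ n) (insert b A)" using F inj_fn inj_on_subset by blast
    ultimately have "distortion_le (F \<circ> (F ^^ n)) (insert b A) ((\<Sum>i<n. Q * (2 * l i)) + Q * (2 * l n))"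
      using distortion_le_comp Suc by blast
    then have *: "distortion_le (F ^^ Suc n) (insert b A) (\<Sum>i<Suc n. Q * (2 * l i))" by simp
    have "(\<Sum>i<Suc n. Q * (2 * l i)) = 2 * Q * (\<Sum>i<Suc n. l i)"
      by (simp add: sum_distrib_left algebra_simps)
    also have "\<dots> \<le> c" unfolding c_def using Q(1) sum[of "Suc n"]
      by (intro mult_left_mono) (auto simp: l_def)
    finally show ?case using * distortion_le_mono by blast
  qed
  have "summable l" using sum by (intro summableI_nonneg_bounded[of l W]) (auto simp: l_def)
  then have "l \<longlonglongrightarrow> 0" by (rule summable_LIMSEQ_zero)
  then have "\<forall>\<^sub>F n in sequentially. l n < l 0 * exp (- c) / 2"
    using l0 by (intro order_tendstoD(2)) auto
  then obtain N where N: "\<And>n. n \<ge> N \<Longrightarrow> l n < l 0 * exp (- c) / 2"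
    unfolding eventually_sequentially by blast
  \<comment> \<open>A return within \<open>\<tau> / 2\<close> together with contraction by the
    factor 1/2 makes the translated iterate map \<open>A\<close> into itself.\<close>
  obtain n p where n: "n \<ge> Suc N" "\<bar>(F ^^ n) a - of_int p - a\<bar> \<le> \<tau> / 2"
    using recur[of "\<tau> / 2" "Suc N"] \<tau> by auto
  define T where "T y = (F ^^ n) y - of_int p" for y
  have T: "\<bar>T y - T y'\<bar> \<le> 1 / 2 * \<bar>y - y'\<bar>" if "y \<in> A" "y' \<in> A" for y y'
  proof -
    have "exp c * (l n * \<bar>y - y'\<bar>) \<le> exp c * (l 0 * exp (- c) / 2 * \<bar>y - y'\<bar>)"
      using N[of n] n(1) by (intro mult_left_mono mult_right_mono) auto
    also have "\<dots> = (1 / 2 * \<bar>y - y'\<bar>) * l 0" by (simp add: exp_minus)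
    finally have "\<bar>(F ^^ n) y - (F ^^ n) y'\<bar> * l 0 \<le> (1 / 2 * \<bar>y - y'\<bar>) * l 0"
      using shrink[OF conjunct2[OF dist] that] order_trans by blast
    then show ?thesis using l0 by (simp add: T_def)
  qed
  have TA: "T ` A \<subseteq> A"
  proof
    fix z assume "z \<in> T ` A"
    then obtain y where y: "y \<in> A" "z = T y" by blast
    have "\<bar>T y - T a\<bar> \<le> \<tau> / 2" using T[OF y(1) aA] y(1) unfolding A_def by simp
    then have "\<bar>T y - a\<bar> \<le> \<tau>" using n(2) unfolding T_def by argo
    moreover have "T y \<in> X" using y(1) X(3) FX unfolding T_def A_def by blast
    ultimately show "z \<in> A" using y by (simp add: A_def)
  qed
  have "A = X \<inter> cball a \<tau>" by (auto simp: A_def dist_real_def)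
  then have "complete A" using X(1) by (simp add: closed_Int complete_eq_closed)
  then have "\<exists>!x\<in>A. T x = x"
    using aA TA T by (intro Banach_fix[of A "1 / 2" T]) (auto simp: dist_real_def)
  then obtain x where "x \<in> A" "T x = x" by blast
  then have "x \<in> X" "(F ^^ n) x = x + of_int p" by (auto simp: A_def T_def)
  then show ?thesis using n(1) by (intro bexI[of _ x] exI[of _ n]) auto
qed

section \<open>Distortion from derivatives taken within an interval\<close>

lemma mean_value_convex:
  fixes h h' :: "real \<Rightarrow> real"
  assumes K: "convex K" "\<And>x. x \<in> K \<Longrightarrow> (h has_real_derivative h' x) (at x within K)"
    and uv: "u \<in> K" "v \<in> K" "u \<le> v"
  shows "\<exists>\<xi>\<in>K. u \<le> \<xi> \<and> \<xi> \<le> v \<and> h v - h u = h' \<xi> * (v - u)"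
proof -
  have sub: "{u..v} \<subseteq> K" using K(1) uv closed_segment_subset[of u K v] closed_segment_eq_real_ivl by auto
  then have "(h has_real_derivative h' x) (at x within {u..v})" if "u \<le> x" "x \<le> v" for x
    using that by (intro DERIV_subset[OF K(2)]) auto
  then have "\<exists>\<xi>\<in>{u..v}. h v - h u = h' \<xi> * (v - u)"
    by (intro mvt_very_simple[OF uv(3)]) (simp add: has_field_derivative_def)
  with sub show ?thesis by auto
qed

lemma mean_value_convex_abs:
  fixes h h' :: "real \<Rightarrow> real"
  assumes K: "convex K" "\<And>x. x \<in> K \<Longrightarrow> (h has_real_derivative h' x) (at x within K)"
    and uv: "u \<in> K" "v \<in> K"
  shows "\<exists>\<xi>\<in>K. \<xi> \<in> closed_segment u v \<and> \<bar>h u - h v\<bar> = \<bar>h' \<xi>\<bar> * \<bar>u - v\<bar>"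
proof (cases "u \<le> v")
  case True
  then obtain \<xi> where "\<xi> \<in> K" "u \<le> \<xi>" "\<xi> \<le> v" "h v - h u = h' \<xi> * (v - u)"
    using mean_value_convex[OF K uv] by blast
  then show ?thesis
    by (intro bexI[of _ \<xi>])
      (simp_all add: abs_mult in_closed_segment_real abs_minus_commute[of "h u"] abs_minus_commute[of u])
next
  case False
  then obtain \<xi> where "\<xi> \<in> K" "v \<le> \<xi>" "\<xi> \<le> u" "h u - h v = h' \<xi> * (u - v)"
    using mean_value_convex[OF K uv(2,1)] by (meson linear)
  then show ?thesis by (intro bexI[of _ \<xi>]) (simp_all add: abs_mult in_closed_segment_real)
qed

lemma constant_sign_of_nonzero:
  fixes h :: "real \<Rightarrow> real"
  assumes "convex K" "continuous_on K h" "\<And>x. x \<in> K \<Longrightarrow> h x \<noteq> 0"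
  shows "(\<forall>x\<in>K. h x > 0) \<or> (\<forall>x\<in>K. h x < 0)"
proof (rule ccontr)
  assume "\<not> ?thesis"
  then obtain x y where xy: "x \<in> K" "y \<in> K" "h x \<le> 0" "0 \<le> h y" by (meson linorder_not_less)
  have "connected (h ` K)" using assms(1,2) convex_connected connected_continuous_image by blast
  then have "0 \<in> h ` K" using connectedD_interval[of "h ` K" "h x" "h y" 0] xy by auto
  then show False using assms(3) by auto
qed

lemma monotonic_of_deriv:
  fixes h h' :: "real \<Rightarrow> real"
  assumes K: "convex K" "\<And>x. x \<in> K \<Longrightarrow> (h has_real_derivative h' x) (at x within K)"
    and h': "continuous_on K h'" "\<And>x. x \<in> K \<Longrightarrow> h' x \<noteq> 0"
  shows "monotonic K h"
proof -
  have "\<exists>s\<in>{-1, 1}. \<forall>x\<in>K. s * h' x > 0"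
    using constant_sign_of_nonzero[OF K(1) h'] by auto
  then obtain s where s: "s \<in> {-1, 1}" "\<forall>x\<in>K. s * h' x > 0" ..
  have "s * h u < s * h v" if uv: "u \<in> K" "v \<in> K" "u < v" for u v
  proof -
    obtain \<xi> where \<xi>: "\<xi> \<in> K" "h v - h u = h' \<xi> * (v - u)"
      using mean_value_convex[OF K uv(1,2)] uv(3) by (meson less_imp_le)
    have "0 < (s * h' \<xi>) * (v - u)" using s(2) \<xi>(1) uv(3) by (intro mult_pos_pos[of "s * h' \<xi>"]) auto
    also have "\<dots> = s * (h v - h u)" using \<xi>(2) by simp
    finally show ?thesis by (simp add: right_diff_distrib)
  qed
  with s(1) show ?thesis unfolding monotonic_def by blast
qed

text \<open>Difference quotients are derivatives at intermediate points, and two points of segments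
  spanned by \<open>B\<close> are at most \<open>D\<close> apart.\<close>

lemma distortion_le_of_deriv:
  fixes h h' :: "real \<Rightarrow> real"
  assumes K: "convex K" "\<And>x. x \<in> K \<Longrightarrow> (h has_real_derivative h' x) (at x within K)"
    and ratio: "\<And>x y. \<lbrakk>x \<in> K; y \<in> K; \<bar>x - y\<bar> \<le> D\<rbrakk> \<Longrightarrow> \<bar>h' x\<bar> \<le> exp c * \<bar>h' y\<bar>"
    and B: "B \<subseteq> K" "spread_le B D"
  shows "distortion_le h B c"
  unfolding distortion_le_def
proof (intro ballI)
  fix u v s t assume uvst: "u \<in> B" "v \<in> B" "s \<in> B" "t \<in> B"
  have K': "u \<in> K" "v \<in> K" "s \<in> K" "t \<in> K" using uvst B by auto
  obtain \<xi> where \<xi>: "\<xi> \<in> K" "\<xi> \<in> closed_segment u v" "\<bar>h u - h v\<bar> = \<bar>h' \<xi>\<bar> * \<bar>u - v\<bar>"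
    using mean_value_convex_abs[OF K K'(1,2)] by blast
  obtain \<zeta> where \<zeta>: "\<zeta> \<in> K" "\<zeta> \<in> closed_segment s t" "\<bar>h s - h t\<bar> = \<bar>h' \<zeta>\<bar> * \<bar>s - t\<bar>"
    using mean_value_convex_abs[OF K K'(3,4)] by blast
  have "\<bar>\<xi> - \<zeta>\<bar> \<le> D"
  proof -
    have "\<bar>x - y\<bar> \<le> D" if "x \<in> {u, v}" "y \<in> {s, t}" for x y
      using that uvst B(2) unfolding spread_le_def by auto
    from this[of u s] this[of u t] this[of v s] this[of v t] show ?thesis
      using \<xi>(2) \<zeta>(2) unfolding in_closed_segment_real by auto
  qed
  then have "\<bar>h' \<xi>\<bar> \<le> exp c * \<bar>h' \<zeta>\<bar>" using ratio \<xi>(1) \<zeta>(1) by blast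
  then have "\<bar>h' \<xi>\<bar> * (\<bar>u - v\<bar> * \<bar>s - t\<bar>) \<le> (exp c * \<bar>h' \<zeta>\<bar>) * (\<bar>u - v\<bar> * \<bar>s - t\<bar>)"
    by (rule mult_right_mono) auto
  then show "\<bar>h u - h v\<bar> * \<bar>s - t\<bar> \<le> exp c * (\<bar>h s - h t\<bar> * \<bar>u - v\<bar>)"
    unfolding \<xi>(3) \<zeta>(3) by (simp add: mult_ac)
qed

subsection \<open>Cylinders and porosity of the invariant Cantor set\<close>

text \<open>What the argument uses of \<open>S\<close>, in terms of difference quotients on
  \<open>C\<close>. \<open>a J\<close> bounds the relative length of the piece in \<open>J\<close>;
  a total below 1 forces gaps. In \<open>step\<close>, \<open>\<epsilon>\<close> reflects the
  nonlinearity and \<open>M * D\<close> the second derivative. \<open>sum_\<epsilon>\<close> adds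
  these bounds up along an orbit whose images grow at least by the factor
  \<open>1 / \<theta>\<close> per step.\<close>

locale cookie_cutter =
  fixes \<I> :: "real set set" and S :: "real \<Rightarrow> real" and C :: "real set"
    and a :: "real set \<Rightarrow> real" and \<theta> \<kappa> \<epsilon> M \<delta> :: real
  assumes finite: "finite \<I>" and disjoint: "disjoint \<I>"
    and convex: "J \<in> \<I> \<Longrightarrow> convex J" and compact_piece: "J \<in> \<I> \<Longrightarrow> compact J"
    and two_pieces: "\<exists>J\<in>\<I>. \<exists>K\<in>\<I>. J \<noteq> K"
    and compact: "compact C" and nonempty: "C \<noteq> {}" and cover: "C \<subseteq> \<Union>\<I>" and unit: "C \<subseteq> {0..1}"
    and branch: "J \<in> \<I> \<Longrightarrow> S ` (C \<inter> J) = C"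
    and mono: "J \<in> \<I> \<Longrightarrow> monotonic (C \<inter> J) S"
    and contract: "\<lbrakk>J \<in> \<I>; u \<in> C \<inter> J; v \<in> C \<inter> J\<rbrakk> \<Longrightarrow> \<bar>u - v\<bar> \<le> a J * \<bar>S u - S v\<bar>"
    and a_nonneg: "J \<in> \<I> \<Longrightarrow> 0 \<le> a J" and sum_a: "(\<Sum>J\<in>\<I>. a J) \<le> \<theta>"
    and \<theta>: "0 < \<theta>" "\<theta> < 1"
    and lower: "\<lbrakk>J \<in> \<I>; u \<in> C \<inter> J; v \<in> C \<inter> J\<rbrakk> \<Longrightarrow> \<kappa> * \<bar>S u - S v\<bar> \<le> \<bar>u - v\<bar>"
    and \<kappa>: "0 < \<kappa>"
    and step: "\<lbrakk>J \<in> \<I>; B \<subseteq> C \<inter> J; spread_le B D\<rbrakk> \<Longrightarrow> distortion_le S B (min \<epsilon> (M * D))"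
    and M: "M \<ge> 0"
    and sum_\<epsilon>: "(\<Sum>j<n. min \<epsilon> (M * \<theta> ^ Suc j)) \<le> \<delta>" and \<delta>: "exp \<delta> \<le> 2"
begin

lemma piece_unique: "\<lbrakk>J \<in> \<I>; K \<in> \<I>; x \<in> J; x \<in> K\<rbrakk> \<Longrightarrow> J = K"
  using disjoint by (auto simp: disjoint_def)

lemma in_piece: "x \<in> C \<Longrightarrow> \<exists>J\<in>\<I>. x \<in> J"
  using cover by auto

lemma S_in: "x \<in> C \<Longrightarrow> S x \<in> C"
  using in_piece[of x] branch by blast

lemma funpow_in: "x \<in> C \<Longrightarrow> (S ^^ n) x \<in> C"
  by (induction n) (auto simp: S_in)

lemma a_le: "J \<in> \<I> \<Longrightarrow> a J \<le> \<theta>"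
  using member_le_sum[of J \<I> a] a_nonneg finite sum_a by force

lemma contract_\<theta>:
  assumes "J \<in> \<I>" "u \<in> C \<inter> J" "v \<in> C \<inter> J"
  shows "\<bar>u - v\<bar> \<le> \<theta> * \<bar>S u - S v\<bar>"
  using contract[OF assms] mult_right_mono[OF a_le[OF assms(1)], of "\<bar>S u - S v\<bar>"] by linarith

text \<open>A proper subset of \<open>C\<close>, one of its pieces, is mapped onto all of
  \<open>C\<close>.\<close>

lemma infinite: "infinite C"
proof
  assume fin: "finite C"
  obtain J K where JK: "J \<in> \<I>" "K \<in> \<I>" "J \<noteq> K" using two_pieces by blast
  obtain y where "y \<in> C \<inter> K" using branch[OF JK(2)] nonempty by blast
  then have "C \<inter> J \<subset> C" using piece_unique JK by blast
  then have "card (C \<inter> J) < card C" using fin by (rule psubset_card_mono[rotated])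
  moreover have "card C \<le> card (C \<inter> J)"
    using card_image_le[of "C \<inter> J" S] branch[OF JK(1)] fin by simp
  ultimately show False by simp
qed

lemma spread_C: "spread_le C 1"
  unfolding spread_le_def
proof (intro ballI)
  fix p q assume "p \<in> C" "q \<in> C"
  then have "p \<in> {0..1}" "q \<in> {0..1}" using unit by blast+
  then show "\<bar>p - q\<bar> \<le> 1" by (simp add: abs_le_iff)
qed

text \<open>Points whose itinerary agrees with that of \<open>x\<close> for \<open>n\<close> steps.
  The recursion removes the first symbol, so that \<open>S\<close> maps a cylinder onto one of depth
  one less.\<close>

primrec cyl :: "nat \<Rightarrow> real \<Rightarrow> real set" where
  "cyl 0 x = C"
| "cyl (Suc n) x = {y \<in> C. (\<exists>J\<in>\<I>. x \<in> J \<and> y \<in> J) \<and> S y \<in> cyl n (S x)}"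

lemma cyl_subset: "cyl n x \<subseteq> C"
  by (cases n) auto

lemma cyl_self: "x \<in> C \<Longrightarrow> x \<in> cyl n x"
  by (induction n arbitrary: x) (auto simp: S_in in_piece)

lemma cyl_Suc_eq: "\<lbrakk>J \<in> \<I>; x \<in> J\<rbrakk> \<Longrightarrow> cyl (Suc n) x = {y \<in> C \<inter> J. S y \<in> cyl n (S x)}"
  using piece_unique by auto

lemma S_cyl:
  assumes "J \<in> \<I>" "x \<in> J"
  shows "S ` cyl (Suc n) x = cyl n (S x)"
proof -
  have "y \<in> S ` {y \<in> C \<inter> J. S y \<in> cyl n (S x)}" if "y \<in> cyl n (S x)" for y
  proof -
    have "y \<in> S ` (C \<inter> J)" using that cyl_subset branch[OF assms(1)] by blast
    with that show ?thesis by auto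
  qed
  then show ?thesis unfolding cyl_Suc_eq[OF assms] by auto
qed

lemma cyl_image: "x \<in> C \<Longrightarrow> (S ^^ n) ` cyl n x = C"
proof (induction n arbitrary: x)
  case (Suc n)
  obtain J where "J \<in> \<I>" "x \<in> J" using in_piece Suc.prems by blast
  then show ?case
    using Suc.IH[OF S_in[OF Suc.prems]] S_cyl unfolding funpow_Suc_right image_comp[symmetric] by simp
qed simp

lemma cyl_monotonic: "x \<in> C \<Longrightarrow> monotonic (cyl n x) (S ^^ n)"
proof (induction n arbitrary: x)
  case 0
  show ?case unfolding monotonic_def by (intro bexI[of _ 1]) auto
next
  case (Suc n)
  obtain J where J: "J \<in> \<I>" "x \<in> J" using in_piece Suc.prems by blast
  have "monotonic (cyl (Suc n) x) S"
    by (rule monotonic_subset[OF mono[OF J(1)]]) (auto simp: cyl_Suc_eq[OF J] simp del: cyl.simps)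
  then show ?case
    using Suc.IH[OF S_in[OF Suc.prems]] unfolding funpow_Suc_right
    by (intro monotonic_comp) (simp_all only: S_cyl[OF J])
qed

lemma cyl_inj: "x \<in> C \<Longrightarrow> inj_on (S ^^ n) (cyl n x)"
  by (intro monotonic_inj_on cyl_monotonic)

lemma cyl_contract:
  "\<lbrakk>x \<in> C; u \<in> cyl n x; v \<in> cyl n x\<rbrakk> \<Longrightarrow> \<bar>u - v\<bar> \<le> \<theta> ^ n * \<bar>(S ^^ n) u - (S ^^ n) v\<bar>"
proof (induction n arbitrary: x u v)
  case (Suc n)
  obtain J where J: "J \<in> \<I>" "x \<in> J" using in_piece Suc.prems by blast
  have uv: "u \<in> C \<inter> J" "v \<in> C \<inter> J" "S u \<in> cyl n (S x)" "S v \<in> cyl n (S x)"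
    using Suc.prems by (auto simp: cyl_Suc_eq[OF J] simp del: cyl.simps)
  have "\<bar>u - v\<bar> \<le> \<theta> * \<bar>S u - S v\<bar>" using contract_\<theta>[OF J(1)] uv by blast
  also have "\<dots> \<le> \<theta> * (\<theta> ^ n * \<bar>(S ^^ n) (S u) - (S ^^ n) (S v)\<bar>)"
    using Suc.IH[OF S_in[OF Suc.prems(1)] uv(3,4)] \<theta> by (intro mult_left_mono) auto
  finally show ?case by (simp add: funpow_Suc_right mult.assoc del: funpow.simps)
qed simp

lemma cyl_lower:
  "\<lbrakk>x \<in> C; u \<in> cyl n x; v \<in> cyl n x\<rbrakk> \<Longrightarrow> \<kappa> ^ n * \<bar>(S ^^ n) u - (S ^^ n) v\<bar> \<le> \<bar>u - v\<bar>"
proof (induction n arbitrary: x u v)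
  case (Suc n)
  obtain J where J: "J \<in> \<I>" "x \<in> J" using in_piece Suc.prems by blast
  have uv: "u \<in> C \<inter> J" "v \<in> C \<inter> J" "S u \<in> cyl n (S x)" "S v \<in> cyl n (S x)"
    using Suc.prems by (auto simp: cyl_Suc_eq[OF J] simp del: cyl.simps)
  have "\<kappa> * (\<kappa> ^ n * \<bar>(S ^^ n) (S u) - (S ^^ n) (S v)\<bar>) \<le> \<kappa> * \<bar>S u - S v\<bar>"
    using Suc.IH[OF S_in[OF Suc.prems(1)] uv(3,4)] \<kappa> by (intro mult_left_mono) auto
  also have "\<dots> \<le> \<bar>u - v\<bar>" using lower[OF J(1)] uv by blast
  finally show ?case by (simp add: funpow_Suc_right mult.assoc del: funpow.simps)
qed simp

text \<open>After \<open>i\<close> steps the image of \<open>B\<close> has spread at most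
  \<open>\<theta> ^ (n - i) * D\<close>, as the remaining iterates expand it to spread at most
  \<open>D\<close>. The index \<open>j\<close> thus counts from the last iterate backwards.\<close>

lemma cyl_distortion_sum:
  "\<lbrakk>x \<in> C; B \<subseteq> cyl n x; spread_le ((S ^^ n) ` B) D\<rbrakk>
     \<Longrightarrow> distortion_le (S ^^ n) B (\<Sum>j<n. min \<epsilon> (M * (\<theta> ^ Suc j * D)))"
proof (induction n arbitrary: x B)
  case 0
  then show ?case by (simp add: distortion_le_def mult.commute)
next
  case (Suc n)
  obtain J where J: "J \<in> \<I>" "x \<in> J" using in_piece Suc.prems by blast
  have BJ: "B \<subseteq> C \<inter> J" and SB: "S ` B \<subseteq> cyl n (S x)"
    using Suc.prems(2) by (auto simp: cyl_Suc_eq[OF J] simp del: cyl.simps)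
  have "spread_le B (\<theta> ^ Suc n * D)"
    unfolding spread_le_def
  proof (intro ballI)
    fix p q assume pq: "p \<in> B" "q \<in> B"
    have "\<bar>p - q\<bar> \<le> \<theta> ^ Suc n * \<bar>(S ^^ Suc n) p - (S ^^ Suc n) q\<bar>"
      using cyl_contract[OF Suc.prems(1)] Suc.prems(2) pq by blast
    also have "\<dots> \<le> \<theta> ^ Suc n * D"
      using Suc.prems(3) pq \<theta> unfolding spread_le_def by (intro mult_left_mono) auto
    finally show "\<bar>p - q\<bar> \<le> \<theta> ^ Suc n * D" .
  qed
  then have "distortion_le S B (min \<epsilon> (M * (\<theta> ^ Suc n * D)))" using step[OF J(1) BJ] by blast
  moreover have "spread_le ((S ^^ n) ` S ` B) D"
    using Suc.prems(3) unfolding funpow_Suc_right by (simp add: image_comp)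
  then have "distortion_le (S ^^ n) (S ` B) (\<Sum>j<n. min \<epsilon> (M * (\<theta> ^ Suc j * D)))"
    using Suc.IH[OF S_in[OF Suc.prems(1)] SB] by blast
  moreover have "inj_on S B" using monotonic_inj_on[OF mono[OF J(1)]] BJ inj_on_subset by blast
  ultimately have "distortion_le ((S ^^ n) \<circ> S) B
      (min \<epsilon> (M * (\<theta> ^ Suc n * D)) + (\<Sum>j<n. min \<epsilon> (M * (\<theta> ^ Suc j * D))))"
    by (rule distortion_le_comp)
  then show ?case unfolding funpow_Suc_right by (simp only: sum.lessThan_Suc add.commute)
qed

lemma cyl_distortion:
  assumes "x \<in> C"
  shows "distortion_le (S ^^ n) (cyl n x) \<delta>"
proof -
  have "spread_le ((S ^^ n) ` cyl n x) 1" using cyl_image[OF assms] spread_C by simp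
  then show ?thesis
    using cyl_distortion_sum[OF assms order_refl] sum_\<epsilon>[of n] distortion_le_mono by fastforce
qed

text \<open>With \<open>\<epsilon>\<close> dropped from each minimum, a geometric series remains.
  Linearity in \<open>D\<close>, uniform in \<open>n\<close>, is the regularity that is eventually
  handed on to \<open>f\<close>.\<close>

lemma cyl_distortion_Lipschitz:
  assumes "x \<in> C" "B \<subseteq> cyl n x" "spread_le ((S ^^ n) ` B) D" "D \<ge> 0"
  shows "distortion_le (S ^^ n) B (M / (1 - \<theta>) * D)"
proof -
  have "(\<Sum>j<n. min \<epsilon> (M * (\<theta> ^ Suc j * D))) \<le> (\<Sum>j<n. M * D * \<theta> ^ j)"
  proof (rule sum_mono)
    fix j
    have "\<theta> ^ Suc j * (M * D) \<le> \<theta> ^ j * (M * D)"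
      using \<theta> M assms(4) by (intro mult_right_mono power_decreasing) auto
    then show "min \<epsilon> (M * (\<theta> ^ Suc j * D)) \<le> M * D * \<theta> ^ j"
      by (simp add: mult_ac min_le_iff_disj)
  qed
  also have "\<dots> = M * D * ((1 - \<theta> ^ n) / (1 - \<theta>))"
    using \<theta> by (simp add: sum_distrib_left[symmetric] sum_gp_strict)
  also have "\<dots> \<le> M * D * (1 / (1 - \<theta>))"
    using \<theta> M assms(4) by (intro mult_left_mono divide_right_mono) auto
  finally show ?thesis
    using cyl_distortion_sum[OF assms(1-3)] distortion_le_mono by fastforce
qed

text \<open>Pieces are traces of intervals and \<open>S\<close> is monotone on each, so order
  convexity is inherited at every step. It ensures that gaps within a cylinder are gaps of
  \<open>C\<close>.\<close>

lemma cyl_convex: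
  "\<lbrakk>x \<in> C; u \<in> cyl n x; v \<in> cyl n x; z \<in> C; z \<in> open_segment u v\<rbrakk> \<Longrightarrow> z \<in> cyl n x"
proof (induction n arbitrary: x u v z)
  case (Suc n)
  obtain J where J: "J \<in> \<I>" "x \<in> J" using in_piece Suc.prems by blast
  have uv: "u \<in> C \<inter> J" "v \<in> C \<inter> J" "S u \<in> cyl n (S x)" "S v \<in> cyl n (S x)"
    using Suc.prems(2,3) by (auto simp: cyl_Suc_eq[OF J] simp del: cyl.simps)
  have z: "z \<in> C \<inter> J"
    using Suc.prems(4,5) uv convex[OF J(1)] convex_contains_open_segment[of J] by blast
  then have "S z \<in> open_segment (S u) (S v)"
    using monotonic_open_segment[OF mono[OF J(1)]] uv Suc.prems(5) by blast
  then have "S z \<in> cyl n (S x)" using Suc.IH[of "S x"] Suc.prems uv S_in by blast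
  with z show ?case unfolding cyl_Suc_eq[OF J] by simp
qed simp

lemma cyl_adjacent:
  assumes "x \<in> C" "u \<in> cyl n x" "v \<in> cyl n x"
  shows "adjacent C ((S ^^ n) u) ((S ^^ n) v) \<longleftrightarrow> adjacent C u v"
  by (rule adjacent_image_iff[OF cyl_monotonic[OF assms(1), of n]])
    (use assms cyl_subset cyl_image[OF assms(1), of n] cyl_convex[OF assms] in auto)

text \<open>Here the last symbol is split off, whereas the definition splits off the first.\<close>

lemma cyl_Suc_iff:
  "x \<in> C \<Longrightarrow> y \<in> cyl (Suc n) x \<longleftrightarrow> y \<in> cyl n x \<and> (\<exists>J\<in>\<I>. (S ^^ n) x \<in> J \<and> (S ^^ n) y \<in> J)"
proof (induction n arbitrary: x y)
  case (Suc n)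
  have "y \<in> cyl (Suc (Suc n)) x
      \<longleftrightarrow> y \<in> C \<and> (\<exists>J\<in>\<I>. x \<in> J \<and> y \<in> J) \<and> S y \<in> cyl (Suc n) (S x)"
    by (subst cyl.simps(2)) simp
  also have "\<dots> \<longleftrightarrow> y \<in> cyl (Suc n) x \<and> (\<exists>J\<in>\<I>. (S ^^ n) (S x) \<in> J \<and> (S ^^ n) (S y) \<in> J)"
    unfolding Suc.IH[OF S_in[OF Suc.prems]] by (auto simp: S_in)
  finally show ?case by (simp only: funpow_Suc_right o_apply)
qed (auto simp: S_in)

text \<open>Cylinders around \<open>p\<close> shrink to \<open>p\<close>, so one of them excludes
  \<open>q\<close>. The depth just before the first cylinder that fails to contain \<open>A\<close>
  is the right one: there the iterate brings \<open>A\<close> to macroscopic size, meeting two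
  pieces.\<close>

lemma cyl_depth:
  assumes "p \<in> C" "A \<subseteq> C" "q \<in> A" "q \<noteq> p"
  obtains n where "A \<subseteq> cyl n p" "\<exists>y\<in>A. \<not> (\<exists>J\<in>\<I>. (S ^^ n) p \<in> J \<and> (S ^^ n) y \<in> J)"
proof -
  have "(\<lambda>n. \<theta> ^ n) \<longlonglongrightarrow> 0" using \<theta> by (intro LIMSEQ_realpow_zero) auto
  then have "\<forall>\<^sub>F n in sequentially. \<theta> ^ n < \<bar>p - q\<bar>"
    using assms(4) by (intro order_tendstoD(2)) auto
  then obtain n where n: "\<theta> ^ n < \<bar>p - q\<bar>" unfolding eventually_sequentially by blast
  have "q \<notin> cyl n p"
  proof
    assume "q \<in> cyl n p"
    then have "\<bar>p - q\<bar> \<le> \<theta> ^ n * \<bar>(S ^^ n) p - (S ^^ n) q\<bar>"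
      using cyl_contract assms(1) cyl_self by blast
    also have "\<dots> \<le> \<theta> ^ n * 1"
      using spread_C funpow_in assms \<theta> unfolding spread_le_def by (intro mult_left_mono) auto
    finally show False using n by simp
  qed
  then have ex: "\<exists>n. \<not> A \<subseteq> cyl n p" using assms(3) by blast
  define m where "m = (LEAST n. \<not> A \<subseteq> cyl n p)"
  have m: "\<not> A \<subseteq> cyl m p" using LeastI_ex[OF ex] m_def by simp
  then have "m \<noteq> 0" using assms(2) by (intro notI) simp
  then obtain k where k: "m = Suc k" using not0_implies_Suc by blast
  then have sub: "A \<subseteq> cyl k p" using not_less_Least[of k "\<lambda>n. \<not> A \<subseteq> cyl n p"] m_def by auto
  from m obtain y where "y \<in> A" "y \<notin> cyl (Suc k) p" using k by blast
  then have "\<exists>y\<in>A. \<not> (\<exists>J\<in>\<I>. (S ^^ k) p \<in> J \<and> (S ^^ k) y \<in> J)"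
    using sub cyl_Suc_iff[OF assms(1)] by blast
  with sub that show thesis by blast
qed

lemma pieces_separated:
  obtains \<gamma> where "\<gamma> > 0"
    "\<And>x y. \<lbrakk>x \<in> C; y \<in> C; \<not> (\<exists>J\<in>\<I>. x \<in> J \<and> y \<in> J)\<rbrakk> \<Longrightarrow> \<gamma> \<le> \<bar>x - y\<bar>"
proof -
  have "\<exists>d>0. \<forall>x\<in>J. \<forall>y\<in>\<Union>(\<I> - {J}). d \<le> dist x y" if "J \<in> \<I>" for J
  proof (rule separate_compact_closed[OF compact_piece[OF that]])
    show "closed (\<Union>(\<I> - {J}))"
      by (intro closed_Union) (use finite compact_piece compact_imp_closed in auto)
    show "J \<inter> \<Union>(\<I> - {J}) = {}" using piece_unique that by blast
  qed
  then obtain d where d: "\<And>J. J \<in> \<I> \<Longrightarrow> d J > 0"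
    "\<And>J x y. \<lbrakk>J \<in> \<I>; x \<in> J; y \<in> \<Union>(\<I> - {J})\<rbrakk> \<Longrightarrow> d J \<le> dist x y" by metis
  have ne: "\<I> \<noteq> {}" using two_pieces by blast
  show thesis
  proof
    show "Min (d ` \<I>) > 0" using d(1) ne finite by simp
    fix x y assume xy: "x \<in> C" "y \<in> C" "\<not> (\<exists>J\<in>\<I>. x \<in> J \<and> y \<in> J)"
    obtain J where J: "J \<in> \<I>" "x \<in> J" using in_piece xy by blast
    have "y \<in> \<Union>(\<I> - {J})" using in_piece xy J by blast
    then have "d J \<le> dist x y" using d(2) J by blast
    moreover have "Min (d ` \<I>) \<le> d J" using J finite by (intro Min_le) auto
    ultimately show "Min (d ` \<I>) \<le> \<bar>x - y\<bar>" by (simp add: dist_real_def)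
  qed
qed

text \<open>Points closer than \<open>\<gamma>\<close> share a piece, and \<open>\<kappa>\<close>
  limits how far \<open>S\<close> moves them apart.\<close>

lemma cyl_nbhd: "x \<in> C \<Longrightarrow> \<exists>r>0. \<forall>y\<in>C. \<bar>y - x\<bar> < r \<longrightarrow> y \<in> cyl n x"
proof (induction n arbitrary: x)
  case 0
  show ?case by (intro exI[of _ 1]) auto
next
  case (Suc n)
  obtain \<gamma> where \<gamma>: "\<gamma> > 0"
    "\<And>x y. \<lbrakk>x \<in> C; y \<in> C; \<not> (\<exists>J\<in>\<I>. x \<in> J \<and> y \<in> J)\<rbrakk> \<Longrightarrow> \<gamma> \<le> \<bar>x - y\<bar>"
    using pieces_separated by blast
  obtain r where r: "r > 0" "\<And>y. \<lbrakk>y \<in> C; \<bar>y - S x\<bar> < r\<rbrakk> \<Longrightarrow> y \<in> cyl n (S x)"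
    using Suc.IH[OF S_in[OF Suc.prems]] by blast
  show ?case
  proof (intro exI[of _ "min \<gamma> (\<kappa> * r)"] conjI ballI impI)
    show "0 < min \<gamma> (\<kappa> * r)" using \<gamma> r \<kappa> by simp
    fix y assume y: "y \<in> C" "\<bar>y - x\<bar> < min \<gamma> (\<kappa> * r)"
    then obtain J where J: "J \<in> \<I>" "x \<in> J" "y \<in> J"
      using \<gamma>(2)[OF y(1) Suc.prems] by (metis min_less_iff_conj not_less)
    have "\<kappa> * \<bar>S y - S x\<bar> < \<kappa> * r" using lower[of J y x] J y Suc.prems by auto
    then have "\<bar>S y - S x\<bar> < r" using \<kappa> by simp
    then have "S y \<in> cyl n (S x)" using r(2) S_in y(1) by blast
    with J y show "y \<in> cyl (Suc n) x" by auto
  qed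
qed

section \<open>Porosity of \<open>C\<close> at all scales\<close>

lemma piece_adjacent:
  assumes "J \<in> \<I>" "u \<in> C \<inter> J" "v \<in> C \<inter> J"
  shows "adjacent C (S u) (S v) \<longleftrightarrow> adjacent C u v"
  using cyl_adjacent[of u u 1 v] assms S_in by auto

lemma piece_compact: "J \<in> \<I> \<Longrightarrow> compact (C \<inter> J)" "J \<in> \<I> \<Longrightarrow> C \<inter> J \<noteq> {}"
  using compact compact_piece compact_Int apply blast
  using branch nonempty by blast

lemma piece_convex: "\<lbrakk>J \<in> \<I>; x \<in> J; y \<in> J; z \<in> closed_segment x y\<rbrakk> \<Longrightarrow> z \<in> J"
  using convex convex_contains_segment by blast

text \<open>The pieces of \<open>C\<close> have total relative length at most \<open>\<theta> < 1\<close>, so the gaps between them,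
  fewer than there are pieces, cannot all be short.\<close>

lemma large_gap:
  obtains c d where "adjacent C c d"
    "\<And>p q. \<lbrakk>p \<in> C; q \<in> C\<rbrakk> \<Longrightarrow> (1 - \<theta>) / (2 * card \<I>) * \<bar>p - q\<bar> \<le> \<bar>c - d\<bar>"
proof -
  obtain l where l: "l \<in> C" "\<And>x. x \<in> C \<Longrightarrow> l \<le> x" using compact_attains_inf[OF compact nonempty] by blast
  obtain h where h: "h \<in> C" "\<And>x. x \<in> C \<Longrightarrow> x \<le> h" using compact_attains_sup[OF compact nonempty] by blast
  have "l \<noteq> h"
  proof
    assume "l = h"
    then have "C \<subseteq> {l}" using l h by fastforce
    then show False using infinite finite_subset by auto
  qed
  then have lh: "l < h" using l(2)[OF h(1)] by simp
  define N where "N = real (card \<I>)"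
  have N: "N > 0" using two_pieces finite unfolding N_def by (auto simp: card_gt_0_iff)
  \<comment> \<open>\<open>N * g\<close> is half of the length that the pieces are certain to leave
    free; the other half gives the strict inequality at the end.\<close>
  define g where "g = (1 - \<theta>) / (2 * N) * (h - l)"
  have g: "g > 0" using \<theta> N lh by (simp add: g_def)
  have "\<exists>c d. adjacent C c d \<and> g \<le> \<bar>c - d\<bar>"
  proof (rule ccontr)
    assume "\<not> ?thesis"
    then have small: "\<bar>c - d\<bar> < g" if "adjacent C c d" for c d using that by force
    have "\<exists>x\<in>C \<inter> J. \<forall>y\<in>C \<inter> J. x \<le> y" if "J \<in> \<I>" for J
      using compact_attains_inf[OF piece_compact[OF that]] by blast
    then obtain lo where lo: "\<And>J. J \<in> \<I> \<Longrightarrow> lo J \<in> C \<inter> J"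
      "\<And>J y. \<lbrakk>J \<in> \<I>; y \<in> C \<inter> J\<rbrakk> \<Longrightarrow> lo J \<le> y" by metis
    have "\<exists>x\<in>C \<inter> J. \<forall>y\<in>C \<inter> J. y \<le> x" if "J \<in> \<I>" for J
      using compact_attains_sup[OF piece_compact[OF that]] by blast
    then obtain hi where hi: "\<And>J. J \<in> \<I> \<Longrightarrow> hi J \<in> C \<inter> J"
      "\<And>J y. \<lbrakk>J \<in> \<I>; y \<in> C \<inter> J\<rbrakk> \<Longrightarrow> y \<le> hi J" by metis
    have lohi: "lo J \<le> hi J" if "J \<in> \<I>" for J using lo hi that by blast
    have len: "hi J - lo J \<le> a J * (h - l)" if "J \<in> \<I>" for J
    proof -
      have "\<bar>S (hi J) - S (lo J)\<bar> \<le> h - l"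
        using l(2) h(2) S_in lo(1)[OF that] hi(1)[OF that] by (simp add: abs_le_iff) (smt (verit))
      then have "a J * \<bar>S (hi J) - S (lo J)\<bar> \<le> a J * (h - l)"
        by (rule mult_left_mono) (rule a_nonneg[OF that])
      then show ?thesis using contract[OF that hi(1)[OF that] lo(1)[OF that]] by linarith
    qed
    \<comment> \<open>If all gaps are shorter than \<open>g\<close>, prolonging the hull of each
      piece to the right by \<open>g\<close> fills the gap that follows it.\<close>
    have cov: "{l..h} \<subseteq> (\<Union>J\<in>\<I>. {lo J..hi J + g})"
    proof
      fix y assume y: "y \<in> {l..h}"
      have "compact (C \<inter> {..y})" "C \<inter> {..y} \<noteq> {}" using compact l y by (auto intro: compact_Int_closed)
      then obtain z where z: "z \<in> C" "z \<le> y" "\<And>x. \<lbrakk>x \<in> C; x \<le> y\<rbrakk> \<Longrightarrow> x \<le> z"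
        using compact_attains_sup[of "C \<inter> {..y}"] by auto
      obtain J where J: "J \<in> \<I>" "z \<in> J" using in_piece z by blast
      have "y \<le> hi J + g"
      proof (cases "y \<in> C")
        case True
        then show ?thesis using z hi(2)[OF J(1), of z] J g by force
      next
        case False
        have "compact (C \<inter> {y..})" "C \<inter> {y..} \<noteq> {}" using compact h y by (auto intro: compact_Int_closed)
        then obtain w where w: "w \<in> C" "y \<le> w" "\<And>x. \<lbrakk>x \<in> C; y \<le> x\<rbrakk> \<Longrightarrow> w \<le> x"
          using compact_attains_inf[of "C \<inter> {y..}"] by auto
        have "x \<notin> open_segment z w" if "x \<in> C" for x
          using z(2) z(3)[of x] w(2) w(3)[of x] that
          by (cases "x \<le> y") (auto simp: in_open_segment_real)
        moreover have "z \<noteq> w" using z w False by force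
        ultimately have "adjacent C z w" using z w unfolding adjacent_def by blast
        then show ?thesis using small[of z w] w(2) hi(2)[OF J(1), of z] J z by force
      qed
      moreover have "lo J \<le> y" using lo(2)[OF J(1), of z] J z by force
      ultimately show "y \<in> (\<Union>J\<in>\<I>. {lo J..hi J + g})" using J by auto
    qed
    have "measure lborel {l..h} \<le> measure lborel (\<Union>J\<in>\<I>. {lo J..hi J + g})"
    proof (rule measure_mono_fmeasurable[OF cov])
      show "(\<Union>J\<in>\<I>. {lo J..hi J + g}) \<in> fmeasurable lborel"
        by (intro fmeasurable_compact compact_UN finite) auto
    qed auto
    also have "\<dots> \<le> (\<Sum>J\<in>\<I>. measure lborel {lo J..hi J + g})"
      by (intro measure_UNION_le finite) auto
    also have "\<dots> = (\<Sum>J\<in>\<I>. (hi J - lo J) + g)"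
      using lohi g by (intro sum.cong) (auto simp: add_increasing2)
    also have "\<dots> \<le> (\<Sum>J\<in>\<I>. a J * (h - l) + g)" using len by (intro sum_mono) auto
    also have "\<dots> = (\<Sum>J\<in>\<I>. a J) * (h - l) + N * g"
      by (simp add: sum.distrib sum_distrib_right N_def)
    also have "\<dots> \<le> \<theta> * (h - l) + (1 - \<theta>) / 2 * (h - l)"
      using sum_a lh N by (intro add_mono mult_right_mono) (auto simp: g_def)
    also have "\<dots> = (h - l) - (1 - \<theta>) / 2 * (h - l)" by (simp add: field_simps)
    also have "\<dots> < h - l" using \<theta> lh by simp
    finally show False using lh by simp
  qed
  then obtain c d where cd: "adjacent C c d" "g \<le> \<bar>c - d\<bar>" by blast
  have "(1 - \<theta>) / (2 * card \<I>) * \<bar>p - q\<bar> \<le> \<bar>c - d\<bar>" if "p \<in> C" "q \<in> C" for p q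
  proof -
    have "\<bar>p - q\<bar> \<le> h - l" using l(2)[OF that(1)] l(2)[OF that(2)] h(2)[OF that(1)] h(2)[OF that(2)] by linarith
    then have "(1 - \<theta>) / (2 * N) * \<bar>p - q\<bar> \<le> g"
      unfolding g_def using \<theta> N by (intro mult_left_mono) auto
    with cd(2) show ?thesis by (simp add: N_def)
  qed
  with cd(1) that show thesis by blast
qed

text \<open>Distortion changes the relative size of a gap by a factor of at most
  \<open>exp \<delta>\<close>. Replacing this factor by 2 keeps the porosity constant independent of
  \<open>\<delta>\<close>.\<close>

lemma porous_pull_back:
  assumes "x \<in> C" "p \<in> cyl n x" "q \<in> cyl n x" "\<sigma> \<ge> 0"
    and por: "porous_between C \<sigma> ((S ^^ n) p) ((S ^^ n) q)"
  shows "porous_between C (\<sigma> / 2) p q"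
proof -
  let ?T = "S ^^ n"
  obtain u' v' where uv': "adjacent C u' v'" "u' \<in> closed_segment (?T p) (?T q)"
    "v' \<in> closed_segment (?T p) (?T q)" "\<sigma> * \<bar>?T p - ?T q\<bar> \<le> \<bar>u' - v'\<bar>"
    using por unfolding porous_between_def by blast
  then obtain u v where uv: "u \<in> cyl n x" "u' = ?T u" "v \<in> cyl n x" "v' = ?T v"
    using cyl_image[OF assms(1), of n] unfolding adjacent_def by blast
  have "adjacent C u v" using cyl_adjacent[OF assms(1)] uv uv'(1) by blast
  moreover have "u \<in> closed_segment p q" "v \<in> closed_segment p q"
    using monotonic_closed_segment[OF cyl_monotonic[OF assms(1)] assms(2,3)] uv uv' by blast+
  moreover have "\<sigma> / 2 * \<bar>p - q\<bar> \<le> \<bar>u - v\<bar>"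
  proof (cases "p = q")
    case False
    then have pos: "\<bar>?T p - ?T q\<bar> > 0" using cyl_inj[OF assms(1)] assms(2,3) by (auto dest: inj_onD)
    have "\<bar>?T p - ?T q\<bar> * (\<sigma> * \<bar>p - q\<bar>) = (\<sigma> * \<bar>?T p - ?T q\<bar>) * \<bar>p - q\<bar>" by simp
    also have "\<dots> \<le> \<bar>?T u - ?T v\<bar> * \<bar>p - q\<bar>"
      using uv' uv by (intro mult_right_mono) auto
    also have "\<dots> \<le> exp \<delta> * (\<bar>?T p - ?T q\<bar> * \<bar>u - v\<bar>)"
      using distortion_leD[OF cyl_distortion[OF assms(1)]] uv assms(2,3) by blast
    also have "\<dots> \<le> 2 * (\<bar>?T p - ?T q\<bar> * \<bar>u - v\<bar>)" using \<delta> by (intro mult_right_mono) auto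
    also have "\<dots> = \<bar>?T p - ?T q\<bar> * (2 * \<bar>u - v\<bar>)" by simp
    finally have "\<sigma> * \<bar>p - q\<bar> \<le> 2 * \<bar>u - v\<bar>" using pos by simp
    then show ?thesis by simp
  qed simp
  ultimately show ?thesis unfolding porous_between_def by blast
qed

text \<open>\<open>e\<close> is the end of the piece in \<open>J\<close> that is far from
  \<open>p\<close>. So the whole piece lies between them, including its copy of the large gap, which
  is shrunk by a factor of at least \<open>\<kappa>\<close>.\<close>

lemma porous_beyond_piece:
  assumes gap: "adjacent C c d" "\<And>p q. \<lbrakk>p \<in> C; q \<in> C\<rbrakk> \<Longrightarrow> g * \<bar>p - q\<bar> \<le> \<bar>c - d\<bar>"
    and J: "J \<in> \<I>" "e \<in> C" "e \<in> J" "p \<in> C" "p \<notin> J" "\<And>z. z \<in> C \<inter> J \<Longrightarrow> (z - e) * (p - e) \<ge> 0"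
  shows "porous_between C (\<kappa> * g) p e"
proof -
  have "c \<in> C" "d \<in> C" using gap(1) unfolding adjacent_def by auto
  then obtain c' d' where cd: "c' \<in> C \<inter> J" "S c' = c" "d' \<in> C \<inter> J" "S d' = d"
    using branch[OF J(1)] by (metis imageE)
  then have "adjacent C c' d'" using piece_adjacent[OF J(1)] gap(1) by blast
  moreover have "z \<in> closed_segment p e" if z: "z \<in> C \<inter> J" for z
  proof (rule ccontr)
    assume "z \<notin> closed_segment p e"
    then have "p \<in> closed_segment e z"
      using J(6)[OF z] by (auto simp: in_closed_segment_real zero_le_mult_iff)
    then show False using piece_convex J z by blast
  qed
  moreover have "\<kappa> * g * \<bar>p - e\<bar> \<le> \<bar>c' - d'\<bar>"
  proof -
    have "\<kappa> * (g * \<bar>p - e\<bar>) \<le> \<kappa> * \<bar>c - d\<bar>" using gap(2) J \<kappa> by (intro mult_left_mono) auto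
    then show ?thesis using lower[OF J(1) cd(1,3)] cd by (simp add: mult.assoc)
  qed
  ultimately show ?thesis using cd unfolding porous_between_def by blast
qed

text \<open>\<open>e\<close> is an extreme point of \<open>C\<close>. Monotone iterates from a
  cylinder onto \<open>C\<close> send it to an extreme point again, which is the far end of its
  piece once \<open>p\<close> and \<open>e\<close> are separated. Pulling back costs the factor
  2.\<close>

lemma porous_at_end:
  assumes gap: "adjacent C c d" "\<And>p q. \<lbrakk>p \<in> C; q \<in> C\<rbrakk> \<Longrightarrow> g * \<bar>p - q\<bar> \<le> \<bar>c - d\<bar>" "g \<ge> 0"
    and e: "e \<in> C" "p \<in> C" "p \<noteq> e" "\<And>z. z \<in> C \<Longrightarrow> (z - e) * (p - e) \<ge> 0"
  shows "porous_between C (\<kappa> * g / 2) p e"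
proof -
  obtain n where n: "{p} \<subseteq> cyl n e" "\<exists>y\<in>{p}. \<not> (\<exists>J\<in>\<I>. (S ^^ n) e \<in> J \<and> (S ^^ n) y \<in> J)"
    using cyl_depth[of e "{p}" p] e by blast
  let ?e = "(S ^^ n) e" and ?p = "(S ^^ n) p"
  obtain J where J: "J \<in> \<I>" "?e \<in> J" using in_piece funpow_in e(1) by blast
  have side: "(z - ?e) * (?p - ?e) \<ge> 0" if "z \<in> C" for z
  proof -
    obtain y where y: "y \<in> cyl n e" "z = (S ^^ n) y" using cyl_image[OF e(1), of n] \<open>z \<in> C\<close> by blast
    then have "(y - e) * (p - e) \<ge> 0" using e(4) cyl_subset by blast
    then show ?thesis
      using monotonic_same_side[OF cyl_monotonic[OF e(1)] cyl_self[OF e(1)]] y n by blast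
  qed
  have "porous_between C (\<kappa> * g) ?p ?e"
  proof (rule porous_beyond_piece[OF gap(1,2) J(1) _ J(2)])
    show "?p \<notin> J" using n(2) J by blast
  qed (use side funpow_in e in auto)
  then show ?thesis
    using porous_pull_back[OF e(1), of p n e "\<kappa> * g"] n(1) cyl_self[OF e(1)] \<kappa> gap(3) by simp
qed

text \<open>If \<open>p\<close> lies in the same piece, one application of \<open>S\<close> turns an
  end of the piece into an end of \<open>C\<close>, at the cost of another factor 2.\<close>

lemma porous_at_piece_end:
  assumes gap: "adjacent C c d" "\<And>p q. \<lbrakk>p \<in> C; q \<in> C\<rbrakk> \<Longrightarrow> g * \<bar>p - q\<bar> \<le> \<bar>c - d\<bar>" "g \<ge> 0"
    and J: "J \<in> \<I>" "e \<in> C" "e \<in> J" "p \<in> C" "p \<noteq> e" "\<And>z. z \<in> C \<inter> J \<Longrightarrow> (z - e) * (p - e) \<ge> 0"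
  shows "porous_between C (\<kappa> * g / 4) p e"
proof (cases "p \<in> J")
  case False
  then have "porous_between C (\<kappa> * g) p e"
    by (intro porous_beyond_piece[OF gap(1,2) J(1-4)]) (use J(6) in auto)
  then show ?thesis using \<kappa> gap(3) by (elim porous_between_weaken) (auto intro: mult_right_mono)
next
  case True
  have "(z - S e) * (S p - S e) \<ge> 0" if z: "z \<in> C" for z
  proof -
    have "z \<in> S ` (C \<inter> J)" using z branch[OF J(1)] by simp
    then obtain y where "y \<in> C \<inter> J" "z = S y" by blast
    then show ?thesis using monotonic_same_side[OF mono[OF J(1)]] J True by blast
  qed
  moreover have "S p \<noteq> S e" using monotonic_inj_on[OF mono[OF J(1)]] J True by (meson IntI inj_onD)
  ultimately have "porous_between C (\<kappa> * g / 2) (S p) (S e)"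
    by (intro porous_at_end[OF gap]) (use S_in J in auto)
  then show ?thesis
    using porous_pull_back[of p p 1 e "\<kappa> * g / 2"] J True S_in \<kappa> gap(3) by auto
qed

text \<open>Let \<open>e\<close> be the right end of the piece of \<open>p\<close> and
  \<open>e'\<close> the next point of \<open>C\<close>, which is the left end of its own piece. One
  of the segments from \<open>p\<close> to \<open>e\<close>, \<open>e\<close> to \<open>e'\<close>
  and \<open>e'\<close> to \<open>q\<close> has at least a third of the length. The middle one is a
  gap, and the outer ones start at ends of pieces; hence 12 = 3 * 4.\<close>

lemma porous_across_pieces:
  assumes gap: "adjacent C c d" "\<And>p q. \<lbrakk>p \<in> C; q \<in> C\<rbrakk> \<Longrightarrow> g * \<bar>p - q\<bar> \<le> \<bar>c - d\<bar>" "g \<ge> 0"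
    and small: "\<kappa> * g \<le> 4"
    and pq: "p \<in> C" "q \<in> C" "\<not> (\<exists>J\<in>\<I>. p \<in> J \<and> q \<in> J)" "p < q"
  shows "porous_between C (\<kappa> * g / 12) p q"
proof -
  obtain J where J: "J \<in> \<I>" "p \<in> J" using in_piece pq by blast
  obtain e where e: "e \<in> C \<inter> J" "\<And>y. y \<in> C \<inter> J \<Longrightarrow> y \<le> e"
    using compact_attains_sup[OF piece_compact[OF J(1)]] by blast
  have pe: "p \<le> e" using e(2) J pq by blast
  have eq: "e < q"
  proof (rule ccontr)
    assume "\<not> e < q"
    then have "q \<in> closed_segment p e" using pq(4) by (simp add: in_closed_segment_real)
    then have "q \<in> J" using piece_convex J e by blast
    then show False using pq J by blast
  qed
  define X where "X = C \<inter> (\<Union>(\<I> - {J}) \<inter> {e..})"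
  have XI: "z \<in> X" if "z \<in> C" "z \<notin> J" "e \<le> z" for z
    using that in_piece[of z] unfolding X_def by blast
  have "compact X" unfolding X_def
    by (intro compact_Int_closed compact closed_Int closed_Union)
      (use finite compact_piece compact_imp_closed in auto)
  moreover have qX: "q \<in> X" using XI pq eq J by force
  ultimately obtain e' where e': "e' \<in> X" "\<And>y. y \<in> X \<Longrightarrow> e' \<le> y"
    using compact_attains_inf[of X] by blast
  obtain K where K: "K \<in> \<I>" "e' \<in> K" "K \<noteq> J" using e'(1) X_def by blast
  have e'C: "e' \<in> C" "e' \<notin> J" using e'(1) K J piece_unique unfolding X_def by blast+
  then have ee': "e < e'" "e' \<le> q" using e' e(1) qX unfolding X_def by (auto simp: order.order_iff_strict)
  have adj: "adjacent C e e'"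
  proof -
    have False if "z \<in> C" "e < z" "z < e'" for z
    proof (cases "z \<in> J")
      case True
      then show False using e(2)[of z] that by simp
    next
      case False
      then show False using e'(2)[OF XI[of z]] that by simp
    qed
    then show ?thesis using e(1) e'C(1) ee' unfolding adjacent_def disjoint_iff
      by (auto simp: in_open_segment_real)
  qed
  have Kmin: "e' \<le> z" if z: "z \<in> C \<inter> K" for z
  proof (rule ccontr)
    assume lt: "\<not> e' \<le> z"
    have zJ: "z \<notin> J" using z K J piece_unique by blast
    then have "\<not> e \<le> z" using e'(2)[OF XI[of z]] z lt by blast
    then have "e \<in> closed_segment z e'" using ee' by (simp add: in_closed_segment_real)
    then have "e \<in> K" using piece_convex K z by blast
    then show False using e K J piece_unique by blast
  qed
  have pos: "0 \<le> \<kappa> * g" using \<kappa> gap(3) by simp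
  have "q - p \<le> 3 * (e' - e) \<or> q - p \<le> 3 * (e - p) \<or> q - p \<le> 3 * (q - e')" by argo
  then consider "q - p \<le> 3 * (e' - e)" | "q - p \<le> 3 * (e - p)" | "q - p \<le> 3 * (q - e')" by blast
  then show ?thesis
  proof cases
    case 1
    have "\<kappa> * g / 12 * (q - p) \<le> 1 / 3 * (q - p)" using small pq(4) by (intro mult_right_mono) auto
    then have "\<kappa> * g / 12 * \<bar>p - q\<bar> \<le> \<bar>e - e'\<bar>" using 1 pq(4) ee' by simp
    then show ?thesis using adj pe eq ee' unfolding porous_between_def
      by (intro exI[of _ e] exI[of _ e']) (auto simp: in_closed_segment_real)
  next
    case 2
    then have "p \<noteq> e" using pq(4) by auto
    have "porous_between C (\<kappa> * g / 4) p e"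
    proof (rule porous_at_piece_end[OF gap J(1)])
      show "(z - e) * (p - e) \<ge> 0" if "z \<in> C \<inter> J" for z
        using e(2)[OF that] pe by (simp add: zero_le_mult_iff)
    qed (use e pq J \<open>p \<noteq> e\<close> in auto)
    then show ?thesis
    proof (rule porous_between_weaken)
      show "\<kappa> * g / 12 * \<bar>p - q\<bar> \<le> \<kappa> * g / 4 * \<bar>p - e\<bar>"
        using mult_left_mono[OF 2 pos] pq(4) pe by (simp add: field_simps)
    qed (use pe eq in \<open>auto simp: in_closed_segment_real\<close>)
  next
    case 3
    then have "q \<noteq> e'" using pq(4) by auto
    have "porous_between C (\<kappa> * g / 4) q e'"
    proof (rule porous_at_piece_end[OF gap K(1)])
      show "(z - e') * (q - e') \<ge> 0" if "z \<in> C \<inter> K" for z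
        using Kmin[OF that] ee' by simp
    qed (use e'C pq K \<open>q \<noteq> e'\<close> in auto)
    then show ?thesis
    proof (rule porous_between_weaken)
      show "\<kappa> * g / 12 * \<bar>p - q\<bar> \<le> \<kappa> * g / 4 * \<bar>q - e'\<bar>"
        using mult_left_mono[OF 3 pos] pq(4) ee' by (simp add: field_simps)
    qed (use pe ee' in \<open>auto simp: in_closed_segment_real\<close>)
  qed
qed

text \<open>Two points are magnified until they lie in different pieces. Pulling the gap back
  doubles the 12.\<close>

lemma porous:
  assumes "\<kappa> \<le> 1" "p \<in> C" "q \<in> C" "p \<noteq> q"
  shows "porous_between C (\<kappa> * ((1 - \<theta>) / (2 * card \<I>)) / 24) p q"
proof -
  define g where "g = (1 - \<theta>) / (2 * card \<I>)"
  obtain c d where gap: "adjacent C c d" "\<And>p q. \<lbrakk>p \<in> C; q \<in> C\<rbrakk> \<Longrightarrow> g * \<bar>p - q\<bar> \<le> \<bar>c - d\<bar>"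
    using large_gap unfolding g_def by blast
  have card: "real (card \<I>) \<ge> 1" using two_pieces finite by (auto simp: Suc_le_eq card_gt_0_iff)
  then have "g \<le> (1 - \<theta>) / 2" using \<theta> unfolding g_def by (intro divide_left_mono) auto
  then have "g \<le> 1" using \<theta> by argo
  have g: "0 \<le> g" using \<theta> by (simp add: g_def)
  then have small: "\<kappa> * g \<le> 4" using assms(1) \<kappa> mult_le_one[of \<kappa> g] \<open>g \<le> 1\<close> g by linarith
  obtain n where n: "{q} \<subseteq> cyl n p" "\<exists>y\<in>{q}. \<not> (\<exists>J\<in>\<I>. (S ^^ n) p \<in> J \<and> (S ^^ n) y \<in> J)"
    using cyl_depth[of p "{q}" q] assms by blast
  let ?p = "(S ^^ n) p" and ?q = "(S ^^ n) q"
  have C: "?p \<in> C" "?q \<in> C" using funpow_in assms by auto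
  have "\<not> (\<exists>J\<in>\<I>. ?p \<in> J \<and> ?q \<in> J)" using n(2) by simp
  moreover from this have "?p \<noteq> ?q" using in_piece[OF C(1)] by metis
  ultimately have "porous_between C (\<kappa> * g / 12) ?p ?q"
    using porous_across_pieces[OF gap g small C] porous_across_pieces[OF gap g small C(2,1)]
      porous_between_commute[of C _ ?p ?q]
    by (cases ?p ?q rule: linorder_cases) metis+
  moreover have "q \<in> cyl n p" "0 \<le> \<kappa> * g / 12" using n(1) \<kappa> g by auto
  ultimately have "porous_between C (\<kappa> * g / 12 / 2) p q"
    using porous_pull_back[OF assms(2) cyl_self[OF assms(2)]] by blast
  then show ?thesis by (simp add: g_def)
qed

section \<open>Renormalisation of \<open>f\<close> near a point of \<open>C\<close>\<close>

definition branch_inv :: "nat \<Rightarrow> real \<Rightarrow> real \<Rightarrow> real" where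
  "branch_inv n x = inv_into (cyl n x) (S ^^ n)"

lemma branch_inv:
  assumes "x \<in> C"
  shows "y \<in> C \<Longrightarrow> branch_inv n x y \<in> cyl n x" "y \<in> C \<Longrightarrow> (S ^^ n) (branch_inv n x y) = y"
    "u \<in> cyl n x \<Longrightarrow> branch_inv n x ((S ^^ n) u) = u"
  using cyl_image[OF assms, of n] cyl_inj[OF assms, of n]
  by (auto simp: branch_inv_def inv_into_into f_inv_into_f)

lemma cyl_spread: "x \<in> C \<Longrightarrow> spread_le (cyl n x) (\<theta> ^ n)"
  unfolding spread_le_def
proof (intro ballI)
  fix p q assume x: "x \<in> C" and pq: "p \<in> cyl n x" "q \<in> cyl n x"
  have "\<bar>(S ^^ n) p - (S ^^ n) q\<bar> \<le> 1"
    using spread_C pq cyl_subset funpow_in unfolding spread_le_def by blast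
  then have "\<theta> ^ n * \<bar>(S ^^ n) p - (S ^^ n) q\<bar> \<le> \<theta> ^ n * 1"
    using \<theta> by (intro mult_left_mono) auto
  with cyl_contract[OF x pq] show "\<bar>p - q\<bar> \<le> \<theta> ^ n" by simp
qed

lemma cyl_infinite: "x \<in> C \<Longrightarrow> infinite (cyl n x)"
  using cyl_image[of x n] infinite finite_imageI by metis

text \<open>\<open>h\<close> is \<open>f\<close> in the coordinates \<open>S ^^ n\<close> near
  \<open>x\<close> and \<open>S ^^ m\<close> near \<open>f x\<close>. The inverse branch,
  \<open>f\<close> and \<open>S ^^ m\<close> contribute \<open>\<delta>\<close> each. With
  \<open>k\<close> independent of \<open>n\<close>, the images of a fixed gap stay long, and so
  range over a finite set.\<close>

definition renormalized ::
    "(real \<Rightarrow> real) \<Rightarrow> real \<Rightarrow> real \<Rightarrow> nat \<Rightarrow> nat \<Rightarrow> (real \<Rightarrow> real) \<Rightarrow> bool" where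
  "renormalized f x k n m h \<longleftrightarrow>
     f ` cyl n x \<subseteq> cyl m (f x) \<and> (\<forall>u\<in>cyl n x. h ((S ^^ n) u) = (S ^^ m) (f u)) \<and>
     h ` C \<subseteq> C \<and> monotonic C h \<and> distortion_le h C (3 * \<delta>) \<and>
     (\<forall>u v. adjacent C u v \<longrightarrow> adjacent C (h u) (h v) \<and> k * \<bar>u - v\<bar> \<le> \<bar>h u - h v\<bar>)"

text \<open>Take for \<open>m\<close> the depth of the smallest cylinder containing \<open>f ` cyl n x\<close>: then the image of
  \<open>h\<close> meets two pieces, so \<open>h\<close> cannot contract too much.\<close>

lemma renormalized_exists:
  assumes f: "f ` C \<subseteq> C" and x: "x \<in> C"
    and V: "monotonic (cyl n x) f" "distortion_le f (cyl n x) \<delta>"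
    and adj: "\<And>u v. \<lbrakk>u \<in> cyl n x; v \<in> cyl n x; adjacent C u v\<rbrakk> \<Longrightarrow> adjacent C (f u) (f v)"
    and \<gamma>: "\<gamma> > 0" "\<And>x y. \<lbrakk>x \<in> C; y \<in> C; \<not> (\<exists>J\<in>\<I>. x \<in> J \<and> y \<in> J)\<rbrakk> \<Longrightarrow> \<gamma> \<le> \<bar>x - y\<bar>"
  shows "\<exists>m h. renormalized f x (exp (- (3 * \<delta>)) * \<gamma>) n m h"
proof -
  let ?V = "cyl n x" and ?T = "branch_inv n x"
  have VC: "?V \<subseteq> C" by (rule cyl_subset)
  have fx: "f x \<in> C" using f x by blast
  have "infinite (f ` ?V)"
    using cyl_infinite[OF x] monotonic_inj_on[OF V(1)] finite_image_iff by blast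
  then have "\<not> f ` ?V \<subseteq> {f x}" using finite_subset by blast
  then obtain q where q: "q \<in> f ` ?V" "q \<noteq> f x" by blast
  have "f ` ?V \<subseteq> C" using f VC by blast
  then obtain m where m: "f ` ?V \<subseteq> cyl m (f x)"
    "\<exists>y\<in>f ` ?V. \<not> (\<exists>J\<in>\<I>. (S ^^ m) (f x) \<in> J \<and> (S ^^ m) y \<in> J)"
    using cyl_depth[OF fx _ q] by metis
  from m(2) obtain y where y: "y \<in> f ` ?V" "\<not> (\<exists>J\<in>\<I>. (S ^^ m) (f x) \<in> J \<and> (S ^^ m) y \<in> J)" ..
  from y(1) obtain z where "z \<in> ?V" "y = f z" ..
  with y(2) have z: "z \<in> ?V" "\<not> (\<exists>J\<in>\<I>. (S ^^ m) (f x) \<in> J \<and> (S ^^ m) (f z) \<in> J)" by simp_all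
  define h where "h = (S ^^ m) \<circ> (f \<circ> ?T)"
  have TC: "?T ` C = ?V"
  proof (intro equalityI subsetI)
    fix u assume u: "u \<in> ?V"
    then have "(S ^^ n) u \<in> C" using VC funpow_in by blast
    moreover have "u = ?T ((S ^^ n) u)" using branch_inv(3)[OF x u] by simp
    ultimately show "u \<in> ?T ` C" by (rule rev_image_eqI)
  qed (use branch_inv(1)[OF x] in blast)
  have Timg: "(S ^^ n) ` ?V = C" by (rule cyl_image[OF x])
  have T: "monotonic C ?T" "distortion_le ?T C \<delta>"
    using monotonic_inverse[OF cyl_monotonic[OF x], of n ?T]
      distortion_le_inverse[OF cyl_distortion[OF x], of n ?T] branch_inv(3)[OF x] Timg by auto
  have h: "h ((S ^^ n) u) = (S ^^ m) (f u)" if "u \<in> ?V" for u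
    using branch_inv(3)[OF x that] by (simp add: h_def)
  have fT: "monotonic C (f \<circ> ?T)" "distortion_le (f \<circ> ?T) C (\<delta> + \<delta>)"
    using monotonic_comp[OF T(1)] distortion_le_comp[OF T(2), of f \<delta>] V TC monotonic_inj_on[OF T(1)]
    by simp_all
  have fTC: "(f \<circ> ?T) ` C \<subseteq> cyl m (f x)" using m(1) by (simp only: image_comp[symmetric] TC)
  have mono: "monotonic C h" unfolding h_def
    by (intro monotonic_comp fT monotonic_subset[OF cyl_monotonic[OF fx] fTC])
  have "distortion_le h C (\<delta> + \<delta> + \<delta>)" unfolding h_def
    by (intro distortion_le_comp fT distortion_le_subset[OF cyl_distortion[OF fx] fTC]
        monotonic_inj_on)
  then have dist: "distortion_le h C (3 * \<delta>)" by (simp add: algebra_simps)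
  have hC: "h ` C \<subseteq> C"
    using image_mono[OF fTC, of "S ^^ m"] cyl_image[OF fx, of m] by (simp only: h_def image_comp)
  have hadj: "adjacent C (h u) (h v)" if uv: "adjacent C u v" for u v
  proof -
    have uvC: "u \<in> C" "v \<in> C" using uv unfolding adjacent_def by auto
    then have TV: "?T u \<in> ?V" "?T v \<in> ?V" using branch_inv(1)[OF x] by auto
    then have "adjacent C (?T u) (?T v)"
      using cyl_adjacent[OF x TV] branch_inv(2)[OF x] uvC uv by simp
    then have "adjacent C (f (?T u)) (f (?T v))" using adj TV by blast
    moreover have "f (?T u) \<in> cyl m (f x)" "f (?T v) \<in> cyl m (f x)" using m(1) TV by auto
    ultimately show ?thesis using cyl_adjacent[OF fx] by (simp add: h_def)
  qed
  \<comment> \<open>\<open>h\<close> has one difference quotient of size at least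
    \<open>\<gamma>\<close>: two image points lie in different pieces, and \<open>C\<close> has
    diameter at most 1. Distortion transfers this to every gap.\<close>
  have "exp (- (3 * \<delta>)) * \<gamma> * \<bar>u - v\<bar> \<le> \<bar>h u - h v\<bar>" if uv: "adjacent C u v" for u v
  proof -
    have uvC: "u \<in> C" "v \<in> C" using uv unfolding adjacent_def by auto
    let ?a = "(S ^^ n) x" and ?b = "(S ^^ n) z"
    have zC: "z \<in> C" using z VC by blast
    have ab: "?a \<in> C" "?b \<in> C" using funpow_in x zC by auto
    have "\<gamma> \<le> \<bar>(S ^^ m) (f x) - (S ^^ m) (f z)\<bar>"
      by (rule \<gamma>(2)[OF funpow_in funpow_in z(2)]) (use fx f zC in auto)
    then have "\<gamma> \<le> \<bar>h ?a - h ?b\<bar>" using h cyl_self[OF x] z(1) by simp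
    then have "\<gamma> * \<bar>u - v\<bar> \<le> \<bar>h ?a - h ?b\<bar> * \<bar>u - v\<bar>" by (intro mult_right_mono) auto
    also have "\<dots> \<le> exp (3 * \<delta>) * (\<bar>h u - h v\<bar> * \<bar>?a - ?b\<bar>)"
      using distortion_leD[OF dist] ab uvC by blast
    also have "\<dots> \<le> exp (3 * \<delta>) * (\<bar>h u - h v\<bar> * 1)"
      using spread_C ab unfolding spread_le_def by (intro mult_left_mono) auto
    finally have "exp (- (3 * \<delta>)) * (\<gamma> * \<bar>u - v\<bar>) \<le> exp (- (3 * \<delta>)) * (exp (3 * \<delta>) * \<bar>h u - h v\<bar>)"
      by (intro mult_left_mono) auto
    then show ?thesis by (simp add: exp_minus field_simps)
  qed
  then show ?thesis
    using m(1) h hC mono dist hadj unfolding renormalized_def by blast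
qed

text \<open>For a fixed gap there are only finitely many possible image gaps, so by rigidity one
  renormalised map \<open>h\<close> recurs at infinitely many depths. Letting the depth tend to infinity, \<open>f\<close>
  contributes nothing to the distortion of \<open>h\<close>, which is therefore controlled by \<open>S\<close> alone.\<close>

lemma local_Lipschitz_distortion:
  assumes "\<kappa> \<le> 1" "\<delta> > 0"
    and rigid: "exp (2 * (3 * \<delta>)) < 1 + \<kappa> * ((1 - \<theta>) / (2 * card \<I>)) / 24"
    and f: "f ` C \<subseteq> C"
    and small: "\<And>\<eta>. \<eta> > 0 \<Longrightarrow> \<exists>\<rho>>0. \<forall>B\<subseteq>C. spread_le B \<rho> \<longrightarrow> distortion_le f B \<eta>"
    and "\<rho> > 0" and mono: "\<And>B. \<lbrakk>B \<subseteq> C; spread_le B \<rho>\<rbrakk> \<Longrightarrow> monotonic B f"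
    and adj: "\<And>u v. \<lbrakk>adjacent C u v; \<bar>u - v\<bar> \<le> \<rho>\<rbrakk> \<Longrightarrow> adjacent C (f u) (f v)"
    and x: "x \<in> C"
  shows "\<exists>r>0. \<exists>Q\<ge>0. \<forall>B D. B \<subseteq> C \<longrightarrow> (\<forall>y\<in>B. \<bar>y - x\<bar> < r) \<longrightarrow> D \<ge> 0 \<longrightarrow> spread_le B D \<longrightarrow>
           distortion_le f B (Q * D)"
proof -
  have fx: "f x \<in> C" using f x by blast
  have deep: "\<exists>N. \<forall>n\<ge>N. \<theta> ^ n \<le> r" if "r > 0" for r
  proof -
    have "(\<lambda>n. \<theta> ^ n) \<longlonglongrightarrow> 0" using \<theta> by (intro LIMSEQ_realpow_zero) auto
    then have "\<forall>\<^sub>F n in sequentially. \<theta> ^ n < r" using that by (intro order_tendstoD(2)) auto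
    then show ?thesis unfolding eventually_sequentially by (meson less_imp_le)
  qed
  have spread: "spread_le (cyl n x) r" if "\<theta> ^ n \<le> r" for n r
    using cyl_spread[OF x, of n] that unfolding spread_le_def by (meson order_trans)
  obtain \<rho>' where \<rho>': "\<rho>' > 0" "\<And>B. \<lbrakk>B \<subseteq> C; spread_le B \<rho>'\<rbrakk> \<Longrightarrow> distortion_le f B \<delta>"
    using small[OF \<open>\<delta> > 0\<close>] by blast
  obtain N where N: "\<And>n. n \<ge> N \<Longrightarrow> \<theta> ^ n \<le> min \<rho> \<rho>'" using deep[of "min \<rho> \<rho>'"] \<rho>' \<open>\<rho> > 0\<close> by auto
  obtain \<gamma> where \<gamma>: "\<gamma> > 0"
    "\<And>x y. \<lbrakk>x \<in> C; y \<in> C; \<not> (\<exists>J\<in>\<I>. x \<in> J \<and> y \<in> J)\<rbrakk> \<Longrightarrow> \<gamma> \<le> \<bar>x - y\<bar>"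
    using pieces_separated by blast
  define k where "k = exp (- (3 * \<delta>)) * \<gamma>"
  have k: "k > 0" using \<gamma> by (simp add: k_def)
  have ex: "\<exists>m h. renormalized f x k n m h" if n: "n \<ge> N" for n
    unfolding k_def
  proof (rule renormalized_exists[OF f x _ _ _ \<gamma>])
    have sp: "spread_le (cyl n x) \<rho>" "spread_le (cyl n x) \<rho>'" using spread N[OF n] by auto
    then show "monotonic (cyl n x) f" "distortion_le f (cyl n x) \<delta>" using mono \<rho>' cyl_subset by auto
    show "adjacent C (f u) (f v)" if "u \<in> cyl n x" "v \<in> cyl n x" "adjacent C u v" for u v
      using sp(1) adj that unfolding spread_le_def by blast
  qed
  define m where "m n = (SOME m. \<exists>h. renormalized f x k n m h)" for n
  define h where "h n = (SOME h. renormalized f x k n (m n) h)" for n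
  have mh: "renormalized f x k n (m n) (h n)" if "n \<ge> N" for n
  proof -
    have "\<exists>h. renormalized f x k n (m n) h" unfolding m_def by (rule someI_ex[OF ex[OF that]])
    then show ?thesis unfolding h_def by (rule someI_ex)
  qed
  obtain c d where cd: "adjacent C c d" by (rule large_gap)
  have cdC: "c \<in> C" "d \<in> C" "c \<noteq> d" using cd unfolding adjacent_def by auto
  \<comment> \<open>The images of the ends of one gap take finitely many values, and by rigidity
    they determine \<open>h n\<close> on \<open>C\<close>.\<close>
  define \<phi> where "\<phi> n = (h n c, h n d)" for n
  have "\<phi> ` {N..} \<subseteq> {(u, v). adjacent C u v \<and> k * \<bar>c - d\<bar> \<le> \<bar>u - v\<bar>}"
    using mh cd unfolding renormalized_def \<phi>_def by auto
  then have "finite (\<phi> ` {N..})"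
    using finite_large_gaps[OF unit, of "k * \<bar>c - d\<bar>"] k cdC by (meson finite_subset mult_pos_pos zero_less_abs_iff right_minus_eq)
  then obtain n1 where n1: "n1 \<ge> N" "infinite {n \<in> {N..}. \<phi> n = \<phi> n1}"
    using pigeonhole_infinite[of "{N..}" \<phi>] infinite_Ici by auto
  define h1 where "h1 = h n1"
  have same: "h n y = h1 y" if "n \<ge> N" "\<phi> n = \<phi> n1" "y \<in> C" for n y
    unfolding h1_def
  proof (rule porous_rigidity[OF compact porous[OF \<open>\<kappa> \<le> 1\<close>] rigid, where h = "h n" and k = "h n1" and a = c and b = d])
    show "h n c = h n1 c" "h n d = h n1 d" using that(2) by (auto simp: \<phi>_def)
  qed (use mh[OF that(1)] mh[OF n1(1)] that(3) cdC in \<open>auto simp: renormalized_def\<close>)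
  have h1: "h1 ` C \<subseteq> C" "monotonic C h1" "distortion_le h1 C (3 * \<delta>)"
    using mh[OF n1(1)] by (auto simp: renormalized_def h1_def)
  define \<Lambda> where "\<Lambda> = exp (3 * \<delta>) / \<bar>c - d\<bar>"
  have \<Lambda>: "\<Lambda> \<ge> 0" by (simp add: \<Lambda>_def)
  have Lip: "\<bar>h1 u - h1 v\<bar> \<le> \<Lambda> * \<bar>u - v\<bar>" if "u \<in> C" "v \<in> C" for u v
  proof -
    have "\<bar>h1 u - h1 v\<bar> * \<bar>c - d\<bar> \<le> exp (3 * \<delta>) * (\<bar>h1 c - h1 d\<bar> * \<bar>u - v\<bar>)"
      using distortion_leD[OF h1(3)] that cdC by blast
    also have "\<dots> \<le> exp (3 * \<delta>) * (1 * \<bar>u - v\<bar>)"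
      using spread_C h1(1) cdC unfolding spread_le_def by (intro mult_left_mono mult_right_mono) auto
    finally show ?thesis using cdC by (simp add: \<Lambda>_def field_simps)
  qed
  then have h1_spread: "spread_le (h1 ` B) (\<Lambda> * D)" if "B \<subseteq> C" "spread_le B D" for B D
    using that \<Lambda> unfolding spread_le_def by (auto intro: order_trans[OF Lip mult_left_mono])
  define L where "L = M / (1 - \<theta>)"
  have L: "L \<ge> 0" using M \<theta> by (simp add: L_def)
  \<comment> \<open>\<open>h1\<close> factors through \<open>f\<close> at arbitrarily large depths.
    There \<open>f\<close> contributes at most \<open>\<eta>\<close>, whereas the estimates for the
    inverse branch and for \<open>S ^^ m n\<close> are uniform in the depth.\<close>
  have h1_dist: "distortion_le h1 B (L * D + L * (\<Lambda> * D))"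
    if B: "B \<subseteq> C" "spread_le B D" "D \<ge> 0" for B D
  proof (rule distortion_le_limit)
    fix \<eta> :: real assume "\<eta> > 0"
    then obtain r where r: "r > 0" "\<And>B. \<lbrakk>B \<subseteq> C; spread_le B r\<rbrakk> \<Longrightarrow> distortion_le f B \<eta>"
      using small by blast
    obtain N' where N': "\<And>n. n \<ge> N' \<Longrightarrow> \<theta> ^ n \<le> r" using deep[OF r(1)] by blast
    obtain n where n: "n \<ge> N" "\<phi> n = \<phi> n1" "n \<ge> N'"
      using n1(2) unfolding infinite_nat_iff_unbounded_le by blast
    let ?T = "branch_inv n x"
    have hn: "f ` cyl n x \<subseteq> cyl (m n) (f x)" "\<And>u. u \<in> cyl n x \<Longrightarrow> h n ((S ^^ n) u) = (S ^^ m n) (f u)"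
      using mh[OF n(1)] by (auto simp: renormalized_def)
    have TB: "?T ` B \<subseteq> cyl n x" using branch_inv(1)[OF x] B by blast
    have "(S ^^ n) ` ?T ` B = (\<lambda>y. y) ` B"
      unfolding image_image by (rule image_cong) (use branch_inv(2)[OF x] B(1) in auto)
    then have STB: "(S ^^ n) ` ?T ` B = B" by simp
    have hT: "(S ^^ m n) (f (?T y)) = h1 y" if "y \<in> B" for y
    proof -
      have "y \<in> C" "?T y \<in> cyl n x" using that B(1) TB by blast+
      then show ?thesis
        using hn(2)[of "?T y"] branch_inv(2)[OF x, of y n] same[OF n(1,2), of y] by simp
    qed
    have SfTB: "(S ^^ m n) ` f ` ?T ` B = h1 ` B"
      unfolding image_image by (rule image_cong) (use hT in auto)
    have "distortion_le (S ^^ n) (?T ` B) (L * D)"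
      unfolding L_def by (rule cyl_distortion_Lipschitz[OF x TB]) (use B STB in auto)
    from distortion_le_inverse[OF this, of ?T] have dT: "distortion_le ?T B (L * D)"
      using branch_inv(3)[OF x] TB STB by auto
    have df: "distortion_le f (?T ` B) \<eta>"
      using TB cyl_subset distortion_le_subset[OF r(2)[OF cyl_subset spread[OF N'[OF n(3)]]]] by blast
    have dS: "distortion_le (S ^^ m n) (f ` ?T ` B) (L * (\<Lambda> * D))"
      unfolding L_def
    proof (rule cyl_distortion_Lipschitz[OF fx])
      show "f ` ?T ` B \<subseteq> cyl (m n) (f x)" using hn(1) TB by blast
      show "spread_le ((S ^^ m n) ` f ` ?T ` B) (\<Lambda> * D)" using SfTB h1_spread B by simp
    qed (use \<Lambda> B in auto)
    have inj1: "inj_on ((S ^^ m n) \<circ> (f \<circ> ?T)) B"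
      using monotonic_inj_on[OF h1(2)] B(1) hT unfolding inj_on_def by auto
    then have inj2: "inj_on (f \<circ> ?T) B" using inj_on_imageI2 by blast
    then have inj3: "inj_on ?T B" using inj_on_imageI2 by blast
    have "distortion_le ((S ^^ m n) \<circ> (f \<circ> ?T)) B ((L * D + \<eta>) + L * (\<Lambda> * D))"
      by (intro distortion_le_comp dT df inj2 inj3) (use dS in \<open>simp add: image_comp\<close>)
    then show "distortion_le h1 B (L * D + L * (\<Lambda> * D) + \<eta>)"
      by (rule distortion_le_cong[OF distortion_le_mono]) (use hT in auto)
  qed
  define e where "e = inverse (\<kappa> ^ n1)"
  have e: "e \<ge> 0" using \<kappa> by (simp add: e_def)
  have hn1: "f ` cyl n1 x \<subseteq> cyl (m n1) (f x)"
    "\<And>u. u \<in> cyl n1 x \<Longrightarrow> h1 ((S ^^ n1) u) = (S ^^ m n1) (f u)"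
    using mh[OF n1(1)] by (auto simp: renormalized_def h1_def)
  obtain r where r: "r > 0" "\<And>y. \<lbrakk>y \<in> C; \<bar>y - x\<bar> < r\<rbrakk> \<Longrightarrow> y \<in> cyl n1 x"
    using cyl_nbhd[OF x] by blast
  \<comment> \<open>On the cylinder of the fixed depth \<open>n1\<close>, \<open>f\<close> is
    \<open>S ^^ n1\<close> followed by \<open>h1\<close> and an inverse branch. \<open>h1\<close>
    accounts for one half of each term; the rest comes from the iterate and the inverse branch.
    \<open>e\<close> bounds the expansion of \<open>S ^^ n1\<close>.\<close>
  define Q where "Q = 2 * L * e + 2 * L * \<Lambda> * e"
  show ?thesis
  proof (rule exI[of _ r], rule conjI[OF r(1)], rule exI[of _ Q], intro conjI allI impI)
    show "Q \<ge> 0" using L e \<Lambda> by (simp add: Q_def)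
    fix B D assume B: "B \<subseteq> C" "\<forall>y\<in>B. \<bar>y - x\<bar> < r" "0 \<le> D" "spread_le B D"
    let ?S = "S ^^ n1" and ?T = "branch_inv (m n1) (f x)"
    have BV: "B \<subseteq> cyl n1 x" using B r by blast
    have eD: "e * D \<ge> 0" using e B by simp
    have SB: "?S ` B \<subseteq> C" using B(1) funpow_in by blast
    have sp: "spread_le (?S ` B) (e * D)"
      unfolding spread_le_def
    proof clarify
      fix p q assume pq: "p \<in> B" "q \<in> B"
      have "\<kappa> ^ n1 * \<bar>?S p - ?S q\<bar> \<le> \<bar>p - q\<bar>" using cyl_lower[OF x] BV pq by blast
      also have "\<dots> \<le> D" using B(4) pq unfolding spread_le_def by blast
      finally show "\<bar>?S p - ?S q\<bar> \<le> e * D" using \<kappa> by (simp add: e_def field_simps)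
    qed
    have d1: "distortion_le ?S B (L * (e * D))"
      unfolding L_def by (rule cyl_distortion_Lipschitz[OF x BV sp eD])
    have d2: "distortion_le h1 (?S ` B) (L * (e * D) + L * (\<Lambda> * (e * D)))"
      by (rule h1_dist[OF SB sp eD])
    have img: "(S ^^ m n1) ` f ` B = h1 ` ?S ` B"
      unfolding image_image by (rule image_cong) (use hn1(2) BV in auto)
    have fB: "f ` B \<subseteq> cyl (m n1) (f x)" using hn1(1) BV by blast
    have "distortion_le (S ^^ m n1) (f ` B) (L * (\<Lambda> * (e * D)))"
      unfolding L_def
      by (rule cyl_distortion_Lipschitz[OF fx fB]) (use img h1_spread[OF SB sp] \<Lambda> eD in auto)
    from distortion_le_inverse[OF this, of ?T] have d3: "distortion_le ?T (h1 ` ?S ` B) (L * (\<Lambda> * (e * D)))"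
      using branch_inv(3)[OF fx] fB img by auto
    have inj: "inj_on ?S B" "inj_on h1 (?S ` B)"
      using cyl_inj[OF x] BV inj_on_subset monotonic_inj_on[OF h1(2)] SB by blast+
    have "distortion_le (?T \<circ> (h1 \<circ> ?S)) B
        ((L * (e * D) + (L * (e * D) + L * (\<Lambda> * (e * D)))) + L * (\<Lambda> * (e * D)))"
      by (intro distortion_le_comp d1 d2 inj comp_inj_on) (use d3 in \<open>simp add: image_comp\<close>)
    then have "distortion_le (?T \<circ> (h1 \<circ> ?S)) B (Q * D)"
      by (rule distortion_le_mono) (simp add: Q_def algebra_simps)
    then show "distortion_le f B (Q * D)"
    proof (rule distortion_le_cong)
      fix u assume "u \<in> B"
      then have "u \<in> cyl n1 x" "f u \<in> cyl (m n1) (f x)" using BV fB by blast+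
      then show "(?T \<circ> (h1 \<circ> ?S)) u = f u" using hn1(2) branch_inv(3)[OF fx] by simp
    qed
  qed
qed

end

subsection \<open>Circle diffeomorphisms\<close>

lemma int_valued_constant:
  fixes g :: "real \<Rightarrow> real"
  assumes "continuous_on UNIV g" "\<And>x. g x \<in> \<int>"
  shows "\<exists>p. \<forall>x. g x = of_int p"
proof -
  have "g constant_on UNIV"
  proof (rule continuous_discrete_range_constant[OF connected_UNIV assms(1)])
    fix x
    have "1 \<le> norm (g y - g x)" if "g y \<noteq> g x" for y
      using Ints_nonzero_abs_ge1[of "g y - g x"] assms(2) that by (simp add: Ints_diff)
    then show "\<exists>e>0. \<forall>y. y \<in> UNIV \<and> g y \<noteq> g x \<longrightarrow> e \<le> norm (g y - g x)"
      by (intro exI[of _ 1]) auto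
  qed
  then obtain c where "\<And>x. g x = c" unfolding constant_on_def by auto
  then show ?thesis using assms(2)[of 0] by (metis Ints_cases)
qed

lemma frac_eq_iff_diff_Ints: "frac x = frac y \<longleftrightarrow> x - y \<in> \<int>" for x y :: real
proof
  assume "frac x = frac y"
  then have "x - y = of_int (\<lfloor>x\<rfloor> - \<lfloor>y\<rfloor>)" by (simp add: frac_def algebra_simps)
  then show "x - y \<in> \<int>" by (simp only: Ints_of_int)
next
  assume "x - y \<in> \<int>"
  then have "frac (y + (x - y)) = frac y" by (rule frac_add_int_right)
  then show "frac x = frac y" by simp
qed

text \<open>Composing the lifts of \<open>f\<close> and of its inverse gives a translation, whence \<open>F' \<noteq> 0\<close>.\<close>

lemma circle_C1_diffeo_lift:
  assumes "circle_C1_diffeo f"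
  obtains F F' where "\<And>x. f (frac x) = frac (F x)" "\<And>x. (F has_real_derivative F' x) (at x)"
    "continuous_on UNIV F'" "\<And>x. F' x \<noteq> 0" "inj F"
proof -
  have bij: "bij_betw f circle circle" using assms by (simp add: circle_C1_diffeo_def)
  obtain F where F: "F C1_differentiable_on UNIV" "\<And>x. f (frac x) = frac (F x)"
    using assms unfolding circle_C1_diffeo_def circle_C1_def by blast
  obtain G where G: "G C1_differentiable_on UNIV" "\<And>x. inv_into circle f (frac x) = frac (G x)"
    using assms unfolding circle_C1_diffeo_def circle_C1_def by blast
  obtain F' where F': "\<And>x. (F has_real_derivative F' x) (at x)" "continuous_on UNIV F'"
    using F(1) unfolding C1_differentiable_on_def by (auto simp: has_real_derivative_iff_has_vector_derivative)
  obtain G' where "\<forall>x\<in>UNIV. (G has_vector_derivative G' x) (at x)" "continuous_on UNIV G'"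
    using G(1) unfolding C1_differentiable_on_def by blast
  then have G': "(G has_real_derivative G' x) (at x)" for x
    by (simp add: has_real_derivative_iff_has_vector_derivative)
  have contF: "continuous_on UNIV F" by (rule DERIV_continuous_on, rule F'(1))
  have contG: "continuous_on UNIV G" by (rule DERIV_continuous_on, rule G')
  have "G (F x) - x \<in> \<int>" for x
  proof -
    have "frac x \<in> circle" by (simp add: circle_def frac_lt_1)
    then have "inv_into circle f (f (frac x)) = frac x"
      using bij by (simp add: bij_betw_def inv_into_f_f)
    then show ?thesis using F(2) G(2) by (simp add: frac_eq_iff_diff_Ints[symmetric])
  qed
  moreover have "continuous_on UNIV (\<lambda>x. G (F x) - x)"
    by (intro continuous_intros continuous_on_compose2[OF contG contF]) auto
  ultimately obtain p where p: "\<And>x. G (F x) - x = of_int p"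
    using int_valued_constant[of "\<lambda>x. G (F x) - x"] by blast
  have GF: "G (F x) = x + of_int p" for x using p[of x] by (simp add: algebra_simps)
  have "F' x \<noteq> 0" for x
  proof -
    have "((\<lambda>x. G (F x)) has_real_derivative G' (F x) * F' x) (at x)"
      using DERIV_chain2[OF G' F'(1)] .
    moreover have "((\<lambda>x. G (F x)) has_real_derivative 1) (at x)"
      unfolding GF by (auto intro!: derivative_eq_intros)
    ultimately have "G' (F x) * F' x = 1" by (rule DERIV_unique)
    then show ?thesis by auto
  qed
  moreover have "inj F" using GF by (intro injI) (metis add_right_cancel)
  ultimately show thesis using that F(2) F' by blast
qed

text \<open>The preimage under \<open>frac\<close> is the sum of the integers and \<open>K\<close>,
  a closed and a compact set.\<close>

lemma circle_closed_compact:
  assumes "compact K" "K \<subseteq> {0..<1}"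
  shows "circle_closed K"
proof -
  have "frac -` K = (\<Union>p\<in>\<int>. \<Union>y\<in>K. {p + y})"
  proof (intro equalityI subsetI)
    fix x :: real assume "x \<in> frac -` K"
    moreover have "x = of_int \<lfloor>x\<rfloor> + frac x" by (simp add: frac_def)
    ultimately show "x \<in> (\<Union>p\<in>\<int>. \<Union>y\<in>K. {p + y})" by auto
  next
    fix x :: real assume "x \<in> (\<Union>p\<in>\<int>. \<Union>y\<in>K. {p + y})"
    then obtain p y where "p \<in> \<int>" "y \<in> K" "x = p + y" by blast
    then have "frac x = y" using assms(2) frac_add_int_left[of p y] by (auto simp: subset_iff)
    with \<open>y \<in> K\<close> show "x \<in> frac -` K" by simp
  qed
  moreover have "closed (\<Union>p\<in>\<int>. \<Union>y\<in>K. {p + y} :: real set)"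
    by (intro closed_compact_sums closed_Ints assms)
  ultimately show ?thesis using assms(2) by (simp add: circle_closed_def circle_def)
qed

locale lifted_minimal =
  fixes f F F' :: "real \<Rightarrow> real" and C :: "real set"
  assumes lift: "f (frac x) = frac (F x)"
    and deriv: "(F has_real_derivative F' x) (at x)"
    and cont_deriv: "continuous_on UNIV F'" and deriv_nz: "F' x \<noteq> 0" and inj: "inj F"
    and inj_f: "inj_on f {0..<1}"
    and compact: "compact C" and infinite: "infinite C" and unit: "C \<subseteq> {0..<1}"
    and minimal: "minimal_set f C"
begin

lemma f_image: "f ` C = C"
  using minimal by (simp add: minimal_set_def)

lemma funpow_in: "x \<in> C \<Longrightarrow> (f ^^ n) x \<in> C"
  using f_image by (induction n) auto

lemma frac_C: "x \<in> C \<Longrightarrow> frac x = x"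
  using unit by (simp add: subset_iff)

text \<open>The periodic lift of \<open>C\<close>. Schwartz's argument runs here, where
  \<open>F\<close> is monotone and iterates need no reduction modulo 1.\<close>

definition X :: "real set" where
  "X = frac -` C"

lemma closed_X: "closed X"
  using minimal by (simp add: X_def minimal_set_def circle_closed_def)

lemma C_in_X: "x \<in> C \<Longrightarrow> x \<in> X"
  by (simp add: X_def frac_C)

lemma X_shift [simp]: "y + of_int p \<in> X \<longleftrightarrow> y \<in> X" "y - of_int p \<in> X \<longleftrightarrow> y \<in> X"
  using frac_add_of_int_right[of y "- p"] by (simp_all add: X_def)

lemma X_floor: "y \<in> X \<Longrightarrow> y - of_int \<lfloor>y\<rfloor> \<in> C"
  by (simp add: X_def frac_def)

lemma F_in_X_iff: "F y \<in> X \<longleftrightarrow> y \<in> X"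
proof
  assume "F y \<in> X"
  then have "f (frac y) \<in> f ` C" using lift f_image by (simp add: X_def)
  then obtain c where c: "c \<in> C" "f (frac y) = f c" by blast
  then have "frac y = c" using inj_f unit by (auto simp: inj_on_def frac_lt_1 subset_iff)
  with c show "y \<in> X" by (simp add: X_def)
next
  assume "y \<in> X"
  then have "f (frac y) \<in> f ` C" by (simp add: X_def)
  then show "F y \<in> X" using f_image lift[of y] by (simp add: X_def)
qed

lemma contF: "continuous_on A F"
  by (rule DERIV_continuous_on, rule DERIV_subset[OF deriv]) simp

lemma frac_funpow: "frac ((F ^^ n) y) = (f ^^ n) (frac y)"
  by (induction n) (auto simp: lift[symmetric])

lemma F_shift: "\<exists>d. \<forall>y. F (y + of_int p) = F y + of_int d"
proof -
  have "frac (F (y + of_int p)) = frac (F y)" for y using lift[of "y + of_int p"] lift[of y] by simp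
  then have "F (y + of_int p) - F y \<in> \<int>" for y by (simp add: frac_eq_iff_diff_Ints)
  moreover have "continuous_on UNIV (\<lambda>y. F (y + of_int p) - F y)"
    by (intro continuous_intros contF continuous_on_compose2[OF contF[of UNIV]]) auto
  ultimately obtain d where "\<And>y. F (y + of_int p) - F y = of_int d"
    using int_valued_constant[of "\<lambda>y. F (y + of_int p) - F y"] by blast
  then have "F (y + of_int p) = F y + of_int d" for y by (simp add: algebra_simps)
  then show ?thesis by blast
qed

lemma deriv_shift: "F' (y + of_int p) = F' y"
proof -
  obtain d where d: "\<And>y. F (y + of_int p) = F y + of_int d" using F_shift by blast
  have "((\<lambda>y. F (y + of_int p)) has_real_derivative F' (y + of_int p)) (at y)"
    using deriv[of "y + of_int p"] by (simp add: DERIV_shift)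
  moreover have "((\<lambda>y. F (y + of_int p)) has_real_derivative F' y) (at y)"
    unfolding d using deriv[of y] by (auto intro!: derivative_eq_intros)
  ultimately show ?thesis by (rule DERIV_unique)
qed

lemma deriv_bounds:
  obtains m W where "m > 0" "W > 0" "\<And>y. m \<le> \<bar>F' y\<bar>" "\<And>y. \<bar>F' y\<bar> \<le> W"
proof -
  have cont: "continuous_on {0..1} (\<lambda>y. \<bar>F' y\<bar>)"
    by (intro continuous_on_rabs continuous_on_subset[OF cont_deriv]) auto
  obtain y where y: "y \<in> {0..1}" "\<And>z. z \<in> {0..1} \<Longrightarrow> \<bar>F' y\<bar> \<le> \<bar>F' z\<bar>"
    using continuous_attains_inf[OF compact_Icc _ cont] by auto
  obtain w where w: "w \<in> {0..1}" "\<And>z. z \<in> {0..1} \<Longrightarrow> \<bar>F' z\<bar> \<le> \<bar>F' w\<bar>"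
    using continuous_attains_sup[OF compact_Icc _ cont] by auto
  have red: "F' z = F' (frac z)" for z
    using deriv_shift[of "frac z" "\<lfloor>z\<rfloor>"] by (simp add: frac_def)
  have "frac z \<in> {0..1}" for z :: real by (simp add: frac_lt_1 less_imp_le)
  then have "\<bar>F' y\<bar> \<le> \<bar>F' z\<bar>" "\<bar>F' z\<bar> \<le> \<bar>F' w\<bar>" for z
    using y(2) w(2) red[of z] by metis+
  then show thesis using that[of "\<bar>F' y\<bar>" "\<bar>F' w\<bar>"] deriv_nz by simp
qed

lemma monotonic_F: "monotonic UNIV F"
  by (rule monotonic_of_deriv[OF convex_UNIV deriv cont_deriv deriv_nz])

lemma adjacent_F:
  assumes "adjacent X u v"
  shows "adjacent X (F u) (F v)"
proof -
  have "adjacent X (F u) (F v) \<longleftrightarrow> adjacent X u v"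
  proof (rule adjacent_image_iff[where A = X and h = F])
  show "z \<in> F ` X" if z: "z \<in> X" "z \<in> open_segment (F u) (F v)" for z
  proof -
    have "connected (range F)" using contF connected_continuous_image by blast
    then have "z \<in> range F"
      using connectedD_interval[of "range F" "F u" "F v" z]
        connectedD_interval[of "range F" "F v" "F u" z] z(2) by (auto simp: in_open_segment_real)
    then show ?thesis using z(1) F_in_X_iff by blast
  qed
  show "monotonic X F" using monotonic_F monotonic_subset by blast
  show "F ` X \<subseteq> X" using F_in_X_iff by blast
  qed (use assms in \<open>auto simp: adjacent_def\<close>)
  with assms show ?thesis by blast
qed

lemma adjacent_X:
  assumes "adjacent C u v"
  shows "adjacent X u v"
proof -
  have uv: "u \<in> C" "v \<in> C" "u \<noteq> v" using assms unfolding adjacent_def by auto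
  have "z \<in> C" if "z \<in> X" "z \<in> open_segment u v" for z
  proof -
    have "0 \<le> z \<and> z < 1" using uv unit that(2) by (fastforce simp: in_open_segment_real)
    then have "frac z = z" by (simp add: frac_eq)
    then show ?thesis using that(1) by (simp add: X_def)
  qed
  then show ?thesis using assms uv C_in_X unfolding adjacent_def by blast
qed

text \<open>The maximum of \<open>C\<close> serves as \<open>w\<close>. The margin
  \<open>1 - w\<close> prevents nearby points of the lift from lying in different periods.\<close>

lemma diameter_less_1:
  obtains w where "w < 1" "\<And>x y. \<lbrakk>x \<in> C; y \<in> C\<rbrakk> \<Longrightarrow> \<bar>x - y\<bar> \<le> w"
proof -
  have ne: "C \<noteq> {}" using infinite by auto
  obtain w where w: "w \<in> C" "\<And>x. x \<in> C \<Longrightarrow> x \<le> w" using compact_attains_sup[OF compact ne] by blast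
  have "\<bar>x - y\<bar> \<le> w" if "x \<in> C" "y \<in> C" for x y
    using w(2)[OF that(1)] w(2)[OF that(2)] unit that by (force simp: abs_le_iff)
  with w(1) unit that[of w] show thesis by auto
qed

lemma F_Lipschitz:
  obtains W where "W > 0" "\<And>u v. \<bar>F u - F v\<bar> \<le> W * \<bar>u - v\<bar>"
proof -
  obtain m W where W: "W > 0" "\<And>y. \<bar>F' y\<bar> \<le> W" using deriv_bounds by metis
  have "\<bar>F u - F v\<bar> \<le> W * \<bar>u - v\<bar>" for u v
    using field_differentiable_bound[of UNIV F F' W u v] deriv W(2) by simp
  with W(1) that show thesis by blast
qed

text \<open>In the coordinate of the unit interval \<open>f\<close> jumps where \<open>F\<close>
  passes an integer, but not between close points of \<open>C\<close>: the two differences differ by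
  an integer, and the bounds \<open>w\<close> and \<open>(1 - w) / 2\<close> add up to less than
  1.\<close>

lemma f_diff_eq:
  obtains \<rho> where "\<rho> > 0" "\<And>u v. \<lbrakk>u \<in> C; v \<in> C; \<bar>u - v\<bar> \<le> \<rho>\<rbrakk> \<Longrightarrow> f u - f v = F u - F v"
proof -
  obtain w where w: "w < 1" "\<And>x y. \<lbrakk>x \<in> C; y \<in> C\<rbrakk> \<Longrightarrow> \<bar>x - y\<bar> \<le> w" using diameter_less_1 by blast
  obtain W where W: "W > 0" "\<And>u v. \<bar>F u - F v\<bar> \<le> W * \<bar>u - v\<bar>" using F_Lipschitz by blast
  show thesis
  proof
    show "(1 - w) / (2 * W) > 0" using w W by simp
    fix u v assume uv: "u \<in> C" "v \<in> C" "\<bar>u - v\<bar> \<le> (1 - w) / (2 * W)"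
    have f: "f u = frac (F u)" "f v = frac (F v)" using lift[of u] lift[of v] frac_C uv by auto
    have "(f u - f v) - (F u - F v) = of_int (\<lfloor>F v\<rfloor> - \<lfloor>F u\<rfloor>)" by (simp add: f frac_def)
    then have int: "(f u - f v) - (F u - F v) \<in> \<int>" by (simp only: Ints_of_int)
    have "W * \<bar>u - v\<bar> \<le> W * ((1 - w) / (2 * W))" using uv(3) W(1) by (intro mult_left_mono) auto
    also have "\<dots> = (1 - w) / 2" using W(1) by simp
    finally have "\<bar>F u - F v\<bar> \<le> (1 - w) / 2" using W(2)[of u v] by simp
    moreover have "\<bar>f u - f v\<bar> \<le> w" using w(2) uv f_image by blast
    ultimately have "\<bar>(f u - f v) - (F u - F v)\<bar> < 1" using w(1) by argo
    then show "f u - f v = F u - F v" using Ints_nonzero_abs_less1[OF int] by simp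
  qed
qed

lemma adjacent_f:
  assumes "adjacent C u v" "f u - f v = F u - F v"
  shows "adjacent C (f u) (f v)"
proof -
  have uv: "u \<in> C" "v \<in> C" "u \<noteq> v" using assms unfolding adjacent_def by auto
  have adj: "adjacent X (F u) (F v)" using adjacent_F adjacent_X assms(1) by blast
  define p where "p = \<lfloor>F u\<rfloor>"
  have "f u = F u - of_int p" using lift[of u] frac_C[OF uv(1)] by (simp add: frac_def p_def)
  then have f: "F u = f u + of_int p" "F v = f v + of_int p" using assms(2) by (auto simp: algebra_simps)
  have "z \<notin> open_segment (f u) (f v)" if z: "z \<in> C" for z
  proof
    assume "z \<in> open_segment (f u) (f v)"
    then have "z + of_int p \<in> open_segment (F u) (F v)" by (auto simp: f in_open_segment_real)
    moreover have "z + of_int p \<in> X" using C_in_X z by simp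
    ultimately show False using adj unfolding adjacent_def by blast
  qed
  moreover have "f u \<noteq> f v" using adj f unfolding adjacent_def by auto
  ultimately show ?thesis using uv f_image unfolding adjacent_def by blast
qed

lemma distortion_f_cong:
  assumes "\<And>u v. \<lbrakk>u \<in> B; v \<in> B\<rbrakk> \<Longrightarrow> f u - f v = F u - F v"
  shows "distortion_le f B c \<longleftrightarrow> distortion_le F B c"
  using assms unfolding distortion_le_def by simp

text \<open>\<open>ln \<bar>F' y\<bar>\<close> is uniformly continuous on the unit interval. This is
  where \<open>f\<close> being C^1 makes it nearly affine on deep cylinders.\<close>

lemma distortion_f_small:
  assumes "\<eta> > 0"
  shows "\<exists>\<rho>>0. \<forall>B\<subseteq>C. spread_le B \<rho> \<longrightarrow> distortion_le f B \<eta>"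
proof -
  have "continuous_on {0..1} (\<lambda>y. ln \<bar>F' y\<bar>)"
    by (intro continuous_on_ln continuous_on_rabs continuous_on_subset[OF cont_deriv]) (auto simp: deriv_nz)
  then have "uniformly_continuous_on {0..1} (\<lambda>y. ln \<bar>F' y\<bar>)"
    by (intro compact_uniformly_continuous) auto
  then obtain d where d: "d > 0"
    "\<And>x y. \<lbrakk>x \<in> {0..1}; y \<in> {0..1}; \<bar>x - y\<bar> < d\<rbrakk> \<Longrightarrow> \<bar>ln \<bar>F' x\<bar> - ln \<bar>F' y\<bar>\<bar> < \<eta>"
    using assms unfolding uniformly_continuous_on_def dist_real_def by blast
  obtain \<rho> where \<rho>: "\<rho> > 0" "\<And>u v. \<lbrakk>u \<in> C; v \<in> C; \<bar>u - v\<bar> \<le> \<rho>\<rbrakk> \<Longrightarrow> f u - f v = F u - F v"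
    using f_diff_eq by blast
  show ?thesis
  proof (intro exI[of _ "min \<rho> (d / 2)"] conjI allI impI)
    show "min \<rho> (d / 2) > 0" using \<rho> d by simp
    fix B assume B: "B \<subseteq> C" "spread_le B (min \<rho> (d / 2))"
    have "distortion_le F B \<eta>"
    proof (rule distortion_le_of_deriv[OF _ _ _ _ B(2)])
      show "convex {0..1::real}" by (rule convex_closed_interval)
      show "(F has_real_derivative F' x) (at x within {0..1})" for x
        using deriv by (rule DERIV_subset) simp
      show "B \<subseteq> {0..1}" using B(1) unit by force
      fix x y :: real assume xy: "x \<in> {0..1}" "y \<in> {0..1}" "\<bar>x - y\<bar> \<le> min \<rho> (d / 2)"
      then have "\<bar>x - y\<bar> < d" using d(1) by auto
      then have "ln \<bar>F' x\<bar> \<le> \<eta> + ln \<bar>F' y\<bar>" using d(2)[OF xy(1,2)] by (simp add: abs_less_iff)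
      then have "exp (ln \<bar>F' x\<bar>) \<le> exp (\<eta> + ln \<bar>F' y\<bar>)" by simp
      then show "\<bar>F' x\<bar> \<le> exp \<eta> * \<bar>F' y\<bar>" using deriv_nz by (simp add: exp_add)
    qed
    moreover have "f u - f v = F u - F v" if "u \<in> B" "v \<in> B" for u v
      using \<rho>(2)[of u v] B that unfolding spread_le_def by auto
    ultimately show "distortion_le f B \<eta>" using distortion_f_cong by blast
  qed
qed

lemma monotonic_f:
  assumes "\<And>u v. \<lbrakk>u \<in> B; v \<in> B\<rbrakk> \<Longrightarrow> f u - f v = F u - F v"
  shows "monotonic B f"
proof -
  obtain s where s: "s \<in> {-1, 1}" "\<forall>u\<in>UNIV. \<forall>v\<in>UNIV. u < v \<longrightarrow> s * F u < s * F v"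
    using monotonic_F unfolding monotonic_def ..
  have "s * f u < s * f v" if "u \<in> B" "v \<in> B" "u < v" for u v
  proof -
    have "s * (F u - F v) < 0" using s(2) that(3) by (simp add: right_diff_distrib)
    then have "s * (f u - f v) < 0" using assms[OF that(1,2)] by simp
    then show ?thesis by (simp add: right_diff_distrib)
  qed
  with s(1) show ?thesis unfolding monotonic_def by blast
qed

lemma continuous_f: "continuous_on C f"
proof -
  obtain \<rho> where \<rho>: "\<rho> > 0" "\<And>u v. \<lbrakk>u \<in> C; v \<in> C; \<bar>u - v\<bar> \<le> \<rho>\<rbrakk> \<Longrightarrow> f u - f v = F u - F v"
    using f_diff_eq by blast
  obtain W where W: "W > 0" "\<And>u v. \<bar>F u - F v\<bar> \<le> W * \<bar>u - v\<bar>" using F_Lipschitz by blast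
  show ?thesis
    unfolding continuous_on_iff
  proof (intro ballI allI impI)
    fix x e :: real assume x: "x \<in> C" "e > 0"
    show "\<exists>d>0. \<forall>y\<in>C. dist y x < d \<longrightarrow> dist (f y) (f x) < e"
    proof (intro exI[of _ "min \<rho> (e / W)"] conjI ballI impI)
      show "min \<rho> (e / W) > 0" using \<rho> W x by simp
      fix y assume y: "y \<in> C" "dist y x < min \<rho> (e / W)"
      then have "f y - f x = F y - F x" using \<rho>(2) x by (simp add: dist_real_def)
      then have "\<bar>f y - f x\<bar> \<le> W * \<bar>y - x\<bar>" using W(2) by simp
      also have "\<dots> < W * (e / W)" using y W by (intro mult_strict_left_mono) (auto simp: dist_real_def)
      finally show "dist (f y) (f x) < e" using W by (simp add: dist_real_def)
    qed
  qed
qed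

section \<open>Recurrence and orbits of gaps\<close>

lemma inj_f_C: "inj_on f C"
  using inj_f unit inj_on_subset by blast

lemma inj_funpow: "inj_on (f ^^ n) C"
proof (induction n)
  case (Suc n)
  have "inj_on f ((f ^^ n) ` C)" by (rule inj_on_subset[OF inj_f_C]) (use funpow_in in auto)
  then show ?case unfolding funpow.simps by (rule comp_inj_on[OF Suc])
qed simp

text \<open>A periodic orbit is a finite closed invariant set, so by minimality it would be the
  infinite set \<open>C\<close>.\<close>

lemma not_periodic:
  assumes x: "x \<in> C" and "n > 0"
  shows "(f ^^ n) x \<noteq> x"
proof
  assume per: "(f ^^ n) x = x"
  define O' where "O' = (\<lambda>i. (f ^^ i) x) ` {..<n}"
  have sub: "O' \<subseteq> C" using funpow_in x by (auto simp: O'_def)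
  have fin: "finite O'" by (simp add: O'_def)
  have "f ` O' \<subseteq> O'"
  proof
    fix y assume "y \<in> f ` O'"
    then obtain i where i: "i < n" "y = (f ^^ Suc i) x" by (auto simp: O'_def)
    show "y \<in> O'"
    proof (cases "Suc i = n")
      case True
      then have "y = (f ^^ 0) x" using i per by simp
      then show ?thesis using \<open>n > 0\<close> unfolding O'_def by blast
    next
      case False
      then show ?thesis using i unfolding O'_def by (intro image_eqI[of _ _ "Suc i"]) auto
    qed
  qed
  moreover have "card (f ` O') = card O'" by (rule card_image[OF inj_on_subset[OF inj_f_C sub]])
  ultimately have "f ` O' = O'" using fin by (simp add: card_subset_eq)
  moreover have "circle_closed O'"
    by (rule circle_closed_compact[OF finite_imp_compact[OF fin]]) (use sub unit in auto)
  moreover have "O' \<noteq> {}" using \<open>n > 0\<close> by (auto simp: O'_def)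
  ultimately have "O' = C" using minimal sub by (simp add: minimal_set_def)
  then show False using infinite fin by simp
qed

text \<open>The \<omega>-limit set of \<open>x\<close> is nonempty, closed and invariant, so by
  minimality it is \<open>C\<close> and contains \<open>x\<close>. Injectivity of \<open>f\<close>
  on \<open>C\<close> lets the image commute with the intersection of the orbit tails'
  closures.\<close>

lemma recurrent:
  assumes x: "x \<in> C" "\<tau> > 0"
  shows "\<exists>n\<ge>N. \<bar>(f ^^ n) x - x\<bar> \<le> \<tau>"
proof -
  define T where "T N = closure ((\<lambda>n. (f ^^ n) x) ` {N..})" for N
  define \<omega> where "\<omega> = (\<Inter>N. T N)"
  have orb: "(\<lambda>n. (f ^^ n) x) ` {N..} \<subseteq> C" for N using funpow_in x by blast
  have TC: "T N \<subseteq> C" for N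
    unfolding T_def by (intro closure_minimal orb compact_imp_closed compact)
  have Tcomp: "compact (T N)" for N using TC compact by (simp add: T_def compact_closure closure_mono
        bounded_subset[OF compact_imp_bounded[OF compact] orb])
  have ne: "\<omega> \<noteq> {}"
    unfolding \<omega>_def
  proof (rule compact_nest)
    show "T n \<noteq> {}" for n by (auto simp: T_def)
    show "T n \<subseteq> T m" if "m \<le> n" for m n
      unfolding T_def using that by (intro closure_mono image_mono) auto
  qed (rule Tcomp)
  have \<omega>C: "\<omega> \<subseteq> C" using TC unfolding \<omega>_def by blast
  have \<omega>comp: "compact \<omega>" unfolding \<omega>_def by (intro compact_Inter) (use Tcomp in auto)
  have fT: "f ` T N = T (Suc N)" for N
  proof -
    let ?O = "\<lambda>N. (\<lambda>n. (f ^^ n) x) ` {N..}"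
    have orb_Suc: "?O (Suc N) = f ` (\<lambda>n. (f ^^ n) x) ` {N..}"
    proof -
      have "n \<in> Suc ` {N..}" if "n \<ge> Suc N" for n using that by (cases n) auto
      then have "{Suc N..} = Suc ` {N..}" by auto
      then show ?thesis by (simp add: image_image)
    qed
    have cont: "continuous_on (T N) f" by (rule continuous_on_subset[OF continuous_f TC])
    show ?thesis
    proof (rule equalityI)
      have "f ` ?O N \<subseteq> T (Suc N)" unfolding T_def orb_Suc[symmetric] by (rule closure_subset)
      then show "f ` T N \<subseteq> T (Suc N)"
        using cont unfolding T_def by (intro image_closure_subset) auto
      have "?O N \<subseteq> T N" unfolding T_def by (rule closure_subset)
      then have "?O (Suc N) \<subseteq> f ` T N" unfolding orb_Suc by (rule image_mono)
      moreover have "closed (f ` T N)"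
        by (intro compact_imp_closed compact_continuous_image cont Tcomp)
      ultimately show "T (Suc N) \<subseteq> f ` T N"
        unfolding T_def[of "Suc N"] by (intro closure_minimal)
    qed
  qed
  have "f ` \<omega> = \<omega>"
  proof -
    have "f ` \<omega> = (\<Inter>N. f ` T N)"
      unfolding \<omega>_def by (rule image_INT[where A = UNIV and B = T and C = C])
        (use inj_f_C TC in auto)
    also have "\<dots> = (\<Inter>N. T (Suc N))" by (simp add: fT)
    also have "\<dots> = \<omega>"
    proof -
      have "T (Suc N) \<subseteq> T N" for N unfolding T_def by (intro closure_mono image_mono) auto
      then show ?thesis unfolding \<omega>_def by blast
    qed
    finally show ?thesis .
  qed
  moreover have "circle_closed \<omega>"
    by (rule circle_closed_compact[OF \<omega>comp]) (use \<omega>C unit in auto)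
  ultimately have "\<omega> = C" using minimal ne \<omega>C by (simp add: minimal_set_def)
  then have "x \<in> T N" using x \<omega>_def by blast
  then obtain y where "y \<in> (\<lambda>n. (f ^^ n) x) ` {N..}" "dist y x < \<tau>"
    unfolding T_def using closure_approachable x(2) by blast
  then show ?thesis by (auto simp: dist_real_def intro: less_imp_le)
qed

text \<open>Modulo \<open>1\<close>, the images of a gap are pairwise disjoint, since \<open>f\<close> has no periodic points.\<close>

lemma gap_orbit_sum:
  assumes "adjacent C a b"
  shows "(\<Sum>i<n. \<bar>(F ^^ i) a - (F ^^ i) b\<bar>) \<le> 2"
proof -
  have ab: "a \<in> C" "b \<in> C" using assms unfolding adjacent_def by auto
  have adj: "adjacent X ((F ^^ i) a) ((F ^^ i) b)" for i
    by (induction i) (auto simp: adjacent_X assms adjacent_F)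
  define u where "u i = min ((F ^^ i) a) ((F ^^ i) b)" for i
  define v where "v i = max ((F ^^ i) a) ((F ^^ i) b)" for i
  have uv: "u i \<in> X" "v i \<in> X" "u i < v i" "\<And>z. \<lbrakk>z \<in> X; u i < z; z < v i\<rbrakk> \<Longrightarrow> False" for i
    using adj[of i] unfolding adjacent_def disjoint_iff in_open_segment_real u_def v_def
    by (auto simp: min_def max_def split: if_splits)
  define p where "p i = \<lfloor>u i\<rfloor>" for i
  define I where "I i = {u i - of_int (p i)<..<v i - of_int (p i)}" for i
  have len: "\<bar>(F ^^ i) a - (F ^^ i) b\<bar> = measure lborel (I i)" for i
    using uv(3)[of i] by (simp add: I_def u_def v_def min_def max_def abs_if)
  \<comment> \<open>A gap of the periodic set \<open>X\<close> has length at most 1. Translated to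
    start in the first period it ends by 2, which is the bound on the sum.\<close>
  have sub: "I i \<subseteq> {0..2}" for i
  proof -
    have "u i + of_int 1 \<in> X" using uv(1) X_shift(1) by blast
    then have "v i \<le> u i + 1" using uv(4)[of "u i + 1" i] by force
    moreover have "0 \<le> u i - of_int (p i)" "u i - of_int (p i) < 1" unfolding p_def by linarith+
    ultimately show ?thesis by (auto simp: I_def)
  qed
  have frac_orbit: "frac ((F ^^ i) a) = (f ^^ i) a" "frac ((F ^^ i) b) = (f ^^ i) b" for i
    using frac_funpow frac_C ab by simp_all
  have disj: "I i \<inter> I j = {}" if "i < j" for i j
  proof (rule ccontr)
    assume "I i \<inter> I j \<noteq> {}"
    then obtain z where z: "z \<in> I i" "z \<in> I j" by blast
    have XI: "u k - of_int (p k) \<in> X" "v k - of_int (p k) \<in> X" for k using uv X_shift by auto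
    have no: "\<not> (u k - of_int (p k) < y \<and> y < v k - of_int (p k))" if "y \<in> X" for y k
      using uv(4)[of "y + of_int (p k)" k] that by auto
    have "u i - of_int (p i) = u j - of_int (p j)" "v i - of_int (p i) = v j - of_int (p j)"
      using no[OF XI(1)[of i], of j] no[OF XI(1)[of j], of i] no[OF XI(2)[of i], of j]
        no[OF XI(2)[of j], of i] z unfolding I_def by auto
    then have eq: "frac (u i) = frac (u j)" "frac (v i) = frac (v j)"
      by (metis X_def diff_add_cancel frac_add_of_int_right)+
    obtain k where k: "j = i + k" "k > 0" using \<open>i < j\<close> less_imp_add_positive by blast
    have inj: "x = y" if "(f ^^ i) x = (f ^^ i) y" "x \<in> C" "y \<in> C" for x y
      using inj_funpow that by (auto dest: inj_onD)
    have kC: "(f ^^ k) a \<in> C" "(f ^^ k) b \<in> C" using funpow_in ab by auto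
    have j: "(f ^^ j) x = (f ^^ i) ((f ^^ k) x)" for x by (simp add: k funpow_add)
    \<comment> \<open>Overlapping gaps coincide modulo 1, but their ends may be interchanged. Then
      \<open>f ^^ k\<close> swaps \<open>a\<close> and \<open>b\<close>, and \<open>a\<close> has
      period \<open>k + k\<close>.\<close>
    consider "(f ^^ i) a = (f ^^ j) a" | "(f ^^ i) a = (f ^^ j) b" "(f ^^ i) b = (f ^^ j) a"
      using eq unfolding frac_orbit[symmetric] u_def v_def min_def max_def by (auto split: if_splits)
    then show False
    proof cases
      case 1
      then have "a = (f ^^ k) a" using inj[of a "(f ^^ k) a"] ab kC j by simp
      then show False using not_periodic[OF ab(1) k(2)] by simp
    next
      case 2
      then have "a = (f ^^ k) b" "b = (f ^^ k) a"
        using inj[of a "(f ^^ k) b"] inj[of b "(f ^^ k) a"] ab kC j by simp_all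
      then have "(f ^^ (k + k)) a = a" by (simp add: funpow_add)
      then show False using not_periodic[OF ab(1), of "k + k"] k(2) by simp
    qed
  qed
  have "disjoint_family_on I {..<n}"
    unfolding disjoint_family_on_def
  proof (intro ballI impI)
    fix i j :: nat assume "i \<noteq> j"
    then show "I i \<inter> I j = {}" using disj[of i j] disj[of j i] by (cases "i < j") auto
  qed
  moreover have "I i \<in> sets lborel" "emeasure lborel (I i) \<noteq> \<infinity>" for i
    using uv(3)[of i] by (simp_all add: I_def)
  ultimately have "(\<Sum>i<n. measure lborel (I i)) = measure lborel (\<Union>i<n. I i)"
    by (intro measure_finite_Union[symmetric]) auto
  also have "\<dots> \<le> measure lborel {0..2::real}"
  proof (rule measure_mono_fmeasurable)
    show "(\<Union>i<n. I i) \<in> sets lborel" by (auto simp: I_def)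
  qed (use sub in \<open>auto intro: fmeasurable_compact\<close>)
  finally show ?thesis by (simp add: len)
qed

text \<open>For spread below \<open>\<rho>\<close>, a finite cover by balls of half the radius makes
  the local bounds uniform. For larger spread, the bound \<open>W / m\<close> on ratios of
  \<open>F'\<close> is absorbed into \<open>Q * D\<close> by dividing its logarithm by
  \<open>\<rho>\<close>.\<close>

lemma global_Lipschitz_distortion:
  assumes local: "\<And>x. x \<in> C \<Longrightarrow> \<exists>r>0. \<exists>Q\<ge>0. \<forall>B D. B \<subseteq> C \<longrightarrow> (\<forall>y\<in>B. \<bar>y - x\<bar> < r) \<longrightarrow>
      D \<ge> 0 \<longrightarrow> spread_le B D \<longrightarrow> distortion_le f B (Q * D)"
  obtains Q where "Q \<ge> 0" "\<And>B D. \<lbrakk>B \<subseteq> X; D \<ge> 0; spread_le B D\<rbrakk> \<Longrightarrow> distortion_le F B (Q * D)"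
proof -
  define good where "good x r Q \<longleftrightarrow> r > 0 \<and> Q \<ge> 0 \<and> (\<forall>B D. B \<subseteq> C \<longrightarrow> (\<forall>y\<in>B. \<bar>y - x\<bar> < r) \<longrightarrow>
      D \<ge> 0 \<longrightarrow> spread_le B D \<longrightarrow> distortion_le f B (Q * D))" for x r Q
  have "\<exists>r Q. good x r Q" if "x \<in> C" for x using local[OF that] unfolding good_def by blast
  then have "\<exists>rQ. good x (fst rQ) (snd rQ)" if "x \<in> C" for x using that by simp
  then obtain rQ where rQ: "\<And>x. x \<in> C \<Longrightarrow> good x (fst (rQ x)) (snd (rQ x))" by metis
  define r q where "r x = fst (rQ x)" and "q x = snd (rQ x)" for x
  have rq: "r x > 0" "q x \<ge> 0" "\<And>B D. \<lbrakk>B \<subseteq> C; \<forall>y\<in>B. \<bar>y - x\<bar> < r x; D \<ge> 0; spread_le B D\<rbrakk>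
      \<Longrightarrow> distortion_le f B (q x * D)" if "x \<in> C" for x
    using rQ[OF that] unfolding good_def r_def q_def by blast+
  have "C \<subseteq> (\<Union>x\<in>C. ball x (r x / 2))" using rq(1) by force
  then obtain Z where Z: "Z \<subseteq> C" "finite Z" "C \<subseteq> (\<Union>x\<in>Z. ball x (r x / 2))"
    using compactE_image[OF compact, of C "\<lambda>x. ball x (r x / 2)"] by blast
  have Zne: "Z \<noteq> {}" using Z(3) infinite by auto
  define \<rho>1 where "\<rho>1 = Min (r ` Z) / 2"
  define q1 where "q1 = Max (q ` Z)"
  have \<rho>1: "\<rho>1 > 0" "\<And>x. x \<in> Z \<Longrightarrow> \<rho>1 \<le> r x / 2"
    using Z Zne rq(1) by (auto simp: \<rho>1_def subset_iff)
  have q1: "\<And>x. x \<in> Z \<Longrightarrow> q x \<le> q1" using Z by (simp add: q1_def)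
  have "q1 \<ge> 0" using Zne q1 rq(2) Z(1) by (meson all_not_in_conv order_trans subsetD)
  obtain \<rho>2 where \<rho>2: "\<rho>2 > 0" "\<And>u v. \<lbrakk>u \<in> C; v \<in> C; \<bar>u - v\<bar> \<le> \<rho>2\<rbrakk> \<Longrightarrow> f u - f v = F u - F v"
    using f_diff_eq by blast
  obtain w where w: "w < 1" "\<And>x y. \<lbrakk>x \<in> C; y \<in> C\<rbrakk> \<Longrightarrow> \<bar>x - y\<bar> \<le> w" using diameter_less_1 by blast
  obtain m W where mW: "m > 0" "W > 0" "\<And>y. m \<le> \<bar>F' y\<bar>" "\<And>y. \<bar>F' y\<bar> \<le> W" using deriv_bounds by blast
  define \<rho> where "\<rho> = min \<rho>1 (min \<rho>2 (1 - w))"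
  have \<rho>: "\<rho> > 0" "\<rho> \<le> \<rho>1" "\<rho> \<le> \<rho>2" "\<rho> \<le> 1 - w" using \<rho>1 \<rho>2 w by (auto simp: \<rho>_def)
  define Q where "Q = q1 + \<bar>ln (W / m)\<bar> / \<rho>"
  have Q: "q1 \<le> Q" "\<bar>ln (W / m)\<bar> / \<rho> \<le> Q" "Q \<ge> 0" using \<open>q1 \<ge> 0\<close> \<rho> by (auto simp: Q_def)
  show thesis
  proof (rule that[OF Q(3)])
    fix B D assume B: "B \<subseteq> X" "D \<ge> 0" "spread_le B D"
    show "distortion_le F B (Q * D)"
    proof (cases "D < \<rho>")
      case False
      have "distortion_le F B (ln (W / m))"
      proof (rule distortion_le_of_deriv[OF convex_UNIV _ _ _ B(3)])
        show "\<bar>F' x\<bar> \<le> exp (ln (W / m)) * \<bar>F' y\<bar>" for x y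
        proof -
          have "W * m \<le> W * \<bar>F' y\<bar>" using mW by (intro mult_left_mono) auto
          then have "W \<le> W / m * \<bar>F' y\<bar>" using mW(1) by (simp add: field_simps)
          with mW(4)[of x] have "\<bar>F' x\<bar> \<le> W / m * \<bar>F' y\<bar>" by linarith
          then show ?thesis using mW(1,2) by simp
        qed
      qed (use deriv in auto)
      moreover have "ln (W / m) \<le> Q * D"
      proof -
        have "\<bar>ln (W / m)\<bar> = \<bar>ln (W / m)\<bar> / \<rho> * \<rho>" using \<rho>(1) by simp
        also have "\<dots> \<le> Q * D" using Q \<rho>(1) False by (intro mult_mono) auto
        finally show ?thesis by linarith
      qed
      ultimately show ?thesis by (rule distortion_le_mono)
    next
      case D: True
      show ?thesis
      proof (cases "B = {}")
        case True
        then show ?thesis by (simp add: distortion_le_def)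
      next
        case False
        then obtain y where y: "y \<in> B" by blast
        define p where "p = \<lfloor>y\<rfloor>"
        have yC: "y - of_int p \<in> C" using X_floor y B(1) unfolding p_def by blast
        \<comment> \<open>One translation must bring all of \<open>B\<close> into \<open>C\<close>.
          Two points with different integer parts would be at least \<open>1 - w\<close> apart, but
          the spread is below \<open>\<rho>\<close>.\<close>
        have inC: "z - of_int p \<in> C" if z: "z \<in> B" for z
        proof -
          have zC: "z - of_int \<lfloor>z\<rfloor> \<in> C" using X_floor z B(1) by blast
          have "\<bar>(z - of_int \<lfloor>z\<rfloor>) - (y - of_int p)\<bar> \<le> w" using w(2) zC yC by blast
          moreover have "\<bar>z - y\<bar> < 1 - w" using B(3) z y D \<rho>(4) unfolding spread_le_def by force
          ultimately have "\<bar>real_of_int (\<lfloor>z\<rfloor> - p)\<bar> < 1" by (simp only: of_int_diff abs_less_iff abs_le_iff) linarith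
          then have "\<lfloor>z\<rfloor> = p" by linarith
          with zC show ?thesis by simp
        qed
        define B' where "B' = (\<lambda>z. z - of_int p) ` B"
        have B': "B' \<subseteq> C" "spread_le B' D" using inC B(3) by (auto simp: B'_def spread_le_def)
        obtain x where x: "x \<in> Z" "\<bar>(y - of_int p) - x\<bar> < r x / 2"
          using Z(3) yC by (force simp: dist_real_def abs_minus_commute)
        have "\<bar>z - x\<bar> < r x" if "z \<in> B'" for z
        proof -
          have "\<bar>z - (y - of_int p)\<bar> \<le> D" using B'(2) that y unfolding spread_le_def B'_def by blast
          then show ?thesis using x(2) D \<rho>(2) \<rho>1(2)[OF x(1)] by argo
        qed
        then have "distortion_le f B' (q x * D)" using rq(3) x(1) Z(1) B' B(2) by blast
        moreover have "f u - f v = F u - F v" if "u \<in> B'" "v \<in> B'" for u v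
          using \<rho>2(2)[of u v] that B' D \<rho>(3) unfolding spread_le_def by force
        ultimately have "distortion_le F B' (q x * D)" using distortion_f_cong by blast
        moreover have "q x * D \<le> Q * D" using q1[OF x(1)] Q(1) B(2) by (intro mult_right_mono) auto
        ultimately have dF: "distortion_le F B' (Q * D)" using distortion_le_mono by blast
        obtain d where d: "\<And>y. F (y + of_int p) = F y + of_int d" using F_shift by blast
        have shift: "F z = F (z - of_int p) + of_int d" for z using d[of "z - of_int p"] by simp
        show ?thesis
          unfolding distortion_le_def
        proof (intro ballI)
          fix u v s t assume "u \<in> B" "v \<in> B" "s \<in> B" "t \<in> B"
          then have "u - of_int p \<in> B'" "v - of_int p \<in> B'" "s - of_int p \<in> B'" "t - of_int p \<in> B'"
            by (auto simp: B'_def)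
          from distortion_leD[OF dF this]
          show "\<bar>F u - F v\<bar> * \<bar>s - t\<bar> \<le> exp (Q * D) * (\<bar>F s - F t\<bar> * \<bar>u - v\<bar>)"
            unfolding shift[of u] shift[of v] shift[of s] shift[of t] by simp
        qed
      qed
    qed
  qed
qed

text \<open>A point that an iterate of \<open>F\<close> moves by an integer projects to a periodic
  point of \<open>f\<close>.\<close>

lemma no_Lipschitz_distortion:
  assumes "adjacent C a b"
    and "\<And>x. x \<in> C \<Longrightarrow> \<exists>r>0. \<exists>Q\<ge>0. \<forall>B D. B \<subseteq> C \<longrightarrow> (\<forall>y\<in>B. \<bar>y - x\<bar> < r) \<longrightarrow>
      D \<ge> 0 \<longrightarrow> spread_le B D \<longrightarrow> distortion_le f B (Q * D)"
  shows False
proof -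
  have ab: "a \<in> C" "b \<in> C" "a \<noteq> b" using assms(1) unfolding adjacent_def by auto
  obtain Q where Q: "Q \<ge> 0" "\<And>B D. \<lbrakk>B \<subseteq> X; D \<ge> 0; spread_le B D\<rbrakk> \<Longrightarrow> distortion_le F B (Q * D)"
    using global_Lipschitz_distortion[OF assms(2)] by blast
  have "\<exists>x\<in>X. \<exists>n>0. \<exists>p. (F ^^ n) x = x + of_int p"
  proof (rule summable_gap_imp_periodic[OF closed_X _ _ inj Q _ _ ab(3) gap_orbit_sum[OF assms(1)]])
    show "\<exists>n\<ge>N. \<exists>p. \<bar>(F ^^ n) a - of_int p - a\<bar> \<le> \<tau>" if pos: "\<tau> > 0" for \<tau> N
    proof -
      obtain n where n: "n \<ge> N" "\<bar>(f ^^ n) a - a\<bar> \<le> \<tau>" using recurrent[OF ab(1) pos] by blast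
      have "(F ^^ n) a - of_int \<lfloor>(F ^^ n) a\<rfloor> = (f ^^ n) a"
        using frac_funpow[of n a] frac_C[OF ab(1)] by (simp add: frac_def)
      with n show ?thesis by metis
    qed
  qed (use F_in_X_iff C_in_X ab in auto)
  then obtain x n p where x: "x \<in> X" "n > 0" "(F ^^ n) x = x + of_int p" by blast
  then have "(f ^^ n) (frac x) = frac x" using frac_funpow[of n x] by simp
  then show False using not_periodic[of "frac x" n] x by (simp add: X_def)
qed

end

subsection \<open>Nearly affine expanding maps\<close>

text \<open>\<open>M\<close>, \<open>\<theta>\<close> and \<open>\<delta>\<close> determine an
  \<open>N\<close> beyond which the geometric terms sum to at most \<open>\<delta> / 2\<close>. The
  first \<open>N\<close> terms cost at most \<open>\<epsilon>\<close> each, and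
  \<open>\<epsilon>\<close> is chosen after \<open>N\<close>.\<close>

lemma sum_min_geometric_small:
  fixes M \<theta> \<delta> :: real
  assumes "0 \<le> M" "0 < \<theta>" "\<theta> < 1" "0 < \<delta>"
  shows "\<exists>\<epsilon>>0. \<forall>n. (\<Sum>j<n. min \<epsilon> (M * \<theta> ^ Suc j)) \<le> \<delta>"
proof -
  have "(\<lambda>n. M / (1 - \<theta>) * \<theta> ^ n) \<longlonglongrightarrow> M / (1 - \<theta>) * 0"
    using assms by (intro tendsto_mult tendsto_const LIMSEQ_realpow_zero) auto
  from order_tendstoD(2)[OF this, of "\<delta> / 2"]
  have "\<forall>\<^sub>F n in sequentially. M / (1 - \<theta>) * \<theta> ^ n < \<delta> / 2" using assms(4) by simp
  then obtain N where N: "M / (1 - \<theta>) * \<theta> ^ N < \<delta> / 2" unfolding eventually_sequentially by blast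
  define \<epsilon> where "\<epsilon> = \<delta> / (2 * (real N + 1))"
  have \<epsilon>: "\<epsilon> > 0" using assms by (simp add: \<epsilon>_def)
  have N\<epsilon>: "real N * \<epsilon> \<le> \<delta> / 2" using assms by (simp add: \<epsilon>_def field_simps)
  have tail: "(\<Sum>j<N + k. min \<epsilon> (M * \<theta> ^ Suc j)) \<le> N * \<epsilon> + M * \<theta> ^ N * ((1 - \<theta> ^ k) / (1 - \<theta>))" for k
  proof (induction k)
    case 0
    have "(\<Sum>j<N. min \<epsilon> (M * \<theta> ^ Suc j)) \<le> (\<Sum>j<N. \<epsilon>)" by (intro sum_mono) simp
    then show ?case by simp
  next
    case (Suc k)
    have "\<theta> ^ Suc (N + k) \<le> \<theta> ^ (N + k)" using assms by (intro power_decreasing) auto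
    then have "min \<epsilon> (M * \<theta> ^ Suc (N + k)) \<le> M * \<theta> ^ (N + k)"
      using assms(1) mult_left_mono by (simp add: min_le_iff_disj mult_left_mono)
    moreover have geo: "(1 - \<theta> ^ k) / (1 - \<theta>) + \<theta> ^ k = (1 - \<theta> ^ Suc k) / (1 - \<theta>)"
      using assms by (simp add: field_simps)
    have "M * \<theta> ^ N * ((1 - \<theta> ^ k) / (1 - \<theta>)) + M * \<theta> ^ (N + k) = M * \<theta> ^ N * ((1 - \<theta> ^ Suc k) / (1 - \<theta>))"
      unfolding geo[symmetric] by (simp only: power_add distrib_left mult.assoc)
    ultimately show ?case using Suc by (simp only: add_Suc_right sum.lessThan_Suc)
  qed
  have "(\<Sum>j<n. min \<epsilon> (M * \<theta> ^ Suc j)) \<le> \<delta>" for n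
  proof -
    have "(\<Sum>j<n. min \<epsilon> (M * \<theta> ^ Suc j)) \<le> (\<Sum>j<N + n. min \<epsilon> (M * \<theta> ^ Suc j))"
      using assms \<epsilon> by (intro sum_mono2) auto
    also have "\<dots> \<le> N * \<epsilon> + M * \<theta> ^ N * ((1 - \<theta> ^ n) / (1 - \<theta>))" by (rule tail)
    also have "\<dots> \<le> N * \<epsilon> + M * \<theta> ^ N * (1 / (1 - \<theta>))"
      using assms by (intro add_left_mono mult_left_mono divide_right_mono) auto
    also have "\<dots> \<le> \<delta>" using N N\<epsilon> by (simp add: mult.commute)
    finally show ?thesis .
  qed
  with \<epsilon> show ?thesis by blast
qed

section \<open>Interval systems and their length ratios\<close>

lemma interval_systemD:
  assumes "interval_system \<I> L"
  shows "compact_interval L" "L \<subseteq> {0..<1}" "finite \<I>" "card \<I> \<ge> 2"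
    "J \<in> \<I> \<Longrightarrow> compact_interval J" "disjoint \<I>" "\<Union>\<I> \<subseteq> L"
proof -
  note sys = assms[unfolded interval_system_def]
  show "finite \<I>" using sys by (intro card_ge_0_finite) linarith
qed (use assms in \<open>simp_all add: interval_system_def\<close>)

lemma compact_interval_props:
  assumes "compact_interval J"
  shows "compact J" "convex J" "J \<noteq> {}" "len J > 0" "J \<in> sets lborel" "emeasure lborel J \<noteq> \<infinity>"
  using assms unfolding compact_interval_def by auto

text \<open>The connected set \<open>L\<close> is not a union of two or more disjoint nonempty
  closed pieces, so it contains a point off the pieces, and with it an interval of positive
  length.\<close>

lemma interval_system_sum_less_1:
  assumes "interval_system \<I> L"
  shows "(\<Sum>J\<in>\<I>. len J / len L) < 1"
proof -
  note sys = interval_systemD[OF assms]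
  obtain l h where L: "l < h" "L = {l..h}" using sys(1) unfolding compact_interval_def by blast
  have piece: "compact J" "J \<noteq> {}" "J \<in> sets lborel" "emeasure lborel J \<noteq> \<infinity>" if "J \<in> \<I>" for J
    using compact_interval_props sys(5)[OF that] by auto
  have closed: "closed (\<Union>\<J>)" if "\<J> \<subseteq> \<I>" for \<J>
    using finite_subset[OF that sys(3)] compact_imp_closed[OF piece(1)[OF subsetD[OF that]]]
    by (intro closed_Union) auto
  have "\<not> L \<subseteq> \<Union>\<I>"
  proof
    assume cov: "L \<subseteq> \<Union>\<I>"
    obtain J where J: "J \<in> \<I>" using sys(4) by fastforce
    then have "card (\<I> - {J}) \<noteq> 0" using sys(3,4) by simp
    then obtain K where K: "K \<in> \<I>" "K \<noteq> J" by (metis Diff_iff card.empty ex_in_conv insertI1)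
    have "connected L" by (simp add: L(2))
    moreover have "J \<inter> \<Union>(\<I> - {J}) \<inter> L = {}" using sys(6) J by (auto simp: disjoint_def)
    moreover have "L \<subseteq> J \<union> \<Union>(\<I> - {J})" using cov by blast
    moreover have "J \<inter> L \<noteq> {}" using piece(2)[OF J] J sys(7) by blast
    moreover have "\<Union>(\<I> - {J}) \<inter> L \<noteq> {}" using piece(2)[OF K(1)] K sys(7) by blast
    moreover have "closed J" "closed (\<Union>(\<I> - {J}))" using closed[of "\<I> - {J}"] piece(1)[OF J] compact_imp_closed by auto
    ultimately show False unfolding connected_closed by blast
  qed
  then obtain y where y: "y \<in> L" "y \<notin> \<Union>\<I>" by blast
  have "open (- \<Union>\<I>)" using closed[of \<I>] by (simp add: closed_def)
  then obtain e where "e > 0" "\<forall>z. dist z y < e \<longrightarrow> z \<in> - \<Union>\<I>"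
    using y(2) unfolding open_dist by (metis ComplI)
  then have e: "e > 0" "\<And>z. \<bar>z - y\<bar> < e \<Longrightarrow> z \<notin> \<Union>\<I>" by (simp_all add: dist_real_def)
  define T where "T = {max l (y - e / 2)..min h (y + e / 2)}"
  have yL: "l \<le> y" "y \<le> h" using y(1) L by auto
  have T: "T \<subseteq> L" "T \<inter> \<Union>\<I> = {}"
  proof -
    show "T \<subseteq> L" using L by (auto simp: T_def)
    have "z \<notin> \<Union>\<I>" if "z \<in> T" for z using that e(1) unfolding T_def by (intro e(2)) (auto simp: abs_less_iff)
    then show "T \<inter> \<Union>\<I> = {}" by blast
  qed
  have lenT: "len T > 0" using yL L(1) e(1) unfolding T_def by (simp add: min_def max_def)
  have TU: "T \<in> fmeasurable lborel" "\<Union>\<I> \<in> fmeasurable lborel"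
    using fmeasurable_compact compact_Union[OF sys(3)] piece(1) by (auto simp: T_def)
  have "(\<Sum>J\<in>\<I>. len J) = len (\<Union>\<I>)"
  proof -
    have "len (\<Union>J\<in>\<I>. J) = (\<Sum>J\<in>\<I>. len J)"
      by (rule measure_finite_Union[OF sys(3)])
        (use piece sys(6) in \<open>auto simp: disjoint_family_on_def disjoint_def\<close>)
    then show ?thesis by simp
  qed
  also have "\<dots> < len T + len (\<Union>\<I>)" using lenT by simp
  also have "\<dots> = len (T \<union> \<Union>\<I>)"
    using TU by (intro measure_Union[symmetric] T(2)) (auto simp: fmeasurable_def less_top[symmetric])
  also have "\<dots> \<le> len L"
  proof (rule measure_mono_fmeasurable)
    show "T \<union> \<Union>\<I> \<in> sets lborel" using fmeasurableD[OF TU(1)] fmeasurableD[OF TU(2)] by (rule sets.Un)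
    show "L \<in> fmeasurable lborel" unfolding L(2) by (rule fmeasurable_compact) simp
  qed (use T(1) sys(7) in blast)
  finally have "(\<Sum>J\<in>\<I>. len J) < len L" .
  moreover have "len L > 0" using L by simp
  ultimately show ?thesis by (simp add: sum_divide_distrib[symmetric])
qed

text \<open>The multiplicities of the ratios are not determined by the set \<open>R\<close>, but they are bounded, so
  that the total length takes finitely many values.\<close>

lemma ratio_bounds:
  assumes "interval_system \<I>0 L0" "{len J / len L0 | J. J \<in> \<I>0} = R"
  shows "\<exists>(r::real) (s::real). 0 < r \<and> 0 < s \<and> s < 1 \<and>
    (\<forall>\<I> L. interval_system \<I> L \<and> {len J / len L | J. J \<in> \<I>} = R \<longrightarrow>
       (\<forall>J\<in>\<I>. r \<le> len J / len L) \<and> (\<Sum>J\<in>\<I>. len J / len L) \<le> s \<and> real (card \<I>) * r \<le> 1)"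
proof -
  define sys where "sys \<I> L \<longleftrightarrow> interval_system \<I> L \<and> {len J / len L | J. J \<in> \<I>} = R" for \<I> L
  have R_image: "R = (\<lambda>J. len J / len L) ` \<I>" if "sys \<I> L" for \<I> L
    using that unfolding sys_def by auto
  have pos: "len J / len L > 0" if "sys \<I> L" "J \<in> \<I>" for \<I> L J
    using that interval_systemD(1,5) compact_interval_props(4) unfolding sys_def by (meson divide_pos_pos)
  have sys0: "sys \<I>0 L0" using assms by (simp add: sys_def)
  have R: "finite R" "R \<noteq> {}" "\<And>x. x \<in> R \<Longrightarrow> x > 0"
    using R_image[OF sys0] pos[OF sys0] interval_systemD(3,4)[OF assms(1)] by auto
  define r where "r = Min R"
  have r: "r > 0" "\<And>x. x \<in> R \<Longrightarrow> r \<le> x" using R by (auto simp: r_def)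
  have card: "card \<I> * r \<le> (\<Sum>J\<in>\<I>. len J / len L)" if "sys \<I> L" for \<I> L
    using sum_bounded_below[of \<I> r "\<lambda>J. len J / len L"] r(2) R_image[OF that] by auto
  have less: "(\<Sum>J\<in>\<I>. len J / len L) < 1" if "sys \<I> L" for \<I> L
    using that interval_system_sum_less_1 unfolding sys_def by blast
  \<comment> \<open>Each interval has ratio at least \<open>r\<close> and the ratios sum to less
    than 1, so \<open>N\<close> bounds every multiplicity. The maximum of the finite set
    \<open>\<Sigma>\<close> is then a uniform bound below 1.\<close>
  define N where "N = nat \<lfloor>1 / r\<rfloor>"
  define \<Sigma> where "\<Sigma> = {\<Sum>J\<in>\<I>. len J / len L | \<I> L. sys \<I> L}"
  have "\<Sigma> \<subseteq> (\<lambda>m. \<Sum>x\<in>R. real (m x) * x) ` (R \<rightarrow>\<^sub>E {..N})"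
  proof
    fix x assume "x \<in> \<Sigma>"
    then obtain \<I> L where IL: "sys \<I> L" "x = (\<Sum>J\<in>\<I>. len J / len L)" unfolding \<Sigma>_def by blast
    let ?g = "\<lambda>J. len J / len L"
    have fin: "finite \<I>" using IL(1) interval_systemD(3) unfolding sys_def by blast
    define m where "m = restrict (\<lambda>y. card {J \<in> \<I>. ?g J = y}) R"
    have "x = (\<Sum>y\<in>?g ` \<I>. \<Sum>J\<in>{J \<in> \<I>. ?g J = y}. ?g J)" unfolding IL(2) by (rule sum.image_gen[OF fin])
    also have "\<dots> = (\<Sum>y\<in>R. real (m y) * y)"
      using R_image[OF IL(1)] by (intro sum.cong) (auto simp: m_def)
    finally have "x = (\<Sum>y\<in>R. real (m y) * y)" .
    moreover have "m \<in> R \<rightarrow>\<^sub>E {..N}"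
    proof -
      have "card \<I> * r \<le> 1" using card[OF IL(1)] less[OF IL(1)] by simp
      then have "real (card \<I>) \<le> 1 / r" using r(1) by (simp add: field_simps)
      then have "card \<I> \<le> N" unfolding N_def by (simp add: le_nat_floor)
      moreover have "card {J \<in> \<I>. ?g J = y} \<le> card \<I>" for y by (intro card_mono fin) auto
      ultimately show ?thesis unfolding m_def by (auto intro: order_trans)
    qed
    ultimately show "x \<in> (\<lambda>m. \<Sum>x\<in>R. real (m x) * x) ` (R \<rightarrow>\<^sub>E {..N})" by blast
  qed
  then have fin\<Sigma>: "finite \<Sigma>" using R(1) finite_PiE finite_subset by (metis (no_types, lifting) finite_atMost finite_imageI)
  have in\<Sigma>: "(\<Sum>J\<in>\<I>. len J / len L) \<in> \<Sigma>" if "sys \<I> L" for \<I> L using that unfolding \<Sigma>_def by blast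
  have "\<Sigma> \<noteq> {}" using in\<Sigma>[OF sys0] by blast
  then have "Max \<Sigma> \<in> \<Sigma>" using fin\<Sigma> by simp
  then have "Max \<Sigma> < 1" using less unfolding \<Sigma>_def by auto
  moreover have le: "(\<Sum>J\<in>\<I>. len J / len L) \<le> Max \<Sigma>" if "sys \<I> L" for \<I> L
    using in\<Sigma>[OF that] fin\<Sigma> by simp
  moreover have "Max \<Sigma> > 0"
  proof -
    have "0 < card \<I>0 * r" using interval_systemD(4)[OF assms(1)] r(1) by simp
    with card[OF sys0] le[OF sys0] show ?thesis by linarith
  qed
  moreover have "r \<le> len J / len L" if "sys \<I> L" "J \<in> \<I>" for \<I> L J
    using r(2) R_image[OF that(1)] that(2) by blast
  moreover have "card \<I> * r \<le> 1" if "sys \<I> L" for \<I> L using card[OF that] less[OF that] by simp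
  ultimately show ?thesis
    using r(1) unfolding sys_def by (intro exI[of _ r] exI[of _ "Max \<Sigma>"]) blast
qed

section \<open>From an expanding map to the Cantor set with its distortion bounds\<close>

declare nth_deriv.simps(2) [simp del]

lemma expanding_map_derivs:
  assumes "S \<in> expanding_maps 2 \<I> L" and x: "x \<in> \<Union>\<I>"
  shows "(S has_real_derivative nth_deriv (\<Union>\<I>) 1 S x) (at x within \<Union>\<I>)"
    "(nth_deriv (\<Union>\<I>) 1 S has_real_derivative nth_deriv (\<Union>\<I>) 2 S x) (at x within \<Union>\<I>)"
proof -
  have diff: "nth_deriv (\<Union>\<I>) n S differentiable_on \<Union>\<I>" if "n < 2" for n
    using assms that unfolding expanding_maps_def C_on_def by blast
  have step: "(nth_deriv (\<Union>\<I>) n S has_real_derivative nth_deriv (\<Union>\<I>) (Suc n) S x) (at x within \<Union>\<I>)"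
    if "n < 2" for n
  proof -
    have "nth_deriv (\<Union>\<I>) n S differentiable (at x within \<Union>\<I>)"
      using diff[OF that] x unfolding differentiable_on_def by blast
    then show ?thesis
      by (simp add: vector_derivative_works has_real_derivative_iff_has_vector_derivative nth_deriv.simps(2))
  qed
  show "(S has_real_derivative nth_deriv (\<Union>\<I>) 1 S x) (at x within \<Union>\<I>)"
    using step[of 0] by simp
  show "(nth_deriv (\<Union>\<I>) 1 S has_real_derivative nth_deriv (\<Union>\<I>) 2 S x) (at x within \<Union>\<I>)"
    using step[of 1] by (simp add: numeral_2_eq_2)
qed

lemma abs_deriv_ratio_le_nonlinearity:
  assumes sys: "interval_system \<I> L" and S: "S \<in> expanding_maps 2 \<I> L"
    and non: "nonlinearity \<I> S < \<epsilon>" and J: "J \<in> \<I>" "x \<in> J" "y \<in> J"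
  shows "\<bar>nth_deriv (\<Union>\<I>) 1 S x\<bar> \<le> exp \<epsilon> * \<bar>nth_deriv (\<Union>\<I>) 1 S y\<bar>"
proof -
  let ?I = "\<Union>\<I>" and ?S' = "nth_deriv (\<Union>\<I>) 1 S"
  have cont: "continuous_on ?I ?S'"
    by (rule DERIV_continuous_on, rule expanding_map_derivs(2)[OF S])
  have gt1: "\<bar>?S' z\<bar> > 1" if "z \<in> ?I" for z using S that unfolding expanding_maps_def by blast
  have JI: "J \<subseteq> ?I" using J by blast
  have Jprops: "compact J" "convex J" using compact_interval_props[OF interval_systemD(5)[OF sys J(1)]] by auto
  have "bounded (?S' ` J)"
    by (intro compact_imp_bounded compact_continuous_image continuous_on_subset[OF cont JI] Jprops)
  then obtain B where B: "\<And>z. z \<in> J \<Longrightarrow> \<bar>?S' z\<bar> \<le> B" unfolding bounded_iff by auto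
  have sign: "(\<forall>z\<in>J. ?S' z > 0) \<or> (\<forall>z\<in>J. ?S' z < 0)"
    by (rule constant_sign_of_nonzero[OF Jprops(2) continuous_on_subset[OF cont JI]]) (use gt1 JI in force)
  have pos: "?S' u / ?S' v > 0" if "u \<in> J" "v \<in> J" for u v
    using sign that by (auto simp: divide_neg_neg)
  let ?X = "\<lambda>J. {ln (?S' x / ?S' y) | x y. x \<in> J \<and> y \<in> J}"
  \<comment> \<open>A real supremum bounds its members only if the set is bounded above. Here
    \<open>ln t \<le> t - 1\<close> and \<open>\<bar>S'\<bar> > 1\<close> reduce this to boundedness
    of \<open>S'\<close>.\<close>
  have "bdd_above (?X J)"
  proof (rule bdd_aboveI[of _ B], clarify)
    fix u v assume uv: "u \<in> J" "v \<in> J"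
    have "ln (?S' u / ?S' v) \<le> ?S' u / ?S' v - 1" using pos[OF uv] by (rule ln_le_minus_one)
    also have "\<dots> \<le> \<bar>?S' u\<bar> / \<bar>?S' v\<bar>" using abs_ge_self[of "?S' u / ?S' v"] by (simp only: abs_divide)
    also have "\<dots> \<le> \<bar>?S' u\<bar> / 1"
    proof -
      have "1 < \<bar>?S' v\<bar>" using gt1[of v] JI uv by blast
      then show ?thesis by (intro divide_left_mono) auto
    qed
    finally show "ln (?S' u / ?S' v) \<le> B" using B[OF uv(1)] by simp
  qed
  then have "ln (?S' x / ?S' y) \<le> Sup (?X J)" using J by (intro cSup_upper) auto
  also have "\<dots> \<le> nonlinearity \<I> S"
    unfolding nonlinearity_def using J(1) interval_systemD(3)[OF sys] by (intro Max_ge) auto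
  finally have "ln (?S' x / ?S' y) < \<epsilon>" using non by simp
  then have "exp (ln (?S' x / ?S' y)) < exp \<epsilon>" by simp
  then have "?S' x / ?S' y < exp \<epsilon>" by (simp only: exp_ln[OF pos[OF J(2,3)]])
  moreover have "?S' x / ?S' y = \<bar>?S' x\<bar> / \<bar>?S' y\<bar>" using pos[OF J(2,3)] by (simp flip: abs_divide)
  moreover have "\<bar>?S' y\<bar> > 0" using gt1[of y] J by fastforce
  ultimately show ?thesis by (simp add: pos_divide_less_eq less_imp_le)
qed

text \<open>Expansion turns the additive bound from the mean value theorem into a multiplicative
  one, as \<open>M * \<bar>x - y\<bar>\<close> is at most its product with
  \<open>\<bar>S' y\<bar>\<close>.\<close>

lemma abs_deriv_ratio_le_second_deriv:
  assumes sys: "interval_system \<I> L" and S: "S \<in> expanding_maps 2 \<I> L"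
    and M: "\<And>x. x \<in> \<Union>\<I> \<Longrightarrow> \<bar>nth_deriv (\<Union>\<I>) 2 S x\<bar> < M" and J: "J \<in> \<I>" "x \<in> J" "y \<in> J"
  shows "\<bar>nth_deriv (\<Union>\<I>) 1 S x\<bar> \<le> exp (M * \<bar>x - y\<bar>) * \<bar>nth_deriv (\<Union>\<I>) 1 S y\<bar>"
proof -
  let ?S' = "nth_deriv (\<Union>\<I>) 1 S" and ?S'' = "nth_deriv (\<Union>\<I>) 2 S"
  have JI: "J \<subseteq> \<Union>\<I>" using J by blast
  have conv: "convex J" using compact_interval_props(2)[OF interval_systemD(5)[OF sys J(1)]] .
  have d: "(?S' has_real_derivative ?S'' z) (at z within J)" if "z \<in> J" for z
    by (rule DERIV_subset[OF expanding_map_derivs(2)[OF S] JI]) (use that JI in blast)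
  obtain \<xi> where \<xi>: "\<xi> \<in> J" "\<bar>?S' x - ?S' y\<bar> = \<bar>?S'' \<xi>\<bar> * \<bar>x - y\<bar>"
    using mean_value_convex_abs[OF conv d J(2,3)] by blast
  have "\<bar>?S'' \<xi>\<bar> * \<bar>x - y\<bar> \<le> M * \<bar>x - y\<bar>"
    using M[OF subsetD[OF JI \<xi>(1)]] by (intro mult_right_mono) auto
  then have diff: "\<bar>?S' x\<bar> \<le> \<bar>?S' y\<bar> + M * \<bar>x - y\<bar>" using \<xi>(2) by linarith
  have "\<bar>?S' y\<bar> > 1" using S J unfolding expanding_maps_def by blast
  moreover have "0 \<le> M" using M[OF subsetD[OF JI J(3)]] by linarith
  ultimately have "M * \<bar>x - y\<bar> * 1 \<le> M * \<bar>x - y\<bar> * \<bar>?S' y\<bar>" by (intro mult_left_mono) auto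
  with diff have "\<bar>?S' x\<bar> \<le> (1 + M * \<bar>x - y\<bar>) * \<bar>?S' y\<bar>" by (simp add: algebra_simps)
  also have "\<dots> \<le> exp (M * \<bar>x - y\<bar>) * \<bar>?S' y\<bar>" by (intro mult_right_mono exp_ge_add_one_self) auto
  finally show ?thesis .
qed

lemma max_invariant_iff: "x \<in> max_invariant \<I> S \<longleftrightarrow> (\<forall>n. (S ^^ n) x \<in> \<Union>\<I>)"
proof
  assume x: "x \<in> max_invariant \<I> S"
  show "\<forall>n. (S ^^ n) x \<in> \<Union>\<I>"
  proof
    fix n show "(S ^^ n) x \<in> \<Union>\<I>" using x unfolding max_invariant_def by (cases "n = 0") auto
  qed
next
  assume x: "\<forall>n. (S ^^ n) x \<in> \<Union>\<I>"
  then have "(S ^^ 0) x \<in> \<Union>\<I>" by blast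
  with x show "x \<in> max_invariant \<I> S" unfolding max_invariant_def by simp
qed

text \<open>\<open>S\<close> is continuous on the intervals only, so the sets of points that stay
  there for \<open>n\<close> further steps are built up as preimages within the intervals.\<close>

lemma compact_max_invariant:
  assumes "compact (\<Union>\<I>)" "continuous_on (\<Union>\<I>) S"
  shows "compact (max_invariant \<I> S)"
proof -
  let ?I = "\<Union>\<I>"
  define A where "A n = {x. \<forall>i\<le>n. (S ^^ i) x \<in> ?I}" for n
  have A_Suc: "A (Suc n) = ?I \<inter> S -` A n" for n
  proof -
    have "x \<in> A (Suc n) \<longleftrightarrow> x \<in> ?I \<and> S x \<in> A n" for x
    proof -
      have "x \<in> A (Suc n) \<longleftrightarrow> (S ^^ 0) x \<in> ?I \<and> (\<forall>i\<le>n. (S ^^ Suc i) x \<in> ?I)"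
      proof
        assume "(S ^^ 0) x \<in> ?I \<and> (\<forall>i\<le>n. (S ^^ Suc i) x \<in> ?I)"
        then have "(S ^^ i) x \<in> ?I" if "i \<le> Suc n" for i using that by (cases i) auto
        then show "x \<in> A (Suc n)" by (simp add: A_def)
      next
        assume "x \<in> A (Suc n)"
        then have "(S ^^ i) x \<in> ?I" if "i \<le> Suc n" for i using that unfolding A_def by blast
        then show "(S ^^ 0) x \<in> ?I \<and> (\<forall>i\<le>n. (S ^^ Suc i) x \<in> ?I)" by (meson Suc_le_mono le0)
      qed
      then show ?thesis unfolding A_def by (simp add: funpow_swap1)
    qed
    then show ?thesis by blast
  qed
  have "closed (A n)" for n
  proof (induction n)
    case 0
    have "A 0 = ?I" by (auto simp: A_def)
    then show ?case using compact_imp_closed[OF assms(1)] by simp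
  next
    case (Suc n)
    then show ?case
      unfolding A_Suc using continuous_closed_preimage[OF assms(2) compact_imp_closed[OF assms(1)]] by blast
  qed
  moreover have "max_invariant \<I> S = ?I \<inter> (\<Inter>n. A n)"
  proof (intro equalityI subsetI)
    fix x assume "x \<in> max_invariant \<I> S"
    then have x: "(S ^^ i) x \<in> ?I" for i by (simp add: max_invariant_iff)
    then show "x \<in> ?I \<inter> (\<Inter>n. A n)" using x[of 0] unfolding A_def by simp
  next
    fix x assume "x \<in> ?I \<inter> (\<Inter>n. A n)"
    then have "x \<in> A n" for n by blast
    then have "(S ^^ n) x \<in> ?I" for n unfolding A_def by blast
    then show "x \<in> max_invariant \<I> S" by (simp add: max_invariant_iff)
  qed
  ultimately show ?thesis using assms(1) by (simp add: compact_Int_closed closed_INT)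
qed

lemma expanding_map_cookie_cutter:
  fixes \<epsilon> :: real
  assumes sys: "interval_system \<I> L" and S: "S \<in> expanding_maps 2 \<I> L"
    and M: "M \<ge> 0" "\<And>x. x \<in> \<Union>\<I> \<Longrightarrow> \<bar>nth_deriv (\<Union>\<I>) 2 S x\<bar> < M"
    and non: "nonlinearity \<I> S < \<epsilon>"
    and ne: "max_invariant \<I> S \<noteq> {}"
    and \<theta>: "exp \<epsilon> * (\<Sum>J\<in>\<I>. len J / len L) \<le> \<theta>" "0 < \<theta>" "\<theta> < 1"
    and \<kappa>: "\<And>J. J \<in> \<I> \<Longrightarrow> \<kappa> * exp \<epsilon> \<le> len J / len L" "0 < \<kappa>"
    and \<delta>: "\<And>n. (\<Sum>j<n. min \<epsilon> (M * \<theta> ^ Suc j)) \<le> \<delta>" "exp \<delta> \<le> 2"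
  shows "cookie_cutter \<I> S (max_invariant \<I> S) (\<lambda>J. exp \<epsilon> * (len J / len L)) \<theta> \<kappa> \<epsilon> M \<delta>"
proof -
  let ?I = "\<Union>\<I>" and ?C = "max_invariant \<I> S"
  let ?S' = "nth_deriv (\<Union>\<I>) 1 S"
  note sysD = interval_systemD[OF sys]
  have props: "compact J" "convex J" "J \<noteq> {}" "len J > 0" if "J \<in> \<I>" for J
    using compact_interval_props sysD(5)[OF that] by auto
  have lenL: "len L > 0" using compact_interval_props(4)[OF sysD(1)] .
  have onto: "S ` J = L" if "J \<in> \<I>" for J using S that by (simp add: expanding_maps_def)
  have gt1: "\<bar>?S' x\<bar> > 1" if "x \<in> ?I" for x using S that unfolding expanding_maps_def by blast
  have contS: "continuous_on ?I S" by (rule DERIV_continuous_on, rule expanding_map_derivs(1)[OF S])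
  have contS': "continuous_on ?I ?S'" by (rule DERIV_continuous_on, rule expanding_map_derivs(2)[OF S])
  have d: "(S has_real_derivative ?S' x) (at x within J)" if "J \<in> \<I>" "x \<in> J" for J x
    by (rule DERIV_subset[OF expanding_map_derivs(1)[OF S]]) (use that in auto)
  have mv: "\<exists>\<xi>\<in>J. \<bar>S u - S v\<bar> = \<bar>?S' \<xi>\<bar> * \<bar>u - v\<bar>" if "J \<in> \<I>" "u \<in> J" "v \<in> J" for J u v
    using mean_value_convex_abs[OF props(2)[OF that(1)] d[OF that(1)] that(2,3)] by blast
  have ratio: "\<bar>?S' x\<bar> \<le> exp \<epsilon> * \<bar>?S' y\<bar>" if "J \<in> \<I>" "x \<in> J" "y \<in> J" for J x y
    using abs_deriv_ratio_le_nonlinearity[OF sys S non that] .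
  obtain l h where L: "l \<le> h" "L = {l..h}" using sysD(1) unfolding compact_interval_def by auto
  have lenL_eq: "len L = h - l" using L by simp
  \<comment> \<open>By the mean value theorem some slope on \<open>J\<close> is at least, and some
    at most, \<open>len L / len J\<close>. Small nonlinearity gives this for every slope up to the
    factor \<open>exp \<epsilon>\<close>.\<close>
  have slope: "len L \<le> exp \<epsilon> * len J * \<bar>?S' x\<bar>" "\<bar>?S' x\<bar> * len J \<le> exp \<epsilon> * len L" if J: "J \<in> \<I>" "x \<in> J" for J x
  proof -
    obtain p q where pq: "p \<le> q" "J = {p..q}" using sysD(5)[OF J(1)] unfolding compact_interval_def by auto
    have lenJ: "len J = q - p" using pq by simp
    have "l \<in> S ` J" "h \<in> S ` J" using onto[OF J(1)] L by auto
    then obtain u v where uv: "u \<in> J" "v \<in> J" "S u = l" "S v = h" by blast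
    obtain \<xi> where \<xi>: "\<xi> \<in> J" "\<bar>S u - S v\<bar> = \<bar>?S' \<xi>\<bar> * \<bar>u - v\<bar>" using mv[OF J(1) uv(1,2)] by blast
    have "\<bar>u - v\<bar> \<le> len J" using uv(1,2) pq lenJ by (auto simp: abs_le_iff)
    then have "len L \<le> \<bar>?S' \<xi>\<bar> * len J"
      using \<xi>(2) uv L lenL_eq mult_left_mono[of "\<bar>u - v\<bar>" "len J" "\<bar>?S' \<xi>\<bar>"] by simp
    also have "\<dots> \<le> (exp \<epsilon> * \<bar>?S' x\<bar>) * len J" using ratio[OF J(1) \<xi>(1) J(2)] by (rule mult_right_mono) simp
    finally show "len L \<le> exp \<epsilon> * len J * \<bar>?S' x\<bar>" by (simp add: mult_ac)
    have "p \<in> J" "q \<in> J" using pq by auto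
    then obtain \<zeta> where \<zeta>: "\<zeta> \<in> J" "\<bar>S p - S q\<bar> = \<bar>?S' \<zeta>\<bar> * \<bar>p - q\<bar>" using mv[OF J(1)] by blast
    have "S p \<in> L" "S q \<in> L" using onto[OF J(1)] \<open>p \<in> J\<close> \<open>q \<in> J\<close> by auto
    then have "\<bar>S p - S q\<bar> \<le> len L" using L lenL_eq by (auto simp: abs_le_iff)
    then have le: "\<bar>?S' \<zeta>\<bar> * len J \<le> len L" using \<zeta>(2) lenJ pq by simp
    have "\<bar>?S' x\<bar> * len J \<le> (exp \<epsilon> * \<bar>?S' \<zeta>\<bar>) * len J" using ratio[OF J \<zeta>(1)] by (rule mult_right_mono) simp
    also have "\<dots> \<le> exp \<epsilon> * len L" using le by (simp add: mult.assoc)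
    finally show "\<bar>?S' x\<bar> * len J \<le> exp \<epsilon> * len L" .
  qed
  have C_sub: "?C \<subseteq> ?I" by (auto simp: max_invariant_def)
  show ?thesis
  proof
    show "finite \<I>" "disjoint \<I>" using sysD by auto
    show "convex J" "compact J" if "J \<in> \<I>" for J using props that by auto
    show "\<exists>J\<in>\<I>. \<exists>K\<in>\<I>. J \<noteq> K"
    proof (rule ccontr)
      assume "\<not> ?thesis"
      then have "\<forall>J\<in>\<I>. \<forall>K\<in>\<I>. J = K" by blast
      then have "card \<I> \<le> Suc 0" by (simp only: card_le_Suc0_iff_eq[OF sysD(3)])
      then show False using sysD(4) by simp
    qed
    have "compact ?I" using compact_Union[OF sysD(3)] props by blast
    then show "compact ?C" using contS by (rule compact_max_invariant)
    show "?C \<noteq> {}" "?C \<subseteq> ?I" by (rule ne, rule C_sub)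
    have "?C \<subseteq> {0..<1}" by (rule order_trans[OF C_sub order_trans[OF sysD(7,2)]])
    also have "\<dots> \<subseteq> {0..1::real}" by auto
    finally show "?C \<subseteq> {0..1}" .
    show "S ` (?C \<inter> J) = ?C" if J: "J \<in> \<I>" for J
    proof (intro equalityI subsetI)
      fix y assume "y \<in> S ` (?C \<inter> J)"
      then obtain x where x: "x \<in> ?C" "y = S x" by blast
      have "(S ^^ n) y \<in> ?I" for n
      proof -
        have "(S ^^ Suc n) x \<in> ?I" using x(1) unfolding max_invariant_iff by blast
        then show ?thesis using x(2) by (simp add: funpow_swap1)
      qed
      then show "y \<in> ?C" unfolding max_invariant_iff by blast
    next
      fix y assume y: "y \<in> ?C"
      then have "y \<in> S ` J" using C_sub sysD(7) onto[OF J] by blast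
      then obtain x where x: "x \<in> J" "S x = y" by blast
      have "(S ^^ n) x \<in> ?I" for n
      proof (cases n)
        case 0
        then show ?thesis using x J by auto
      next
        case (Suc m)
        then have "(S ^^ n) x = (S ^^ m) y" using x(2) by (simp add: funpow_swap1)
        then show ?thesis using y by (simp add: max_invariant_iff)
      qed
      then have "x \<in> ?C" unfolding max_invariant_iff by blast
      then show "y \<in> S ` (?C \<inter> J)" using x by blast
    qed
    show "monotonic (?C \<inter> J) S" if J: "J \<in> \<I>" for J
    proof (rule monotonic_subset)
      show "monotonic J S"
      proof (rule monotonic_of_deriv[OF props(2)[OF J] d[OF J]])
        show "continuous_on J ?S'" by (rule continuous_on_subset[OF contS']) (use J in blast)
        show "?S' x \<noteq> 0" if "x \<in> J" for x using gt1[of x] that J by force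
      qed
    qed blast
    show "\<bar>u - v\<bar> \<le> exp \<epsilon> * (len J / len L) * \<bar>S u - S v\<bar>" if J: "J \<in> \<I>" and uv: "u \<in> ?C \<inter> J" "v \<in> ?C \<inter> J" for J u v
    proof -
      obtain \<xi> where \<xi>: "\<xi> \<in> J" "\<bar>S u - S v\<bar> = \<bar>?S' \<xi>\<bar> * \<bar>u - v\<bar>" using mv[OF J] uv by blast
      have "len L * \<bar>u - v\<bar> \<le> (exp \<epsilon> * len J * \<bar>?S' \<xi>\<bar>) * \<bar>u - v\<bar>"
        using slope(1)[OF J \<xi>(1)] by (rule mult_right_mono) simp
      then show ?thesis unfolding \<xi>(2) using lenL by (simp add: field_simps)
    qed
    show "0 \<le> exp \<epsilon> * (len J / len L)" for J by simp
    show "(\<Sum>J\<in>\<I>. exp \<epsilon> * (len J / len L)) \<le> \<theta>" using \<theta>(1) by (simp add: sum_distrib_left)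
    show "\<kappa> * \<bar>S u - S v\<bar> \<le> \<bar>u - v\<bar>" if J: "J \<in> \<I>" and uv: "u \<in> ?C \<inter> J" "v \<in> ?C \<inter> J" for J u v
    proof -
      obtain \<xi> where \<xi>: "\<xi> \<in> J" "\<bar>S u - S v\<bar> = \<bar>?S' \<xi>\<bar> * \<bar>u - v\<bar>" using mv[OF J] uv by blast
      have "\<kappa> * exp \<epsilon> * len L \<le> len J" using \<kappa>(1)[OF J] lenL by (simp add: pos_le_divide_eq)
      then have "\<kappa> * (exp \<epsilon> * len L) * 1 \<le> len J" by simp
      then have "\<kappa> * (\<bar>?S' \<xi>\<bar> * len J) \<le> len J"
        using mult_left_mono[OF slope(2)[OF J \<xi>(1)], of \<kappa>] \<kappa>(2) by linarith
      then have "(\<kappa> * \<bar>?S' \<xi>\<bar>) * len J \<le> 1 * len J" by (simp only: mult.assoc mult_1)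
      then have "\<kappa> * \<bar>?S' \<xi>\<bar> \<le> 1" using props(4)[OF J] by (simp only: mult_le_cancel_right_pos)
      then have "(\<kappa> * \<bar>?S' \<xi>\<bar>) * \<bar>u - v\<bar> \<le> 1 * \<bar>u - v\<bar>" by (rule mult_right_mono) simp
      then show ?thesis unfolding \<xi>(2) by (simp only: mult.assoc mult_1)
    qed
    show "distortion_le S B (min \<epsilon> (M * D))" if J: "J \<in> \<I>" and B: "B \<subseteq> ?C \<inter> J" "spread_le B D" for J B D
    proof (rule distortion_le_of_deriv[OF props(2)[OF J] d[OF J] _ _ B(2)])
      fix x y assume xy: "x \<in> J" "y \<in> J" "\<bar>x - y\<bar> \<le> D"
      have "\<bar>?S' x\<bar> \<le> exp (M * \<bar>x - y\<bar>) * \<bar>?S' y\<bar>"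
        using abs_deriv_ratio_le_second_deriv[OF sys S M(2) J xy(1,2)] .
      also have "\<dots> \<le> exp (M * D) * \<bar>?S' y\<bar>" using xy(3) M(1) by (simp add: mult_left_mono mult_right_mono)
      finally show "\<bar>?S' x\<bar> \<le> exp (min \<epsilon> (M * D)) * \<bar>?S' y\<bar>"
        using ratio[OF J xy(1,2)] by (simp add: min_def)
    qed (use B(1) in auto)
  qed (use \<theta> \<kappa>(2) M(1) \<delta> in simp_all)
qed

theorem theorem2:
  fixes M :: real and R :: "real set"
  assumes "M > 0"
  shows "\<exists>\<epsilon>>0. \<forall>\<I> L. interval_system \<I> L \<and> {len J / len L | J. J \<in> \<I>} = R \<longrightarrow>
           (\<forall>S \<in> expanding_maps 2 \<I> L.
              (\<forall>x\<in>\<Union>\<I>. \<bar>nth_deriv (\<Union>\<I>) 2 S x\<bar> < M) \<and> nonlinearity \<I> S < \<epsilon> \<longrightarrow>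
              \<not> C1_minimal (max_invariant \<I> S))"
proof (cases "\<exists>\<I> L. interval_system \<I> L \<and> {len J / len L | J. J \<in> \<I>} = R")
  case False
  then show ?thesis by (intro exI[of _ 1]) auto
next
  case True
  then obtain \<I>0 L0 where sys0: "interval_system \<I>0 L0" "{len J / len L0 | J. J \<in> \<I>0} = R" by blast
  obtain r s :: real where rs: "0 < r" "0 < s" "s < 1"
    and bounds: "\<forall>\<I> L. interval_system \<I> L \<and> {len J / len L | J. J \<in> \<I>} = R \<longrightarrow>
       (\<forall>J\<in>\<I>. r \<le> len J / len L) \<and> (\<Sum>J\<in>\<I>. len J / len L) \<le> s \<and> real (card \<I>) * r \<le> 1"
    using ratio_bounds[OF sys0] by (elim exE conjE)
  have number0: "card \<I>0 * r \<le> 1" using bounds sys0 by blast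
  have "2 * r \<le> card \<I>0 * r" using interval_systemD(4)[OF sys0(1)] rs(1) by (intro mult_right_mono) auto
  with number0 have r: "r \<le> 1" using rs(1) by linarith
  \<comment> \<open>Strictly between \<open>s\<close> and 1: \<open>exp \<epsilon> * s\<close> still
    fits below \<open>\<theta>\<close>, and \<open>1 - \<theta>\<close> remains for gaps.\<close>
  define \<theta> where "\<theta> = (1 + s) / 2"
  have \<theta>: "0 < \<theta>" "\<theta> < 1" "s < \<theta>" using rs by (auto simp: \<theta>_def)
  \<comment> \<open>The 2 makes room for the factor \<open>exp \<epsilon> \<le> 2\<close> in the
    lower bound on contraction.\<close>
  define \<kappa> where "\<kappa> = r / 2"
  have \<kappa>: "0 < \<kappa>" "\<kappa> \<le> 1" using rs r by (auto simp: \<kappa>_def)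
  \<comment> \<open>The porosity constant with \<open>1 / card \<I>\<close> replaced by its lower
    bound \<open>r\<close>, so that it depends on \<open>R\<close> only.\<close>
  define \<sigma> where "\<sigma> = \<kappa> * ((1 - \<theta>) * r / 2) / 24"
  have "\<sigma> > 0" using \<kappa> \<theta> rs by (simp add: \<sigma>_def)
  have "(1 - \<theta>) * r \<le> 1 * 1" using \<theta> rs r by (intro mult_mono) auto
  then have "\<kappa> * ((1 - \<theta>) * r / 2) \<le> 1 * 1" using \<kappa> \<theta> rs by (intro mult_mono) auto
  then have "\<sigma> \<le> 1" by (simp add: \<sigma>_def)
  \<comment> \<open>Six times \<open>\<delta>\<close> is half of \<open>ln (1 + \<sigma>)\<close>,
    which gives the strict inequality required for rigidity.\<close>
  define \<delta> where "\<delta> = ln (1 + \<sigma>) / 12"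
  have ln_pos: "ln (1 + \<sigma>) > 0" using \<open>\<sigma> > 0\<close> by simp
  then have \<delta>: "\<delta> > 0" by (simp add: \<delta>_def)
  have "exp \<delta> \<le> exp (ln (1 + \<sigma>))" unfolding exp_le_cancel_iff using ln_pos by (simp add: \<delta>_def)
  also have "\<dots> = 1 + \<sigma>" by (rule exp_ln) (use \<open>\<sigma> > 0\<close> in simp)
  finally have exp_\<delta>: "exp \<delta> \<le> 2" using \<open>\<sigma> \<le> 1\<close> by linarith
  have "exp (2 * (3 * \<delta>)) < exp (ln (1 + \<sigma>))" unfolding exp_less_cancel_iff using ln_pos by (simp add: \<delta>_def)
  also have "\<dots> = 1 + \<sigma>" by (rule exp_ln) (use \<open>\<sigma> > 0\<close> in simp)
  finally have rigid: "exp (2 * (3 * \<delta>)) < 1 + \<sigma>" .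
  obtain \<epsilon>' where \<epsilon>': "\<epsilon>' > 0" "\<And>n. (\<Sum>j<n. min \<epsilon>' (M * \<theta> ^ Suc j)) \<le> \<delta>"
    using sum_min_geometric_small[of M \<theta> \<delta>] assms \<theta> \<delta> by auto
  \<comment> \<open>The three bounds control the accumulated distortion, the lower bound by
    \<open>\<kappa>\<close>, and the total relative length of the pieces.\<close>
  define \<epsilon> where "\<epsilon> = min \<epsilon>' (min (ln 2) (ln (\<theta> / s)))"
  have \<epsilon>: "\<epsilon> > 0" using \<epsilon>'(1) \<theta> rs by (simp add: \<epsilon>_def)
  have "exp \<epsilon> \<le> exp (ln 2)" unfolding exp_le_cancel_iff by (simp add: \<epsilon>_def)
  then have exp_\<epsilon>: "exp \<epsilon> \<le> 2" by simp
  have "exp \<epsilon> \<le> exp (ln (\<theta> / s))" unfolding exp_le_cancel_iff by (simp add: \<epsilon>_def)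
  also have "\<dots> = \<theta> / s" using \<theta> rs by (intro exp_ln) simp
  finally have exp_s: "exp \<epsilon> * s \<le> \<theta>" using rs by (simp add: pos_le_divide_eq)
  have sum_\<epsilon>: "(\<Sum>j<n. min \<epsilon> (M * \<theta> ^ Suc j)) \<le> \<delta>" for n
    by (rule order_trans[OF sum_mono \<epsilon>'(2)]) (simp add: \<epsilon>_def min_le_iff_disj)
  show ?thesis
  proof (intro exI[of _ \<epsilon>] conjI allI impI ballI, rule \<epsilon>)
    fix \<I> L S
    assume sys: "interval_system \<I> L \<and> {len J / len L | J. J \<in> \<I>} = R"
      and S: "S \<in> expanding_maps 2 \<I> L"
      and small: "(\<forall>x\<in>\<Union>\<I>. \<bar>nth_deriv (\<Union>\<I>) 2 S x\<bar> < M) \<and> nonlinearity \<I> S < \<epsilon>"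
    let ?C = "max_invariant \<I> S"
    have ratio: "r \<le> len J / len L" if "J \<in> \<I>" for J using bounds sys that by blast
    have total: "(\<Sum>J\<in>\<I>. len J / len L) \<le> s" and number: "card \<I> * r \<le> 1"
      using bounds sys by blast+
    show "\<not> C1_minimal ?C"
    proof
      assume "C1_minimal ?C"
      then obtain f where f: "circle_C1_diffeo f" "minimal_set f ?C" unfolding C1_minimal_def by blast
      interpret cc: cookie_cutter \<I> S ?C "\<lambda>J. exp \<epsilon> * (len J / len L)" \<theta> \<kappa> \<epsilon> M \<delta>
      proof (rule expanding_map_cookie_cutter)
        \<comment> \<open>A minimal set is nonempty by definition.\<close>
        show "?C \<noteq> {}" using f(2) by (simp add: minimal_set_def)
        have "exp \<epsilon> * (\<Sum>J\<in>\<I>. len J / len L) \<le> exp \<epsilon> * s" using total by (intro mult_left_mono) auto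
        then show "exp \<epsilon> * (\<Sum>J\<in>\<I>. len J / len L) \<le> \<theta>" using exp_s by linarith
        fix J assume "J \<in> \<I>"
        then have "r \<le> len J / len L" by (rule ratio)
        moreover have "\<kappa> * exp \<epsilon> \<le> \<kappa> * 2" using exp_\<epsilon> \<kappa>(1) by (intro mult_left_mono) auto
        moreover have "\<kappa> * 2 = r" by (simp add: \<kappa>_def)
        ultimately show "\<kappa> * exp \<epsilon> \<le> len J / len L" by linarith
      qed (use sys S small assms \<theta> \<kappa> sum_\<epsilon> exp_\<delta> in auto)
      obtain F F' where F: "\<And>x. f (frac x) = frac (F x)" "\<And>x. (F has_real_derivative F' x) (at x)"
        "continuous_on UNIV F'" "\<And>x. F' x \<noteq> 0" "inj F"
        using circle_C1_diffeo_lift[OF f(1)] by blast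
      interpret lm: lifted_minimal f F F' ?C
      proof
        show "inj_on f {0..<1}" using f(1) by (simp add: circle_C1_diffeo_def bij_betw_def circle_def)
        show "?C \<subseteq> {0..<1}"
          using cc.cover interval_systemD(2,7)[of \<I> L] sys by (meson order_trans)
      qed (use F f(2) cc.compact cc.infinite in auto)
      obtain c d where gap: "adjacent ?C c d" by (rule cc.large_gap)
      obtain \<rho> where \<rho>: "\<rho> > 0" "\<And>u v. \<lbrakk>u \<in> ?C; v \<in> ?C; \<bar>u - v\<bar> \<le> \<rho>\<rbrakk> \<Longrightarrow> f u - f v = F u - F v"
        using lm.f_diff_eq by metis
      have rigid': "exp (2 * (3 * \<delta>)) < 1 + \<kappa> * ((1 - \<theta>) / (2 * card \<I>)) / 24"
      proof -
        have card: "card \<I> > 0" using interval_systemD(4)[of \<I> L] sys by simp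
        then have "r \<le> 1 / card \<I>" using number by (simp add: pos_le_divide_eq mult.commute)
        then have "\<kappa> * ((1 - \<theta>) * r / 2) \<le> \<kappa> * ((1 - \<theta>) * (1 / card \<I>) / 2)"
          using \<kappa>(1) \<theta>(2) by (intro mult_left_mono divide_right_mono) auto
        then have "\<sigma> \<le> \<kappa> * ((1 - \<theta>) / (2 * card \<I>)) / 24" by (simp add: \<sigma>_def mult.commute)
        with rigid show ?thesis by linarith
      qed
      show False
      proof (rule lm.no_Lipschitz_distortion[OF gap],
          rule cc.local_Lipschitz_distortion[OF \<kappa>(2) \<delta> rigid' _ lm.distortion_f_small \<rho>(1)])
        show "f ` ?C \<subseteq> ?C" using lm.f_image by simp
        show "monotonic B f" if "B \<subseteq> ?C" "spread_le B \<rho>" for B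
          using that \<rho>(2) unfolding spread_le_def by (intro lm.monotonic_f) blast
        show "adjacent ?C (f u) (f v)" if "adjacent ?C u v" "\<bar>u - v\<bar> \<le> \<rho>" for u v
          using that(1) \<rho>(2)[OF _ _ that(2)] by (intro lm.adjacent_f) (auto simp: adjacent_def)
      qed
    qed
  qed
qed

end
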